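(* Suppose that $G$ is a finitely presented group such that some asymptotic cone of $G$ is an $\mathbb R$-tree. Then $G$ is Gromov-hyperbolic.
   Context: For a finitely generated group $G$ with the word metric of a finite generating set, a non-principal ultrafilter $\omega$ on $\mathbb N$ and a sequence $d=(d_n)$ of positive real scaling constants, unbounded and non-decreasing, the asymptotic cone $\mathrm{Con}^\omega(G,d)$ is the set of sequences $(g_n)$ in $G$ with $\mathrm{dist}(1,g_n)/d_n$ bounded, modulo $\lim^\omega \mathrm{dist}(g_n,h_n)/d_n=0$, with metric $\lim^\omega \mathrm{dist}(g_n,h_n)/d_n$. "Some asymptotic cone" means the cone for at least one choice of $\omega$ and $d$. *)

theory Defs
  imports "HOL-Analysis.Analysis" "HOL-Algebra.Generated_Groups"
begin

section \<open>Free groups and finite presentations\<close>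

text \<open>A letter \<open>(x, True)\<close> stands for the generator \<open>x\<close> and \<open>(x, False)\<close> for its formal
  inverse. Two words are related by \<open>free_rel X\<close> if they become equal after inserting and
  deleting subwords consisting of a letter followed by its formal inverse.\<close>

definition words :: "'x set \<Rightarrow> ('x \<times> bool) list set"
  where "words X = lists (X \<times> UNIV)"

inductive_set free_rel :: "'x set \<Rightarrow> (('x \<times> bool) list \<times> ('x \<times> bool) list) set"
  for X :: "'x set"
  where
    refl_word: "u \<in> words X \<Longrightarrow> (u, u) \<in> free_rel X"
  | symm: "(u, v) \<in> free_rel X \<Longrightarrow> (v, u) \<in> free_rel X"
  | transi: "(u, v) \<in> free_rel X \<Longrightarrow> (v, w) \<in> free_rel X \<Longrightarrow> (u, w) \<in> free_rel X"
  | cancel: "u \<in> words X \<Longrightarrow> v \<in> words X \<Longrightarrow> x \<in> X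
      \<Longrightarrow> (u @ [(x, b), (x, \<not> b)] @ v, u @ v) \<in> free_rel X"

definition free_group :: "'x set \<Rightarrow> ('x \<times> bool) list set monoid"
  where "free_group X =
    \<lparr>carrier = words X // free_rel X,
     monoid.mult = (\<lambda>A B. \<Union>u\<in>A. \<Union>v\<in>B. free_rel X `` {u @ v}),
     one = free_rel X `` {[]}\<rparr>"

definition normal_closure :: "('a, 'b) monoid_scheme \<Rightarrow> 'a set \<Rightarrow> 'a set"
  where "normal_closure G R = \<Inter> {N. N \<lhd> G \<and> R \<subseteq> N}"

definition finitely_presented :: "('a, 'b) monoid_scheme \<Rightarrow> bool"
  where "finitely_presented G \<longleftrightarrow>
    (\<exists>(X :: nat set) R. finite X \<and> finite R \<and> R \<subseteq> carrier (free_group X) \<and>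
       G \<cong> free_group X Mod normal_closure (free_group X) R)"

lemma words_append [simp]: "u @ v \<in> words X \<longleftrightarrow> u \<in> words X \<and> v \<in> words X"
  by (auto simp: words_def)

lemma free_rel_words: "(u, v) \<in> free_rel X \<Longrightarrow> u \<in> words X \<and> v \<in> words X"
  by (induction rule: free_rel.induct) (auto simp: words_def)

lemma equiv_free_rel: "equiv (words X) (free_rel X)"
  by (rule equivI)
    (auto simp: refl_on_def sym_def trans_def dest: free_rel_words
      intro: free_rel.refl_word free_rel.symm free_rel.transi)

lemma free_rel_append_left:
  "(u, v) \<in> free_rel X \<Longrightarrow> w \<in> words X \<Longrightarrow> (w @ u, w @ v) \<in> free_rel X"
proof (induction rule: free_rel.induct)
  case (cancel u v x b)
  then show ?case using free_rel.cancel [of "w @ u" X v x b] by simp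
next
  case (transi u v w')
  then show ?case by (meson free_rel.transi)
qed (auto intro: free_rel.refl_word free_rel.symm)

lemma free_rel_append_right:
  "(u, v) \<in> free_rel X \<Longrightarrow> w \<in> words X \<Longrightarrow> (u @ w, v @ w) \<in> free_rel X"
proof (induction rule: free_rel.induct)
  case (cancel u v x b)
  then show ?case using free_rel.cancel [of u X "v @ w" x b] by simp
next
  case (transi u v w')
  then show ?case by (meson free_rel.transi)
qed (auto intro: free_rel.refl_word free_rel.symm)

lemma free_rel_append:
  assumes "(u, u') \<in> free_rel X" "(v, v') \<in> free_rel X"
  shows "(u @ v, u' @ v') \<in> free_rel X"
  using assms free_rel_words free_rel_append_left free_rel_append_right free_rel.transi by metis

lemma free_group_mult:
  assumes "u \<in> words X" "v \<in> words X"
  shows "free_rel X `` {u} \<otimes>\<^bsub>free_group X\<^esub> free_rel X `` {v} = free_rel X `` {u @ v}"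
proof -
  have *: "free_rel X `` {u' @ v'} = free_rel X `` {u @ v}"
    if "u' \<in> free_rel X `` {u}" "v' \<in> free_rel X `` {v}" for u' v'
    using equiv_class_eq [OF equiv_free_rel free_rel_append [of u u' X v v']] that by simp
  have "(\<Union>u'\<in>free_rel X `` {u}. \<Union>v'\<in>free_rel X `` {v}. free_rel X `` {u' @ v'}) =
      (\<Union>u'\<in>free_rel X `` {u}. \<Union>v'\<in>free_rel X `` {v}. free_rel X `` {u @ v})"
    by (intro SUP_cong HOL.refl *)
  also have "\<dots> = free_rel X `` {u @ v}"
    using equiv_class_self [OF equiv_free_rel assms(1)]
      equiv_class_self [OF equiv_free_rel assms(2)] by blast
  finally show ?thesis
    by (simp add: free_group_def)
qed

lemma free_rel_inverse:
  "u \<in> words X \<Longrightarrow> (map (\<lambda>(x, b). (x, \<not> b)) (rev u) @ u, []) \<in> free_rel X"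
proof (induction u)
  case Nil
  then show ?case by (auto intro: free_rel.refl_word)
next
  case (Cons a u)
  obtain x b where a: "a = (x, b)" by fastforce
  let ?w = "map (\<lambda>(x, b). (x, \<not> b)) (rev u)"
  have u: "u \<in> words X" "x \<in> X" "?w \<in> words X"
    using Cons.prems by (auto simp: words_def a in_lists_conv_set)
  have "(?w @ [(x, \<not> b), (x, \<not> \<not> b)] @ u, ?w @ u) \<in> free_rel X"
    using u by (intro free_rel.cancel)
  then show ?case
    using Cons.IH [OF u(1)] by (auto simp: a intro: free_rel.transi)
qed

lemma free_group_group: "group (free_group X)"
proof (rule groupI)
  have carr: "carrier (free_group X) = (\<lambda>u. free_rel X `` {u}) ` words X"
    by (auto simp: free_group_def quotient_def)
  have nil: "[] \<in> words X" by (simp add: words_def)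
  have one: "\<one>\<^bsub>free_group X\<^esub> = free_rel X `` {[]}" by (simp add: free_group_def)
  show "\<one>\<^bsub>free_group X\<^esub> \<in> carrier (free_group X)"
    using nil by (auto simp: carr one)
  show "A \<otimes>\<^bsub>free_group X\<^esub> B \<in> carrier (free_group X)"
    if "A \<in> carrier (free_group X)" "B \<in> carrier (free_group X)" for A B
    using that by (auto simp: carr free_group_mult)
  show "A \<otimes>\<^bsub>free_group X\<^esub> B \<otimes>\<^bsub>free_group X\<^esub> C =
      A \<otimes>\<^bsub>free_group X\<^esub> (B \<otimes>\<^bsub>free_group X\<^esub> C)"
    if "A \<in> carrier (free_group X)" "B \<in> carrier (free_group X)"
      "C \<in> carrier (free_group X)" for A B C
    using that by (auto simp: carr free_group_mult)
  show "\<one>\<^bsub>free_group X\<^esub> \<otimes>\<^bsub>free_group X\<^esub> A = A"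
    if "A \<in> carrier (free_group X)" for A
    using that nil by (auto simp: carr one free_group_mult)
  show "\<exists>B\<in>carrier (free_group X). B \<otimes>\<^bsub>free_group X\<^esub> A = \<one>\<^bsub>free_group X\<^esub>"
    if "A \<in> carrier (free_group X)" for A
  proof -
    obtain u where u: "u \<in> words X" "A = free_rel X `` {u}"
      using \<open>A \<in> carrier (free_group X)\<close> carr by blast
    let ?w = "map (\<lambda>(x, b). (x, \<not> b)) (rev u)"
    have w: "?w \<in> words X"
      using u by (auto simp: words_def in_lists_conv_set)
    have "free_rel X `` {?w} \<otimes>\<^bsub>free_group X\<^esub> A = \<one>\<^bsub>free_group X\<^esub>"
      using u w equiv_class_eq [OF equiv_free_rel free_rel_inverse [OF u(1)]]
      by (simp add: free_group_mult one)
    then show ?thesis using w by (auto simp: carr)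
  qed
qed

lemma (in group) normal_closure_normal:
  assumes "R \<subseteq> carrier G"
  shows "normal_closure G R \<lhd> G"
proof -
  have "carrier G \<in> {N. N \<lhd> G \<and> R \<subseteq> N}"
    using assms by (auto simp: normal_inv_iff subgroup_self)
  then have "subgroup (\<Inter> {N. N \<lhd> G \<and> R \<subseteq> N}) G"
    by (intro subgroups_Inter) (auto simp: normal_inv_iff)
  then show ?thesis
    by (auto simp: normal_inv_iff normal_closure_def)
qed


section \<open>The word metric\<close>

definition word_length :: "('a, 'b) monoid_scheme \<Rightarrow> 'a set \<Rightarrow> 'a \<Rightarrow> nat"
  where "word_length G S g =
    (LEAST n. \<exists>ws. length ws = n \<and> set ws \<subseteq> S \<union> m_inv G ` S \<and> foldr (monoid.mult G) ws \<one>\<^bsub>G\<^esub> = g)"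

text \<open>The locale \<open>Metric_space M d\<close> demands nonnegativity and symmetry of \<open>d\<close> also outside
  of \<open>M\<close>; this is why distances are set to \<open>0\<close> there, here and in \<open>cone_dist\<close> below.\<close>

definition word_dist :: "('a, 'b) monoid_scheme \<Rightarrow> 'a set \<Rightarrow> 'a \<Rightarrow> 'a \<Rightarrow> real"
  where "word_dist G S g h =
    (if g \<in> carrier G \<and> h \<in> carrier G then real (word_length G S (inv\<^bsub>G\<^esub> g \<otimes>\<^bsub>G\<^esub> h)) else 0)"

definition finite_generating_set :: "('a, 'b) monoid_scheme \<Rightarrow> 'a set \<Rightarrow> bool"
  where "finite_generating_set G S \<longleftrightarrow>
    finite S \<and> S \<subseteq> carrier G \<and> generate G S = carrier G"

context group
begin

lemma foldr_closed: "set ws \<subseteq> carrier G \<Longrightarrow> foldr (\<otimes>) ws \<one> \<in> carrier G"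
  by (induction ws) auto

lemma foldr_append_mult:
  "set us \<subseteq> carrier G \<Longrightarrow> set vs \<subseteq> carrier G
    \<Longrightarrow> foldr (\<otimes>) (us @ vs) \<one> = foldr (\<otimes>) us \<one> \<otimes> foldr (\<otimes>) vs \<one>"
proof (induction us)
  case (Cons a us)
  then show ?case
    using foldr_closed [of us] foldr_closed [of vs] by (simp add: m_assoc)
qed (simp add: foldr_closed)

lemma foldr_inverse:
  "set ws \<subseteq> carrier G \<Longrightarrow> foldr (\<otimes>) (map (m_inv G) (rev ws)) \<one> = inv (foldr (\<otimes>) ws \<one>)"
proof (induction ws)
  case (Cons a ws)
  have "set (map (m_inv G) (rev ws)) \<subseteq> carrier G" using Cons.prems by auto
  then show ?case
    using Cons foldr_closed [of ws] foldr_append_mult [of "map (m_inv G) (rev ws)" "[inv a]"]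
    by (simp add: inv_mult_group)
qed simp

lemma word_exists:
  assumes "S \<subseteq> carrier G" "g \<in> generate G S"
  shows "\<exists>ws. set ws \<subseteq> S \<union> m_inv G ` S \<and> foldr (\<otimes>) ws \<one> = g"
  using assms(2)
proof induction
  case one
  show ?case by (rule exI [of _ "[]"]) simp
next
  case (incl h)
  then show ?case using assms(1) by (intro exI [of _ "[h]"]) auto
next
  case (inv h)
  then show ?case using assms(1) by (intro exI [of _ "[inv h]"]) auto
next
  case (eng h1 h2)
  then obtain us vs where "set us \<subseteq> S \<union> m_inv G ` S" "foldr (\<otimes>) us \<one> = h1"
    "set vs \<subseteq> S \<union> m_inv G ` S" "foldr (\<otimes>) vs \<one> = h2" by blast
  moreover have "S \<union> m_inv G ` S \<subseteq> carrier G" using assms(1) by auto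
  ultimately show ?case
    by (intro exI [of _ "us @ vs"]) (use foldr_append_mult [of us vs] in auto)
qed

lemma word_length_le:
  assumes "set ws \<subseteq> S \<union> m_inv G ` S"
  shows "word_length G S (foldr (\<otimes>) ws \<one>) \<le> length ws"
  unfolding word_length_def by (rule Least_le) (use assms in blast)

lemma word_length_attained:
  assumes "finite_generating_set G S" "g \<in> carrier G"
  obtains ws where "length ws = word_length G S g" "set ws \<subseteq> S \<union> m_inv G ` S"
    "set ws \<subseteq> carrier G" "foldr (\<otimes>) ws \<one> = g"
proof -
  have S: "S \<union> m_inv G ` S \<subseteq> carrier G"
    using assms by (auto simp: finite_generating_set_def)
  have "\<exists>n ws. length ws = n \<and> set ws \<subseteq> S \<union> m_inv G ` S \<and> foldr (\<otimes>) ws \<one> = g"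
    using word_exists [of S g] assms by (auto simp: finite_generating_set_def)
  from LeastI_ex [OF this] show thesis
    using that S unfolding word_length_def by blast
qed

lemma word_length_inv_le:
  assumes S: "finite_generating_set G S" and g: "g \<in> carrier G"
  shows "word_length G S (inv g) \<le> word_length G S g"
proof -
  obtain ws where ws: "length ws = word_length G S g" "set ws \<subseteq> S \<union> m_inv G ` S"
    "set ws \<subseteq> carrier G" "foldr (\<otimes>) ws \<one> = g"
    using word_length_attained [OF S g] .
  have SC: "S \<subseteq> carrier G" using S by (simp add: finite_generating_set_def)
  have "set (map (m_inv G) (rev ws)) \<subseteq> S \<union> m_inv G ` S"
  proof
    fix y assume "y \<in> set (map (m_inv G) (rev ws))"
    then obtain x where "x \<in> S \<union> m_inv G ` S" "y = inv x"
      using ws(2) by (metis imageE set_map set_rev subsetD)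
    then show "y \<in> S \<union> m_inv G ` S" using SC by (auto simp: subset_iff)
  qed
  from word_length_le [OF this] show ?thesis
    using foldr_inverse [OF ws(3)] ws by simp
qed

lemma word_dist_Metric_space:
  assumes S: "finite_generating_set G S"
  shows "Metric_space (carrier G) (word_dist G S)"
proof
  show "0 \<le> word_dist G S x y" for x y by (simp add: word_dist_def)
  have "word_dist G S x y \<le> word_dist G S y x" for x y
    using word_length_inv_le [OF S, of "inv y \<otimes> x"]
    by (auto simp: word_dist_def inv_mult_group)
  then show "word_dist G S x y = word_dist G S y x" for x y
    by (simp add: order_antisym)
  show "word_dist G S x y = 0 \<longleftrightarrow> x = y" if "x \<in> carrier G" "y \<in> carrier G" for x y
  proof
    assume "word_dist G S x y = 0"
    then have 0: "word_length G S (inv x \<otimes> y) = 0" using that by (simp add: word_dist_def)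
    have "inv x \<otimes> y \<in> carrier G" using that by simp
    from word_length_attained [OF S this] have "inv x \<otimes> y = \<one>"
      using 0 by (metis foldr.simps(1) id_apply length_0_conv)
    then show "x = y" using that by (metis inv_closed inv_equality inv_inv)
  next
    assume "x = y"
    then show "word_dist G S x y = 0"
      using that word_length_le [of "[]" S] by (simp add: word_dist_def)
  qed
  show "word_dist G S x z \<le> word_dist G S x y + word_dist G S y z"
    if "x \<in> carrier G" "y \<in> carrier G" "z \<in> carrier G" for x y z
  proof -
    have xy: "inv x \<otimes> y \<in> carrier G" and yz: "inv y \<otimes> z \<in> carrier G"
      using \<open>x \<in> carrier G\<close> \<open>y \<in> carrier G\<close> \<open>z \<in> carrier G\<close> by auto
    obtain us where us: "length us = word_length G S (inv x \<otimes> y)" "set us \<subseteq> S \<union> m_inv G ` S"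
      "set us \<subseteq> carrier G" "foldr (\<otimes>) us \<one> = inv x \<otimes> y"
      using word_length_attained [OF S xy] .
    obtain vs where vs: "length vs = word_length G S (inv y \<otimes> z)" "set vs \<subseteq> S \<union> m_inv G ` S"
      "set vs \<subseteq> carrier G" "foldr (\<otimes>) vs \<one> = inv y \<otimes> z"
      using word_length_attained [OF S yz] .
    have "(inv x \<otimes> y) \<otimes> (inv y \<otimes> z) = inv x \<otimes> z"
      using that by (metis inv_closed inv_solve_left m_assoc m_closed)
    then have "word_length G S (inv x \<otimes> z) \<le> length (us @ vs)"
      using word_length_le [of "us @ vs" S] us vs foldr_append_mult [of us vs] by simp
    then show ?thesis
      using us vs that by (simp add: word_dist_def)
  qed
qed

end


section \<open>Asymptotic cones\<close>

definition nonprincipal_ultrafilter :: "nat filter \<Rightarrow> bool"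
  where "nonprincipal_ultrafilter \<omega> \<longleftrightarrow>
    \<omega> \<noteq> bot \<and>
    (\<forall>P. eventually P \<omega> \<or> eventually (\<lambda>n. \<not> P n) \<omega>) \<and>
    (\<forall>m. \<not> eventually (\<lambda>n. n = m) \<omega>)"

definition scaling_sequence :: "(nat \<Rightarrow> real) \<Rightarrow> bool"
  where "scaling_sequence d \<longleftrightarrow> (\<forall>n. 0 < d n) \<and> mono d \<and> \<not> bdd_above (range d)"

text \<open>In the following definitions \<open>M\<close> with distance \<open>\<rho>\<close> is a metric space, \<open>e\<close> is the base
  point, and \<open>d\<close> is the sequence of scaling constants.\<close>

definition cone_sequences ::
  "'a set \<Rightarrow> ('a \<Rightarrow> 'a \<Rightarrow> real) \<Rightarrow> 'a \<Rightarrow> (nat \<Rightarrow> real) \<Rightarrow> (nat \<Rightarrow> 'a) set"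
  where "cone_sequences M \<rho> e d =
    {g. (\<forall>n. g n \<in> M) \<and> bounded (range (\<lambda>n. \<rho> e (g n) / d n))}"

definition cone_rel ::
  "'a set \<Rightarrow> ('a \<Rightarrow> 'a \<Rightarrow> real) \<Rightarrow> 'a \<Rightarrow> nat filter \<Rightarrow> (nat \<Rightarrow> real)
    \<Rightarrow> ((nat \<Rightarrow> 'a) \<times> (nat \<Rightarrow> 'a)) set"
  where "cone_rel M \<rho> e \<omega> d =
    {(g, h). g \<in> cone_sequences M \<rho> e d \<and> h \<in> cone_sequences M \<rho> e d \<and>
      ((\<lambda>n. \<rho> (g n) (h n) / d n) \<longlongrightarrow> 0) \<omega>}"

definition cone_space ::
  "'a set \<Rightarrow> ('a \<Rightarrow> 'a \<Rightarrow> real) \<Rightarrow> 'a \<Rightarrow> nat filter \<Rightarrow> (nat \<Rightarrow> real) \<Rightarrow> (nat \<Rightarrow> 'a) set set"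
  where "cone_space M \<rho> e \<omega> d = cone_sequences M \<rho> e d // cone_rel M \<rho> e \<omega> d"

definition cone_dist ::
  "'a set \<Rightarrow> ('a \<Rightarrow> 'a \<Rightarrow> real) \<Rightarrow> 'a \<Rightarrow> nat filter \<Rightarrow> (nat \<Rightarrow> real)
    \<Rightarrow> (nat \<Rightarrow> 'a) set \<Rightarrow> (nat \<Rightarrow> 'a) set \<Rightarrow> real"
  where "cone_dist M \<rho> e \<omega> d A B =
    (if A \<in> cone_space M \<rho> e \<omega> d \<and> B \<in> cone_space M \<rho> e \<omega> d
     then (THE l. \<exists>g\<in>A. \<exists>h\<in>B. ((\<lambda>n. \<rho> (g n) (h n) / d n) \<longlongrightarrow> l) \<omega>)
     else 0)"

lemma ultrafilter_limit:
  fixes f :: "nat \<Rightarrow> real"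
  assumes U: "nonprincipal_ultrafilter \<omega>" and b: "bounded (range f)"
  shows "\<exists>l. (f \<longlongrightarrow> l) \<omega>"
proof -
  let ?F = "filtermap f \<omega>"
  have "compact (closure (range f))" using b by (simp add: compact_closure)
  moreover have "?F \<noteq> bot" using U by (simp add: nonprincipal_ultrafilter_def filtermap_bot_iff)
  moreover have "eventually (\<lambda>x. x \<in> closure (range f)) ?F"
    by (simp add: eventually_filtermap closure_subset [THEN subsetD])
  ultimately obtain l where l: "inf (nhds l) ?F \<noteq> bot"
    unfolding compact_filter by blast
  have "(f \<longlongrightarrow> l) \<omega>"
  proof (rule topological_tendstoI)
    fix T assume T: "open T" "l \<in> T"
    show "eventually (\<lambda>n. f n \<in> T) \<omega>"
    proof (rule ccontr)
      assume "\<not> eventually (\<lambda>n. f n \<in> T) \<omega>"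
      then have "eventually (\<lambda>n. f n \<notin> T) \<omega>"
        using U unfolding nonprincipal_ultrafilter_def by blast
      then have "eventually (\<lambda>x. x \<notin> T) ?F" by (simp add: eventually_filtermap)
      moreover have "eventually (\<lambda>x. x \<in> T) (nhds l)"
        using T by (simp add: eventually_nhds_in_open)
      ultimately have "eventually (\<lambda>x. False) (inf (nhds l) ?F)"
        unfolding eventually_inf by blast
      then show False using l by (simp add: trivial_limit_def)
    qed
  qed
  then show ?thesis by blast
qed

locale asymptotic_cone = Metric_space M \<rho>
  for M :: "'a set" and \<rho> :: "'a \<Rightarrow> 'a \<Rightarrow> real" +
  fixes e :: 'a and \<omega> :: "nat filter" and d :: "nat \<Rightarrow> real"
  assumes base: "e \<in> M"
    and ultra: "nonprincipal_ultrafilter \<omega>"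
    and scaling: "scaling_sequence d"
begin

abbreviation "seqs \<equiv> cone_sequences M \<rho> e d"
abbreviation "rel \<equiv> cone_rel M \<rho> e \<omega> d"
abbreviation "points \<equiv> cone_space M \<rho> e \<omega> d"
abbreviation "cdist \<equiv> cone_dist M \<rho> e \<omega> d"

lemma d_pos: "0 < d n"
  using scaling by (simp add: scaling_sequence_def)

lemma omega_nontrivial: "\<omega> \<noteq> bot"
  using ultra by (simp add: nonprincipal_ultrafilter_def)

lemma seqs_in: "g \<in> seqs \<Longrightarrow> g n \<in> M"
  by (simp add: cone_sequences_def)

lemma scaled_triangle:
  assumes "x \<in> M" "y \<in> M" "z \<in> M"
  shows "\<rho> x z / d n \<le> \<rho> x y / d n + \<rho> y z / d n"
  using triangle [OF assms] d_pos [of n] by (simp add: field_simps)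

lemma scaled_limit:
  assumes "g \<in> seqs" "h \<in> seqs"
  shows "\<exists>l. ((\<lambda>n. \<rho> (g n) (h n) / d n) \<longlongrightarrow> l) \<omega>"
proof (rule ultrafilter_limit [OF ultra])
  obtain a b where a: "\<And>n. \<bar>\<rho> e (g n) / d n\<bar> \<le> a" and b: "\<And>n. \<bar>\<rho> e (h n) / d n\<bar> \<le> b"
    using assms by (simp add: cone_sequences_def bounded_iff) blast
  have "\<bar>\<rho> (g n) (h n) / d n\<bar> \<le> a + b" for n
  proof -
    have "\<rho> (g n) (h n) / d n \<le> \<rho> e (g n) / d n + \<rho> e (h n) / d n"
      using scaled_triangle [of "g n" e "h n" n] assms seqs_in base by (simp add: commute)
    moreover have "0 \<le> \<rho> (g n) (h n) / d n" using d_pos [of n] by simp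
    ultimately show ?thesis using a [of n] b [of n] by linarith
  qed
  then show "bounded (range (\<lambda>n. \<rho> (g n) (h n) / d n))"
    by (auto simp: bounded_iff)
qed

lemma limit_le_sum:
  assumes "g \<in> seqs" "h \<in> seqs" "k \<in> seqs"
    and "((\<lambda>n. \<rho> (g n) (k n) / d n) \<longlongrightarrow> a) \<omega>"
    and "((\<lambda>n. \<rho> (g n) (h n) / d n) \<longlongrightarrow> b) \<omega>"
    and "((\<lambda>n. \<rho> (h n) (k n) / d n) \<longlongrightarrow> c) \<omega>"
  shows "a \<le> b + c"
  by (rule tendsto_le [OF omega_nontrivial tendsto_add [OF assms(5,6)] assms(4)])
    (use assms scaled_triangle seqs_in in auto)

lemma limit_nonneg:
  assumes "((\<lambda>n. \<rho> (g n) (h n) / d n) \<longlongrightarrow> a) \<omega>"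
  shows "0 \<le> a"
  by (rule tendsto_lowerbound [OF assms _ omega_nontrivial])
    (simp add: d_pos less_imp_le)

lemma limit_commute:
  "((\<lambda>n. \<rho> (g n) (h n) / d n) \<longlongrightarrow> a) \<omega> \<longleftrightarrow> ((\<lambda>n. \<rho> (h n) (g n) / d n) \<longlongrightarrow> a) \<omega>"
  by (simp add: commute)

lemma equiv_rel: "equiv seqs rel"
proof (rule equivI)
  show "rel \<subseteq> seqs \<times> seqs" by (auto simp: cone_rel_def)
  show "refl_on seqs rel"
    by (auto simp: refl_on_def cone_rel_def seqs_in)
  show "sym rel"
    using limit_commute by (auto simp: sym_def cone_rel_def)
  show "trans rel"
  proof (rule transI)
    fix g h k assume "(g, h) \<in> rel" "(h, k) \<in> rel"
    then have *: "g \<in> seqs" "h \<in> seqs" "k \<in> seqs"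
      "((\<lambda>n. \<rho> (g n) (h n) / d n) \<longlongrightarrow> 0) \<omega>" "((\<lambda>n. \<rho> (h n) (k n) / d n) \<longlongrightarrow> 0) \<omega>"
      by (auto simp: cone_rel_def)
    obtain l where l: "((\<lambda>n. \<rho> (g n) (k n) / d n) \<longlongrightarrow> l) \<omega>"
      using scaled_limit * by blast
    then have "l = 0"
      using limit_le_sum [OF *(1-3) l *(4,5)] limit_nonneg [OF l] by simp
    then show "(g, k) \<in> rel" using * l by (simp add: cone_rel_def)
  qed
qed

lemma cone_cases:
  assumes "A \<in> points"
  obtains g where "g \<in> seqs" "A = rel `` {g}"
  using assms by (auto simp: cone_space_def quotient_def)

lemma cdist_eq:
  assumes g: "g \<in> seqs" and h: "h \<in> seqs"
    and l: "((\<lambda>n. \<rho> (g n) (h n) / d n) \<longlongrightarrow> l) \<omega>"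
  shows "cdist (rel `` {g}) (rel `` {h}) = l"
proof -
  have in_class: "g \<in> rel `` {g}" "h \<in> rel `` {h}"
    using equiv_class_self [OF equiv_rel] g h by auto
  have in_cone: "rel `` {g} \<in> points" "rel `` {h} \<in> points"
    using g h by (auto simp: cone_space_def quotient_def)
  have "l' = l"
    if g': "g' \<in> rel `` {g}" and h': "h' \<in> rel `` {h}"
      and l': "((\<lambda>n. \<rho> (g' n) (h' n) / d n) \<longlongrightarrow> l') \<omega>" for g' h' l'
  proof -
    have s: "g' \<in> seqs" "h' \<in> seqs"
      and g1: "((\<lambda>n. \<rho> (g n) (g' n) / d n) \<longlongrightarrow> 0) \<omega>"
      and h1: "((\<lambda>n. \<rho> (h n) (h' n) / d n) \<longlongrightarrow> 0) \<omega>"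
      using g' h' by (simp_all add: cone_rel_def)
    note gg = g1 g1 [unfolded limit_commute [of g g']]
      and hh = h1 h1 [unfolded limit_commute [of h h']]
    obtain m where m: "((\<lambda>n. \<rho> (g' n) (h n) / d n) \<longlongrightarrow> m) \<omega>"
      using scaled_limit [OF s(1) h] by blast
    have "m \<le> 0 + l" "l \<le> 0 + m" "m \<le> l' + 0" "l' \<le> m + 0"
      using limit_le_sum [OF s(1) g h m gg(2) l] limit_le_sum [OF g s(1) h l gg(1) m]
        limit_le_sum [OF s(1) s(2) h m l' hh(2)] limit_le_sum [OF s(1) h s(2) l' m hh(1)]
      by auto
    then show ?thesis by simp
  qed
  then have "(THE l. \<exists>g'\<in>rel `` {g}. \<exists>h'\<in>rel `` {h}.
      ((\<lambda>n. \<rho> (g' n) (h' n) / d n) \<longlongrightarrow> l) \<omega>) = l"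
    using in_class l by (intro the_equality) blast+
  then show ?thesis using in_cone by (simp add: cone_dist_def)
qed

lemma cone_Metric_space: "Metric_space points cdist"
proof
  have lim: "\<exists>l. ((\<lambda>n. \<rho> (g n) (h n) / d n) \<longlongrightarrow> l) \<omega> \<and> cdist (rel `` {g}) (rel `` {h}) = l"
    if "g \<in> seqs" "h \<in> seqs" for g h
    using scaled_limit [OF that] cdist_eq [OF that] by blast
  have outside: "cdist A B = 0" if "A \<notin> points \<or> B \<notin> points" for A B
    using that by (auto simp: cone_dist_def)
  have inside: "\<exists>g h l. g \<in> seqs \<and> h \<in> seqs \<and> A = rel `` {g} \<and> B = rel `` {h} \<and>
      ((\<lambda>n. \<rho> (g n) (h n) / d n) \<longlongrightarrow> l) \<omega> \<and> cdist A B = l"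
    if AB: "A \<in> points" "B \<in> points" for A B
  proof -
    obtain g where g: "g \<in> seqs" "A = rel `` {g}" using cone_cases [OF AB(1)] by blast
    obtain h where h: "h \<in> seqs" "B = rel `` {h}" using cone_cases [OF AB(2)] by blast
    obtain l where "((\<lambda>n. \<rho> (g n) (h n) / d n) \<longlongrightarrow> l) \<omega>"
      "cdist (rel `` {g}) (rel `` {h}) = l"
      using lim [OF g(1) h(1)] by blast
    then show ?thesis
      using g h by (intro exI [of _ g] exI [of _ h] exI [of _ l]) simp
  qed
  show "0 \<le> cdist A B" for A B
  proof (cases "A \<in> points \<and> B \<in> points")
    case True
    from inside [OF True [THEN conjunct1] True [THEN conjunct2]] obtain g h l where "((\<lambda>n. \<rho> (g n) (h n) / d n) \<longlongrightarrow> l) \<omega>" "cdist A B = l"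
      by blast
    then show ?thesis using limit_nonneg by blast
  qed (use outside in auto)
  show "cdist A B = cdist B A" for A B
  proof (cases "A \<in> points \<and> B \<in> points")
    case True
    from inside [OF True [THEN conjunct1] True [THEN conjunct2]] obtain g h l where *: "g \<in> seqs" "h \<in> seqs" "A = rel `` {g}" "B = rel `` {h}"
      "((\<lambda>n. \<rho> (g n) (h n) / d n) \<longlongrightarrow> l) \<omega>" "cdist A B = l"
      by blast
    have "cdist B A = l"
      unfolding *(3,4) by (rule cdist_eq [OF *(2,1) *(5) [unfolded limit_commute [of g h]]])
    then show ?thesis using *(6) by simp
  qed (use outside in auto)
  show "cdist A B = 0 \<longleftrightarrow> A = B" if AB: "A \<in> points" "B \<in> points" for A B
  proof -
    obtain g where g: "g \<in> seqs" "A = rel `` {g}" using cone_cases [OF AB(1)] by blast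
    obtain h where h: "h \<in> seqs" "B = rel `` {h}" using cone_cases [OF AB(2)] by blast
    have "A = B \<longleftrightarrow> (g, h) \<in> rel"
      unfolding g(2) h(2) by (rule eq_equiv_class_iff [OF equiv_rel g(1) h(1)])
    also have "\<dots> \<longleftrightarrow> ((\<lambda>n. \<rho> (g n) (h n) / d n) \<longlongrightarrow> 0) \<omega>"
      using g h by (simp add: cone_rel_def)
    also have "\<dots> \<longleftrightarrow> cdist A B = 0"
      using lim [OF g(1) h(1)] cdist_eq [OF g(1) h(1)] g(2) h(2) by metis
    finally show ?thesis by simp
  qed
  show "cdist A C \<le> cdist A B + cdist B C" if ABC: "A \<in> points" "B \<in> points" "C \<in> points" for A B C
  proof -
    obtain g where g: "g \<in> seqs" "A = rel `` {g}" using cone_cases [OF ABC(1)] by blast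
    obtain h where h: "h \<in> seqs" "B = rel `` {h}" using cone_cases [OF ABC(2)] by blast
    obtain k where k: "k \<in> seqs" "C = rel `` {k}" using cone_cases [OF ABC(3)] by blast
    obtain p q r where
      "((\<lambda>n. \<rho> (g n) (k n) / d n) \<longlongrightarrow> p) \<omega>" "cdist A C = p"
      "((\<lambda>n. \<rho> (g n) (h n) / d n) \<longlongrightarrow> q) \<omega>" "cdist A B = q"
      "((\<lambda>n. \<rho> (h n) (k n) / d n) \<longlongrightarrow> r) \<omega>" "cdist B C = r"
      using lim [OF g(1) k(1)] lim [OF g(1) h(1)] lim [OF h(1) k(1)] g(2) h(2) k(2) by blast
    then show ?thesis
      using limit_le_sum [OF g(1) h(1) k(1)] by blast
  qed
qed

end

definition group_cone_space ::
  "('a, 'b) monoid_scheme \<Rightarrow> 'a set \<Rightarrow> nat filter \<Rightarrow> (nat \<Rightarrow> real) \<Rightarrow> (nat \<Rightarrow> 'a) set set"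
  where "group_cone_space G S \<omega> d = cone_space (carrier G) (word_dist G S) \<one>\<^bsub>G\<^esub> \<omega> d"

definition group_cone_dist ::
  "('a, 'b) monoid_scheme \<Rightarrow> 'a set \<Rightarrow> nat filter \<Rightarrow> (nat \<Rightarrow> real)
    \<Rightarrow> (nat \<Rightarrow> 'a) set \<Rightarrow> (nat \<Rightarrow> 'a) set \<Rightarrow> real"
  where "group_cone_dist G S \<omega> d = cone_dist (carrier G) (word_dist G S) \<one>\<^bsub>G\<^esub> \<omega> d"

lemma (in group) group_cone_Metric_space:
  assumes "finite_generating_set G S" "nonprincipal_ultrafilter \<omega>" "scaling_sequence d"
  shows "Metric_space (group_cone_space G S \<omega> d) (group_cone_dist G S \<omega> d)"
proof -
  interpret asymptotic_cone "carrier G" "word_dist G S" \<one> \<omega> d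
    using assms word_dist_Metric_space
    by (simp add: asymptotic_cone_def asymptotic_cone_axioms_def)
  show ?thesis
    unfolding group_cone_space_def group_cone_dist_def by (rule cone_Metric_space)
qed


section \<open>Real trees\<close>

definition geodesic_segment ::
  "'a set \<Rightarrow> ('a \<Rightarrow> 'a \<Rightarrow> real) \<Rightarrow> 'a \<Rightarrow> 'a \<Rightarrow> 'a set \<Rightarrow> bool"
  where "geodesic_segment M \<rho> x y I \<longleftrightarrow>
    (\<exists>\<gamma> :: real \<Rightarrow> 'a. \<gamma> 0 = x \<and> \<gamma> (\<rho> x y) = y \<and> \<gamma> ` {0..\<rho> x y} = I \<and> I \<subseteq> M \<and>
       (\<forall>s\<in>{0..\<rho> x y}. \<forall>t\<in>{0..\<rho> x y}. \<rho> (\<gamma> s) (\<gamma> t) = \<bar>s - t\<bar>))"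

text \<open>An \<open>\<real>\<close>-tree is a metric space in which any two points are joined by a unique geodesic
  segment, and in which two segments that meet exactly in a common endpoint form together a
  geodesic segment.\<close>

definition real_tree :: "'a set \<Rightarrow> ('a \<Rightarrow> 'a \<Rightarrow> real) \<Rightarrow> bool"
  where "real_tree M \<rho> \<longleftrightarrow>
    Metric_space M \<rho> \<and>
    (\<forall>x\<in>M. \<forall>y\<in>M. \<exists>!I. geodesic_segment M \<rho> x y I) \<and>
    (\<forall>x\<in>M. \<forall>y\<in>M. \<forall>z\<in>M. \<forall>I J.
       geodesic_segment M \<rho> y x I \<and> geodesic_segment M \<rho> x z J \<and> I \<inter> J = {x}
       \<longrightarrow> geodesic_segment M \<rho> y z (I \<union> J))"


section \<open>Hyperbolicity\<close>

definition gromov_product :: "('a \<Rightarrow> 'a \<Rightarrow> real) \<Rightarrow> 'a \<Rightarrow> 'a \<Rightarrow> 'a \<Rightarrow> real"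
  where "gromov_product \<rho> w x y = (\<rho> w x + \<rho> w y - \<rho> x y) / 2"

definition gromov_hyperbolic :: "'a set \<Rightarrow> ('a \<Rightarrow> 'a \<Rightarrow> real) \<Rightarrow> bool"
  where "gromov_hyperbolic M \<rho> \<longleftrightarrow>
    Metric_space M \<rho> \<and>
    (\<exists>\<delta>\<ge>0. \<forall>w\<in>M. \<forall>x\<in>M. \<forall>y\<in>M. \<forall>z\<in>M.
       gromov_product \<rho> w x z \<ge> min (gromov_product \<rho> w x y) (gromov_product \<rho> w y z) - \<delta>)"

definition hyperbolic_group :: "('a, 'b) monoid_scheme \<Rightarrow> bool"
  where "hyperbolic_group G \<longleftrightarrow>
    (\<exists>S. finite_generating_set G S \<and> gromov_hyperbolic (carrier G) (word_dist G S))"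

end

theory Submission
  imports Defs
begin

text \<open>Since the cone is a tree, at some scale \<open>\<delta>\<close> much larger than the relators all balls of radius \<open>10\<^sup>7 \<delta>\<close> satisfy the
  four-point condition with defect \<open>2 \<delta>\<close>. The rest is a coarse Cartan--Hadamard theorem. A local geodesic issuing from a
  base point can be transported along every edge at its end point: append the edge and straighten. Within balls the result is
  unique up to fellow travelling, so short loops act trivially on classes of local geodesics. The relators being short, all
  loops act trivially, and hence a local geodesic is determined by its end points up to fellow travelling. In a geodesic
  triangle with vertices \<open>o\<close>, \<open>x\<close>, \<open>y\<close>, a geodesic from \<open>o\<close> to a point of the side \<open>xy\<close> continues without a corner towards \<open>x\<close>
  or towards \<open>y\<close>; where the direction switches, both continuations are close to the sides \<open>ox\<close> and \<open>oy\<close>.\<close>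

section \<open>Real trees and asymptotic cones\<close>

text \<open>The cone is a limit along \<open>\<omega>\<close> only, so nothing is known far from the
  chosen scale, and the usual stability of quasi-geodesics, which needs hyperbolicity at all scales,
  is not at hand. What helps is that the scale is chosen after the bound on the relators, and that
  left translation carries the four-point condition from the ball about \<open>\<one>\<close> to all
  balls. The obstacle is accumulation: transport along a word composes as many fellow-travelling
  relations as there are letters, and each composition adds to the constant. Local geodesics with a
  common start, ends within \<open>100 * D\<close> and a track at distance \<open>20000 * D\<close>
  are therefore shown to have one at distance \<open>3000 * D\<close>. So the relation with constant
  \<open>10000 * D\<close> is transitive as long as the end points are close, which is all that
  lifting words needs. The constants form a ladder: ends 100, contracted tracks 3000, the relation
  10000, two of its steps 20000, windows 200000, almost geodesic behaviour 2000000, the four-point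
  condition 10000000, all times \<open>D\<close>. Each rung absorbs the errors of those
  below.\<close>

lemma geodesic_segment_reverse:
  assumes "Metric_space M \<rho>" "geodesic_segment M \<rho> x y I"
  shows "geodesic_segment M \<rho> y x I"
proof -
  interpret Metric_space M \<rho> by fact
  obtain \<gamma> where \<gamma>: "\<gamma> 0 = x" "\<gamma> (\<rho> x y) = y" "\<gamma> ` {0..\<rho> x y} = I" "I \<subseteq> M"
    "\<forall>s\<in>{0..\<rho> x y}. \<forall>t\<in>{0..\<rho> x y}. \<rho> (\<gamma> s) (\<gamma> t) = \<bar>s - t\<bar>"
    using assms(2) unfolding geodesic_segment_def by blast
  have "(\<lambda>t. \<gamma> (\<rho> x y - t)) ` {0..\<rho> x y} = \<gamma> ` ((\<lambda>t. \<rho> x y - t) ` {0..\<rho> x y})"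
    by (simp only: image_image)
  also have "\<dots> = I" using \<gamma>(3) by (simp add: image_diff_atLeastAtMost)
  finally show ?thesis
    unfolding geodesic_segment_def commute [of y x]
    using \<gamma> by (intro exI [of _ "\<lambda>t. \<gamma> (\<rho> x y - t)"]) auto
qed

lemma geodesic_segment_part:
  fixes \<gamma> :: "real \<Rightarrow> 'a"
  assumes "Metric_space M \<rho>" "\<forall>s\<in>{0..a}. \<forall>t\<in>{0..a}. \<rho> (\<gamma> s) (\<gamma> t) = \<bar>s - t\<bar>"
    "\<gamma> ` {0..a} \<subseteq> M" "0 \<le> p" "p \<le> q" "q \<le> a"
  shows "geodesic_segment M \<rho> (\<gamma> p) (\<gamma> q) (\<gamma> ` {p..q})"
proof -
  have d: "\<rho> (\<gamma> p) (\<gamma> q) = q - p" using assms by simp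
  have "(\<lambda>t. \<gamma> (p + t)) ` {0..q - p} = \<gamma> ` ((\<lambda>t. p + t) ` {0..q - p})"
    by (simp only: image_image)
  also have "\<dots> = \<gamma> ` {p..q}" by simp
  finally show ?thesis
    unfolding geodesic_segment_def d
    using assms by (intro exI [of _ "\<lambda>t. \<gamma> (p + t)"]) auto
qed

text \<open>Beyond the last common point the two tails do not meet again: a later common point has
  the same parameter on both, and uniqueness of segments would make the geodesics agree up to it.
  Hence the union of the tails is a geodesic from \<open>y\<close> to \<open>z\<close>, and its
  length puts the point of separation at the Gromov product.\<close>

lemma real_tree_geodesics_agree:
  fixes \<gamma> \<eta> :: "real \<Rightarrow> 'a"
  assumes tree: "real_tree M \<rho>" and M: "x \<in> M" "y \<in> M" "z \<in> M"
    and \<gamma>: "\<gamma> 0 = x" "\<gamma> (\<rho> x y) = y" "\<gamma> ` {0..\<rho> x y} \<subseteq> M"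
      "\<forall>s\<in>{0..\<rho> x y}. \<forall>t\<in>{0..\<rho> x y}. \<rho> (\<gamma> s) (\<gamma> t) = \<bar>s - t\<bar>"
    and \<eta>: "\<eta> 0 = x" "\<eta> (\<rho> x z) = z" "\<eta> ` {0..\<rho> x z} \<subseteq> M"
      "\<forall>s\<in>{0..\<rho> x z}. \<forall>t\<in>{0..\<rho> x z}. \<rho> (\<eta> s) (\<eta> t) = \<bar>s - t\<bar>"
    and s: "0 \<le> s" "s \<le> gromov_product \<rho> x y z"
  shows "\<gamma> s = \<eta> s"
proof -
  interpret Metric_space M \<rho> using tree by (simp add: real_tree_def)
  note ms = Metric_space_axioms
  let ?a = "\<rho> x y" and ?b = "\<rho> x z"
  define T where "T = {t. 0 \<le> t \<and> t \<le> ?a \<and> t \<le> ?b \<and> (\<forall>s. 0 \<le> s \<longrightarrow> s \<le> t \<longrightarrow> \<gamma> s = \<eta> s)}"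
  have "0 \<in> T" using \<gamma>(1) \<eta>(1) by (auto simp: T_def order_antisym)
  moreover have bdd: "bdd_above T" by (auto simp: T_def intro: bdd_aboveI)
  ultimately have t0: "0 \<le> Sup T" by (simp add: cSup_upper)
  define t0 where "t0 = Sup T"
  have t0ab: "0 \<le> t0" "t0 \<le> ?a" "t0 \<le> ?b"
    using t0 \<open>0 \<in> T\<close> by (auto simp: t0_def T_def intro!: cSup_least)
  have below: "\<gamma> s = \<eta> s" if s: "0 \<le> s" "s < t0" for s
  proof -
    obtain t where "t \<in> T" "s < t" using s less_cSupD [of T s] \<open>0 \<in> T\<close> by (auto simp: t0_def)
    then show ?thesis using s by (auto simp: T_def)
  qed
  have inM: "\<gamma> t0 \<in> M" "\<eta> t0 \<in> M" using \<gamma>(3) \<eta>(3) t0ab by auto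
  \<comment> \<open>Agreement is known strictly before \<open>t0\<close> only; continuity of both
    geodesics closes the interval.\<close>
  have m: "\<gamma> t0 = \<eta> t0"
  proof (cases "t0 = 0")
    case True
    then show ?thesis using \<gamma> \<eta> by simp
  next
    case False
    have "\<rho> (\<gamma> t0) (\<eta> t0) \<le> e" if "0 < e" for e
    proof -
      define s where "s = max 0 (t0 - e / 2)"
      have s: "0 \<le> s" "s < t0" "t0 - s \<le> e / 2" using that False t0ab by (auto simp: s_def max_def field_simps)
      have "\<gamma> s \<in> M" using \<gamma>(3) s t0ab by auto
      then show ?thesis
        using triangle [of "\<gamma> t0" "\<gamma> s" "\<eta> t0"] inM \<gamma>(4) [rule_format, of t0 s] \<eta>(4) [rule_format, of s t0] below [OF s(1,2)] s t0ab
        by auto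
    qed
    then have "\<rho> (\<gamma> t0) (\<eta> t0) \<le> 0" by (rule field_le_epsilon) simp
    then have "\<rho> (\<gamma> t0) (\<eta> t0) = 0" using nonneg [of "\<gamma> t0" "\<eta> t0"] by simp
    then show ?thesis using inM by simp
  qed
  let ?I = "\<gamma> ` {t0..?a}" and ?J = "\<eta> ` {t0..?b}"
  have "?I \<inter> ?J = {\<gamma> t0}"
  proof (intro equalityI subsetI)
    fix p assume "p \<in> ?I \<inter> ?J"
    then obtain u v where u: "u \<in> {t0..?a}" "v \<in> {t0..?b}" "p = \<gamma> u" "p = \<eta> v" by auto
    have "u = v" using \<gamma>(4) [rule_format, of 0 u] \<eta>(4) [rule_format, of 0 v] u t0ab \<gamma>(1) \<eta>(1) by auto
    have "geodesic_segment M \<rho> (\<gamma> 0) (\<gamma> u) (\<gamma> ` {0..u})"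
      by (rule geodesic_segment_part [OF ms \<gamma>(4) \<gamma>(3)]) (use u t0ab in auto)
    moreover have "geodesic_segment M \<rho> (\<eta> 0) (\<eta> u) (\<eta> ` {0..u})"
      by (rule geodesic_segment_part [OF ms \<eta>(4) \<eta>(3)]) (use u t0ab \<open>u = v\<close> in auto)
    moreover have "\<gamma> u \<in> M" using \<gamma>(3) u t0ab by auto
    ultimately have eq: "\<gamma> ` {0..u} = \<eta> ` {0..u}"
      using tree M(1) \<gamma>(1) \<eta>(1) u \<open>u = v\<close> unfolding real_tree_def by metis
    \<comment> \<open>The segments agree as sets; since the parameter is the distance from
      \<open>x\<close>, they agree as maps.\<close>
    have "\<gamma> r = \<eta> r" if r: "0 \<le> r" "r \<le> u" for r
    proof -
      have "\<gamma> r \<in> \<eta> ` {0..u}" using eq r by auto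
      then obtain r' where r': "r' \<in> {0..u}" "\<gamma> r = \<eta> r'" by auto
      have "r = r'" using \<gamma>(4) [rule_format, of 0 r] \<eta>(4) [rule_format, of 0 r'] r r' u t0ab \<open>u = v\<close> \<gamma>(1) \<eta>(1) by auto
      then show ?thesis using r' by simp
    qed
    then have "u \<in> T" using u t0ab \<open>u = v\<close> by (auto simp: T_def)
    then have "u \<le> t0" unfolding t0_def using bdd by (rule cSup_upper)
    then show "p \<in> {\<gamma> t0}" using u by auto
  next
    fix p assume "p \<in> {\<gamma> t0}"
    moreover have "\<gamma> t0 \<in> ?I" "\<eta> t0 \<in> ?J" using t0ab by auto
    ultimately show "p \<in> ?I \<inter> ?J" using m by simp
  qed
  moreover have "geodesic_segment M \<rho> y (\<gamma> t0) ?I"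
    using geodesic_segment_reverse [OF ms geodesic_segment_part [OF ms \<gamma>(4) \<gamma>(3), of t0 ?a]] \<gamma>(2) t0ab by simp
  moreover have "geodesic_segment M \<rho> (\<gamma> t0) z ?J"
    using geodesic_segment_part [OF ms \<eta>(4) \<eta>(3), of t0 ?b] \<eta>(2) t0ab m by simp
  ultimately have "geodesic_segment M \<rho> y z (?I \<union> ?J)"
    using tree M(2,3) inM unfolding real_tree_def by blast
  then obtain \<sigma> where \<sigma>: "\<sigma> 0 = y" "\<sigma> (\<rho> y z) = z" "\<sigma> ` {0..\<rho> y z} = ?I \<union> ?J"
    "\<forall>s\<in>{0..\<rho> y z}. \<forall>t\<in>{0..\<rho> y z}. \<rho> (\<sigma> s) (\<sigma> t) = \<bar>s - t\<bar>"
    unfolding geodesic_segment_def by (elim exE conjE) (rule that; assumption)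
  have "\<gamma> t0 \<in> ?I \<union> ?J" using t0ab by auto
  then obtain t where t: "t \<in> {0..\<rho> y z}" "\<gamma> t0 = \<sigma> t" unfolding \<sigma>(3) [symmetric] by blast
  have "\<rho> y (\<gamma> t0) + \<rho> (\<gamma> t0) z = \<rho> y z"
    using \<sigma>(4) [rule_format, of 0 t] \<sigma>(4) [rule_format, of t "\<rho> y z"] \<sigma>(1,2) t by auto
  moreover have "\<rho> y (\<gamma> t0) = ?a - t0" using \<gamma>(4) [rule_format, of ?a t0] \<gamma>(2) t0ab by auto
  moreover have "\<rho> (\<gamma> t0) z = ?b - t0" using \<eta>(4) [rule_format, of t0 ?b] \<eta>(2) t0ab m by auto
  ultimately have "s \<le> t0" using s(2) by (simp add: gromov_product_def)
  then show ?thesis using below [of s] m s(1) by (cases "s = t0") auto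
qed

text \<open>Seen from \<open>x\<close>, the geodesics to \<open>z\<close>, \<open>y\<close> and
  \<open>u\<close> share their point at time \<open>s\<close>, the smaller of the two Gromov
  products with \<open>y\<close>; going from \<open>z\<close> to \<open>u\<close> through it bounds
  the third product from below. The four-point inequality is this ultrametric inequality multiplied
  out.\<close>

lemma real_tree_four_point:
  assumes tree: "real_tree M \<rho>" and M: "x \<in> M" "y \<in> M" "z \<in> M" "u \<in> M"
  shows "\<rho> x y + \<rho> z u \<le> max (\<rho> x z + \<rho> y u) (\<rho> x u + \<rho> y z)"
proof -
  interpret Metric_space M \<rho> using tree by (simp add: real_tree_def)
  have geo: "\<exists>\<gamma>::real \<Rightarrow> 'a. \<gamma> 0 = x \<and> \<gamma> (\<rho> x p) = p \<and> \<gamma> ` {0..\<rho> x p} \<subseteq> M \<and>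
      (\<forall>s\<in>{0..\<rho> x p}. \<forall>t\<in>{0..\<rho> x p}. \<rho> (\<gamma> s) (\<gamma> t) = \<bar>s - t\<bar>)" if "p \<in> M" for p
    using tree M(1) that unfolding real_tree_def geodesic_segment_def by metis
  obtain f where f: "f 0 = x" "f (\<rho> x z) = z" "f ` {0..\<rho> x z} \<subseteq> M"
    "\<forall>s\<in>{0..\<rho> x z}. \<forall>t\<in>{0..\<rho> x z}. \<rho> (f s) (f t) = \<bar>s - t\<bar>" using geo [OF M(3)] by blast
  obtain g where g: "g 0 = x" "g (\<rho> x y) = y" "g ` {0..\<rho> x y} \<subseteq> M"
    "\<forall>s\<in>{0..\<rho> x y}. \<forall>t\<in>{0..\<rho> x y}. \<rho> (g s) (g t) = \<bar>s - t\<bar>" using geo [OF M(2)] by blast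
  obtain h where h: "h 0 = x" "h (\<rho> x u) = u" "h ` {0..\<rho> x u} \<subseteq> M"
    "\<forall>s\<in>{0..\<rho> x u}. \<forall>t\<in>{0..\<rho> x u}. \<rho> (h s) (h t) = \<bar>s - t\<bar>" using geo [OF M(4)] by blast
  define s where "s = min (gromov_product \<rho> x z y) (gromov_product \<rho> x y u)"
  have s0: "0 \<le> s" "s \<le> \<rho> x z" "s \<le> \<rho> x u"
  proof -
    have gp: "0 \<le> gromov_product \<rho> x p q \<and> gromov_product \<rho> x p q \<le> \<rho> x p \<and> gromov_product \<rho> x p q \<le> \<rho> x q"
      if "p \<in> M" "q \<in> M" for p q
    proof -
      have "\<rho> p q \<le> \<rho> x p + \<rho> x q" "\<rho> x p \<le> \<rho> x q + \<rho> p q" "\<rho> x q \<le> \<rho> x p + \<rho> p q"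
        using triangle [of p x q] triangle [of x q p] triangle [of x p q] M(1) that
        by (simp_all add: commute [of p x] commute [of q p])
      then show ?thesis by (simp add: gromov_product_def)
    qed
    show "0 \<le> s" "s \<le> \<rho> x z" "s \<le> \<rho> x u"
      using gp [OF M(3,2)] gp [OF M(2,4)] by (auto simp: s_def)
  qed
  have "f s = g s"
    by (rule real_tree_geodesics_agree [OF tree M(1,3,2) f g s0(1)]) (simp add: s_def)
  moreover have "g s = h s"
    by (rule real_tree_geodesics_agree [OF tree M(1,2,4) g h s0(1)]) (simp add: s_def)
  moreover have "f s \<in> M" using f(3) s0 by auto
  ultimately have "\<rho> z u \<le> (\<rho> x z - s) + (\<rho> x u - s)"
    using triangle [of z "f s" u] f(4) [rule_format, of "\<rho> x z" s] h(4) [rule_format, of s "\<rho> x u"] f(2,3) h(2,3) s0 M by auto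
  then show ?thesis
    using commute [of y z] by (auto simp: s_def gromov_product_def min_def max_def field_simps split: if_splits)
qed

section \<open>From the cone back to a single scale\<close>

context asymptotic_cone begin

lemma eventually_ge: "eventually (\<lambda>n. m \<le> n) \<omega>"
proof -
  have "eventually (\<lambda>n. n \<noteq> k) \<omega>" for k
    using ultra unfolding nonprincipal_ultrafilter_def by blast
  then have "eventually (\<lambda>n. \<forall>k\<in>{..<m}. n \<noteq> k) \<omega>"
    by (simp add: eventually_ball_finite_distrib)
  then show ?thesis by (rule eventually_mono) (auto simp: not_less)
qed

lemma eventually_scale_ge: "eventually (\<lambda>n. c \<le> d n) \<omega>"
proof -
  have "mono d" "\<not> bdd_above (range d)" using scaling by (auto simp: scaling_sequence_def)
  then obtain m where "c \<le> d m" by (meson bdd_aboveI2 nle_le)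
  then have "c \<le> d n" if "m \<le> n" for n using monoD [OF \<open>mono d\<close> that] by simp
  then show ?thesis by (rule eventually_mono [OF eventually_ge])
qed

text \<open>For an ultrafilter, failure means failure almost everywhere. Violating quadruples stay
  within \<open>d n\<close> of \<open>e\<close>, so they form four points of the cone; dividing by
  \<open>d n\<close> and passing to the limit keeps the gap \<open>\<epsilon>\<close>, against the
  exact inequality in a tree.\<close>

lemma eventually_four_point:
  assumes tree: "real_tree points cdist" and "0 < \<epsilon>"
  shows "eventually (\<lambda>n. \<forall>x\<in>M. \<forall>y\<in>M. \<forall>z\<in>M. \<forall>u\<in>M. \<rho> e x \<le> d n \<longrightarrow> \<rho> e y \<le> d n \<longrightarrow> \<rho> e z \<le> d n \<longrightarrow> \<rho> e u \<le> d n \<longrightarrow>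
    \<rho> x y + \<rho> z u \<le> max (\<rho> x z + \<rho> y u) (\<rho> x u + \<rho> y z) + \<epsilon> * d n) \<omega>"
    (is "eventually (\<lambda>n. ?good n) \<omega>")
proof (rule ccontr)
  assume "\<not> ?thesis"
  then have bad: "eventually (\<lambda>n. \<not> ?good n) \<omega>"
    using ultra unfolding nonprincipal_ultrafilter_def by blast
  define near where "near n x \<longleftrightarrow> x \<in> M \<and> \<rho> e x \<le> d n" for n x
  \<comment> \<open>For those \<open>n\<close> without a violation the choice still needs some
    admissible points; \<open>e\<close> serves.\<close>
  have "near n e" for n using base d_pos [of n] by (simp add: near_def)
  then have "\<forall>n. \<exists>x y z u. near n x \<and> near n y \<and> near n z \<and> near n u \<and>
      (\<not> ?good n \<longrightarrow> max (\<rho> x z + \<rho> y u) (\<rho> x u + \<rho> y z) + \<epsilon> * d n < \<rho> x y + \<rho> z u)"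
    unfolding near_def by (metis (no_types, lifting) not_le)
  then obtain x y z u where near: "\<And>n. near n (x n)" "\<And>n. near n (y n)" "\<And>n. near n (z n)" "\<And>n. near n (u n)"
    and viol: "\<And>n. \<not> ?good n \<Longrightarrow> max (\<rho> (x n) (z n) + \<rho> (y n) (u n)) (\<rho> (x n) (u n) + \<rho> (y n) (z n)) + \<epsilon> * d n
      < \<rho> (x n) (y n) + \<rho> (z n) (u n)"
    by metis
  have seqs: "g \<in> seqs" if "\<And>n. near n (g n)" for g
  proof -
    have "\<bar>\<rho> e (g n) / d n\<bar> \<le> 1" for n
      using that [of n] d_pos [of n] by (simp add: near_def field_simps)
    then show ?thesis using that by (auto simp: cone_sequences_def near_def bounded_iff)
  qed
  define a where "a g h = cdist (rel `` {g}) (rel `` {h})" for g h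
  have lim: "((\<lambda>n. \<rho> (g n) (h n) / d n) \<longlongrightarrow> a g h) \<omega>" if "g \<in> seqs" "h \<in> seqs" for g h
    using scaled_limit [OF that] cdist_eq [OF that] by (auto simp: a_def)
  note s = seqs [OF near(1)] seqs [OF near(2)] seqs [OF near(3)] seqs [OF near(4)]
  have points: "rel `` {g} \<in> points" if "g \<in> seqs" for g
    using that by (auto simp: cone_space_def quotient_def)
  have "max (a x z + a y u) (a x u + a y z) + \<epsilon> \<le> a x y + a z u"
  proof (rule tendsto_le [OF omega_nontrivial])
    show "((\<lambda>n. \<rho> (x n) (y n) / d n + \<rho> (z n) (u n) / d n) \<longlongrightarrow> a x y + a z u) \<omega>"
      by (intro tendsto_intros lim s)
    show "((\<lambda>n. max (\<rho> (x n) (z n) / d n + \<rho> (y n) (u n) / d n) (\<rho> (x n) (u n) / d n + \<rho> (y n) (z n) / d n) + \<epsilon>)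
        \<longlongrightarrow> max (a x z + a y u) (a x u + a y z) + \<epsilon>) \<omega>"
      by (intro tendsto_intros tendsto_max lim s)
    show "eventually (\<lambda>n. max (\<rho> (x n) (z n) / d n + \<rho> (y n) (u n) / d n) (\<rho> (x n) (u n) / d n + \<rho> (y n) (z n) / d n) + \<epsilon>
        \<le> \<rho> (x n) (y n) / d n + \<rho> (z n) (u n) / d n) \<omega>"
      using bad
    proof (rule eventually_mono)
      fix n assume "\<not> ?good n"
      have scale: "p / d n + \<epsilon> \<le> q / d n" if "p + \<epsilon> * d n \<le> q" for p q
        using divide_right_mono [OF that less_imp_le [OF d_pos [of n]]] d_pos [of n] by (simp add: add_divide_distrib)
      from viol [OF \<open>\<not> ?good n\<close>] show "max (\<rho> (x n) (z n) / d n + \<rho> (y n) (u n) / d n) (\<rho> (x n) (u n) / d n + \<rho> (y n) (z n) / d n) + \<epsilon>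
        \<le> \<rho> (x n) (y n) / d n + \<rho> (z n) (u n) / d n"
        unfolding add_divide_distrib [symmetric]
        using scale [of "\<rho> (x n) (z n) + \<rho> (y n) (u n)" "\<rho> (x n) (y n) + \<rho> (z n) (u n)"]
          scale [of "\<rho> (x n) (u n) + \<rho> (y n) (z n)" "\<rho> (x n) (y n) + \<rho> (z n) (u n)"] by linarith
    qed
  qed
  moreover have "a x y + a z u \<le> max (a x z + a y u) (a x u + a y z)"
    unfolding a_def using s points by (intro real_tree_four_point [OF tree]) auto
  ultimately show False using \<open>0 < \<epsilon>\<close> by simp
qed

end

section \<open>Finite presentations and lifting of words\<close>

text \<open>The isomorphism is inverted so that words evaluate in \<open>G\<close>; afterwards the
  quotient group occurs only through its kernel.\<close>

lemma (in group) evaluation_of_presentation: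
  assumes R: "R \<subseteq> carrier (free_group X)"
    and iso: "G \<cong> free_group X Mod normal_closure (free_group X) R"
  obtains \<phi> where
    "\<And>u. u \<in> words X \<Longrightarrow> \<phi> u \<in> carrier G"
    "\<And>u v. u \<in> words X \<Longrightarrow> v \<in> words X \<Longrightarrow> \<phi> (u @ v) = \<phi> u \<otimes> \<phi> v"
    "\<And>u v. (u, v) \<in> free_rel X \<Longrightarrow> \<phi> u = \<phi> v"
    "\<And>g. g \<in> carrier G \<Longrightarrow> \<exists>u\<in>words X. \<phi> u = g"
    "\<And>u. u \<in> words X \<Longrightarrow> \<phi> u = \<one> \<longleftrightarrow> free_rel X `` {u} \<in> normal_closure (free_group X) R"
proof -
  let ?F = "free_group X" and ?K = "normal_closure (free_group X) R"
  interpret F: group ?F by (rule free_group_group)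
  interpret K: normal ?K ?F by (rule F.normal_closure_normal [OF R])
  interpret Q: group "?F Mod ?K" by (rule K.factorgroup_is_group)
  obtain h0 where "h0 \<in> iso G (?F Mod ?K)" using iso by (auto simp: is_iso_def)
  then obtain h where h: "h \<in> iso (?F Mod ?K) G" using iso_set_sym by blast
  then have hom: "h \<in> hom (?F Mod ?K) G" and surj: "h ` carrier (?F Mod ?K) = carrier G"
    and inj: "inj_on h (carrier (?F Mod ?K))"
    by (auto simp: iso_iff)
  interpret h: group_hom "?F Mod ?K" G h
    using hom by (simp add: group_hom_def group_hom_axioms_def Q.group_axioms)
  have carr: "carrier ?F = (\<lambda>u. free_rel X `` {u}) ` words X"
    by (auto simp: free_group_def quotient_def)
  have carrQ: "carrier (?F Mod ?K) = (\<lambda>c. ?K #>\<^bsub>?F\<^esub> c) ` carrier ?F"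
    by (auto simp: FactGroup_def RCOSETS_def)
  define \<phi> where "\<phi> u = h (?K #>\<^bsub>?F\<^esub> (free_rel X `` {u}))" for u
  have cos: "?K #>\<^bsub>?F\<^esub> (free_rel X `` {u}) \<in> carrier (?F Mod ?K)" if "u \<in> words X" for u
    using that carr carrQ by auto
  show thesis
  proof
    show "\<phi> u \<in> carrier G" if "u \<in> words X" for u
      using cos [OF that] by (simp add: \<phi>_def)
    show "\<phi> (u @ v) = \<phi> u \<otimes> \<phi> v" if uv: "u \<in> words X" "v \<in> words X" for u v
    proof -
      have c: "free_rel X `` {u} \<in> carrier ?F" "free_rel X `` {v} \<in> carrier ?F" using uv carr by auto
      have "?K #>\<^bsub>?F\<^esub> (free_rel X `` {u @ v}) =
          (?K #>\<^bsub>?F\<^esub> (free_rel X `` {u})) \<otimes>\<^bsub>?F Mod ?K\<^esub> (?K #>\<^bsub>?F\<^esub> (free_rel X `` {v}))"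
        using K.r_coset_hom_Mod c by (simp add: hom_def free_group_mult [OF uv, symmetric])
      then show ?thesis using h.hom_mult [OF cos [OF uv(1)] cos [OF uv(2)]] by (simp only: \<phi>_def)
    qed
    show "\<phi> u = \<phi> v" if "(u, v) \<in> free_rel X" for u v
      using equiv_class_eq [OF equiv_free_rel that] by (simp add: \<phi>_def)
    show "\<exists>u\<in>words X. \<phi> u = g" if "g \<in> carrier G" for g
      using that unfolding surj [symmetric] carrQ carr \<phi>_def by blast
    show "\<phi> u = \<one> \<longleftrightarrow> free_rel X `` {u} \<in> ?K" if u: "u \<in> words X" for u
    proof -
      have one: "\<one>\<^bsub>?F Mod ?K\<^esub> = ?K" by (simp add: FactGroup_def)
      have c: "free_rel X `` {u} \<in> carrier ?F" using u carr by auto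
      have "\<phi> u = \<one> \<longleftrightarrow> h (?K #>\<^bsub>?F\<^esub> (free_rel X `` {u})) = h \<one>\<^bsub>?F Mod ?K\<^esub>"
        by (simp only: \<phi>_def h.hom_one)
      also have "\<dots> \<longleftrightarrow> ?K #>\<^bsub>?F\<^esub> (free_rel X `` {u}) = \<one>\<^bsub>?F Mod ?K\<^esub>"
        by (rule inj_on_eq_iff [OF inj cos [OF u] Q.one_closed])
      also have "\<dots> \<longleftrightarrow> free_rel X `` {u} \<in> ?K"
        unfolding one using F.coset_join1 [OF _ c K.subgroup_axioms] F.coset_join2 [OF c K.subgroup_axioms] by blast
      finally show ?thesis .
    qed
  qed
qed

section \<open>Homotopy of words across short loops\<close>

text \<open>Two words are related if, as paths in the Cayley graph, they are homotopic after discs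
  are glued to all loops of length at most \<open>N\<close>. Every short trivial word may be
  inserted, not just images of given relators, so the relation refers to no presentation.\<close>

inductive word_eq :: "('a, 'b) monoid_scheme \<Rightarrow> 'a set \<Rightarrow> nat \<Rightarrow> 'a list \<Rightarrow> 'a list \<Rightarrow> bool"
  for G :: "('a, 'b) monoid_scheme" (structure) and A :: "'a set" and N :: nat
  where
    refl: "set u \<subseteq> A \<Longrightarrow> word_eq G A N u u"
  | sym: "word_eq G A N u v \<Longrightarrow> word_eq G A N v u"
  | trans: "word_eq G A N u v \<Longrightarrow> word_eq G A N v w \<Longrightarrow> word_eq G A N u w"
  | insert: "set u \<subseteq> A \<Longrightarrow> set v \<subseteq> A \<Longrightarrow> set t \<subseteq> A \<Longrightarrow> length t \<le> N \<Longrightarrow> foldr (\<otimes>) t \<one> = \<one> \<Longrightarrow>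
      word_eq G A N (u @ v) (u @ t @ v)"

lemma word_eq_sets: "word_eq G A N u v \<Longrightarrow> set u \<subseteq> A \<and> set v \<subseteq> A"
  by (induction rule: word_eq.induct) auto

lemma (in group) word_eq_foldr:
  "word_eq G A N u v \<Longrightarrow> A \<subseteq> carrier G \<Longrightarrow> foldr (\<otimes>) u \<one> = foldr (\<otimes>) v \<one>"
proof (induction rule: word_eq.induct)
  case (insert u v t)
  then have "set u \<subseteq> carrier G" "set v \<subseteq> carrier G" "set t \<subseteq> carrier G" by auto
  then show ?case using insert foldr_closed [of v] by (simp add: foldr_append_mult del: foldr_append)
qed auto

lemma word_eq_append:
  "word_eq G A N u v \<Longrightarrow> set p \<subseteq> A \<Longrightarrow> set q \<subseteq> A \<Longrightarrow> word_eq G A N (p @ u @ q) (p @ v @ q)"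
proof (induction rule: word_eq.induct)
  case (insert u v t)
  then show ?case using word_eq.insert [of "p @ u" A "v @ q" t N G] by simp
next
  case (refl u)
  then show ?case by (intro word_eq.refl) simp
qed (auto intro: word_eq.sym word_eq.trans)

lemma word_eq_append2:
  assumes "word_eq G A N u u'" "word_eq G A N v v'"
  shows "word_eq G A N (u @ v) (u' @ v')"
proof -
  have s: "set u' \<subseteq> A" "set v \<subseteq> A" using word_eq_sets assms by blast+
  show ?thesis
    using word_eq_append [OF assms(1), of "[]" v] word_eq_append [OF assms(2), of u' "[]"] s
    by (auto intro: word_eq.trans)
qed

abbreviation formal_inverse :: "('x \<times> bool) list \<Rightarrow> ('x \<times> bool) list"
  where "formal_inverse u \<equiv> map (\<lambda>(x, b). (x, \<not> b)) (rev u)"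

lemma formal_inverse_words: "u \<in> words X \<Longrightarrow> formal_inverse u \<in> words X"
  by (auto simp: words_def in_lists_conv_set)

lemma formal_inverse_inverse: "formal_inverse (formal_inverse u) = u"
  by (simp add: rev_map [symmetric] comp_def case_prod_beta)

lemma bounded_by_nat: "finite B \<Longrightarrow> \<exists>N :: nat. \<forall>x\<in>B. f x \<le> N"
  by (metis finite_imageI finite_nat_set_iff_bounded_le image_eqI)

text \<open>This is coarse simple connectedness of the Cayley graph for the given \<open>S\<close>,
  whatever generators \<open>X\<close> the presentation uses. Words are translated both ways; the
  elements of the free group whose translation is null-homotopic form a normal subgroup that
  contains the relators, hence their normal closure.\<close>

lemma (in group) finitely_presented_word_eq:
  assumes fp: "finitely_presented G" and S: "finite_generating_set G S"
  shows "\<exists>N\<ge>1. \<forall>w w'. set w \<subseteq> S \<union> m_inv G ` S \<longrightarrow> set w' \<subseteq> S \<union> m_inv G ` S \<longrightarrow>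
    foldr (\<otimes>) w \<one> = foldr (\<otimes>) w' \<one> \<longrightarrow> word_eq G (S \<union> m_inv G ` S) N w w'"
proof -
  define A where "A = S \<union> m_inv G ` S"
  have A: "A \<subseteq> carrier G" "finite A" using S by (auto simp: A_def finite_generating_set_def)
  have inv_A: "inv a \<in> A" if "a \<in> A" for a
    using that S by (auto simp: A_def finite_generating_set_def subset_iff)
  obtain X :: "nat set" and R where X: "finite X" "finite R" and R: "R \<subseteq> carrier (free_group X)"
    and iso: "G \<cong> free_group X Mod normal_closure (free_group X) R"
    using fp unfolding finitely_presented_def by blast
  interpret F: group "free_group X" by (rule free_group_group)
  obtain \<phi> where \<phi>: "\<And>u. u \<in> words X \<Longrightarrow> \<phi> u \<in> carrier G"
    and \<phi>_append: "\<And>u v. u \<in> words X \<Longrightarrow> v \<in> words X \<Longrightarrow> \<phi> (u @ v) = \<phi> u \<otimes> \<phi> v"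
    and \<phi>_rel: "\<And>u v. (u, v) \<in> free_rel X \<Longrightarrow> \<phi> u = \<phi> v"
    and \<phi>_surj: "\<And>g. g \<in> carrier G \<Longrightarrow> \<exists>u\<in>words X. \<phi> u = g"
    and \<phi>_one: "\<And>u. u \<in> words X \<Longrightarrow> \<phi> u = \<one> \<longleftrightarrow> free_rel X `` {u} \<in> normal_closure (free_group X) R"
    using evaluation_of_presentation [OF R iso] by blast
  have nil: "[] \<in> words X" by (simp add: words_def)
  have \<phi>_nil: "\<phi> [] = \<one>" using \<phi>_append [OF nil nil] \<phi> [OF nil] by (simp add: l_cancel_one')
  have letter: "[(x, b)] \<in> words X" if "x \<in> X" for x b using that by (simp add: words_def)
  have "\<exists>us. set us \<subseteq> A \<and> foldr (\<otimes>) us \<one> = \<phi> [l]" if "fst l \<in> X" for l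
    using word_length_attained [OF S \<phi> [OF letter [OF that, of "snd l"]]] unfolding A_def by (metis prod.collapse)
  then obtain U where U: "\<And>l. fst l \<in> X \<Longrightarrow> set (U l) \<subseteq> A \<and> foldr (\<otimes>) (U l) \<one> = \<phi> [l]" by metis
  define V where "V u = concat (map U u)" for u
  have V_append: "V (u @ v) = V u @ V v" for u v by (simp add: V_def)
  have V_nil: "V [] = []" by (simp add: V_def)
  have words_Cons: "l # u \<in> words X \<longleftrightarrow> fst l \<in> X \<and> u \<in> words X" for l u
    by (cases l) (auto simp: words_def)
  have V: "set (V u) \<subseteq> A \<and> foldr (\<otimes>) (V u) \<one> = \<phi> u" if "u \<in> words X" for u
    using that
  proof (induction u)
    case Nil
    then show ?case by (simp add: V_nil \<phi>_nil)
  next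
    case (Cons l u)
    then have l: "fst l \<in> X" "u \<in> words X" "[l] \<in> words X" using words_Cons nil by auto
    have *: "V (l # u) = U l @ V u" by (simp add: V_def)
    show ?case
      using Cons.IH [OF l(2)] U [OF l(1)] \<phi>_append [OF l(3,2)] A(1) unfolding *
      by (subst foldr_append_mult) auto
  qed
  have "\<exists>v\<in>words X. \<phi> v = a" if "a \<in> A" for a using \<phi>_surj that A by blast
  then obtain v where v: "\<And>a. a \<in> A \<Longrightarrow> v a \<in> words X \<and> \<phi> (v a) = a" by metis
  have "\<exists>u\<in>words X. r = free_rel X `` {u}" if "r \<in> R" for r
    using R that by (auto simp: free_group_def quotient_def)
  then obtain \<rho> where \<rho>: "\<And>r. r \<in> R \<Longrightarrow> \<rho> r \<in> words X \<and> r = free_rel X `` {\<rho> r}" by metis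
  \<comment> \<open>The three bounds pay for a cancelling pair of letters, for replacing a letter of
    \<open>A\<close> by its translation back and forth, and for a relator; the summand 2 leaves room
    for \<open>[inv a, a]\<close>.\<close>
  obtain N1 where N1: "\<forall>l\<in>X \<times> UNIV. length (U l @ U (fst l, \<not> snd l)) \<le> N1"
    using bounded_by_nat [of "X \<times> UNIV" "\<lambda>l. length (U l @ U (fst l, \<not> snd l))"] X by auto
  obtain N2 where N2: "\<forall>a\<in>A. length (V (v a)) + 2 \<le> N2"
    using bounded_by_nat [OF A(2), of "\<lambda>a. length (V (v a)) + 2"] by auto
  obtain N3 where N3: "\<forall>r\<in>R. length (V (\<rho> r)) \<le> N3"
    using bounded_by_nat [OF X(2), of "\<lambda>r. length (V (\<rho> r))"] by auto
  define N where "N = N1 + N2 + N3 + 1"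
  note eq_refl = word_eq.refl [of _ A G N] and eq_sym = word_eq.sym [of G A N] and eq_trans = word_eq.trans [of G A N]
  have V_rel: "word_eq G A N (V u) (V u')" if "(u, u') \<in> free_rel X" for u u'
    using that
  proof (induction rule: free_rel.induct)
    case (refl_word u)
    then show ?case using V by (auto intro: eq_refl)
  next
    case (cancel u v x b)
    have "foldr (\<otimes>) (V [(x, b), (x, \<not> b)]) \<one> = \<phi> [(x, b), (x, \<not> b)]"
      using V letter [OF cancel(3)] words_Cons cancel(3) nil by simp
    also have "\<dots> = \<one>"
      using \<phi>_rel [OF free_rel.cancel [OF nil nil cancel(3), of b]] by (simp add: \<phi>_nil)
    finally have one: "foldr (\<otimes>) (V [(x, b), (x, \<not> b)]) \<one> = \<one>" .
    have s: "set (V [(x, b), (x, \<not> b)]) \<subseteq> A" using V words_Cons cancel(3) nil by simp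
    have "length (V [(x, b), (x, \<not> b)]) \<le> N"
      using bspec [OF N1, of "(x, b)"] cancel(3) by (simp add: V_def N_def)
    then have "word_eq G A N (V u @ V v) (V u @ V [(x, b), (x, \<not> b)] @ V v)"
      using V cancel s one by (intro word_eq.insert) auto
    then show ?case by (simp only: V_append eq_sym)
  qed (auto intro: eq_sym eq_trans)
  have inv_rel: "(u @ formal_inverse u, []) \<in> free_rel X" if "u \<in> words X" for u
    using free_rel_inverse [OF formal_inverse_words [OF that]] by (simp only: formal_inverse_inverse)
  define T where "T = {free_rel X `` {u} | u. u \<in> words X \<and> word_eq G A N (V u) []}"
  have T: "free_rel X `` {u} \<in> T \<longleftrightarrow> word_eq G A N (V u) []" if "u \<in> words X" for u
  proof
    assume "free_rel X `` {u} \<in> T"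
    then obtain u' where u': "u' \<in> words X" "word_eq G A N (V u') []" "free_rel X `` {u} = free_rel X `` {u'}"
      by (auto simp: T_def)
    then have "(u, u') \<in> free_rel X" using eq_equiv_class [OF _ equiv_free_rel] by blast
    then show "word_eq G A N (V u) []" using V_rel u' by (blast intro: eq_trans)
  qed (use that in \<open>auto simp: T_def\<close>)
  have carr: "carrier (free_group X) = (\<lambda>u. free_rel X `` {u}) ` words X"
    by (auto simp: free_group_def quotient_def)
  have inv_class: "inv\<^bsub>free_group X\<^esub> (free_rel X `` {u}) = free_rel X `` {formal_inverse u}" if "u \<in> words X" for u
  proof (rule F.inv_equality)
    show "free_rel X `` {formal_inverse u} \<otimes>\<^bsub>free_group X\<^esub> free_rel X `` {u} = \<one>\<^bsub>free_group X\<^esub>"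
      using free_group_mult [OF formal_inverse_words [OF that] that]
        equiv_class_eq [OF equiv_free_rel free_rel_inverse [OF that]] by (simp add: free_group_def)
  qed (use that formal_inverse_words carr in auto)
  have "T \<lhd> free_group X"
    unfolding F.normal_inv_iff
  proof (intro conjI ballI F.subgroupI)
    show "T \<subseteq> carrier (free_group X)" by (auto simp: T_def carr)
    have "free_rel X `` {[]} \<in> T" using T [OF nil] by (simp add: V_nil eq_refl)
    then show "T \<noteq> {}" by blast
    fix a assume a: "a \<in> T"
    then obtain u where u: "u \<in> words X" "a = free_rel X `` {u}" "word_eq G A N (V u) []" by (auto simp: T_def)
    note u' = formal_inverse_words [OF u(1)]
    have "word_eq G A N (V (formal_inverse u) @ V u) (V (formal_inverse u) @ [])"
      by (rule word_eq_append2) (use u V u' in \<open>auto intro: eq_refl\<close>)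
    then have "word_eq G A N (V (formal_inverse u)) []"
      using V_rel [OF free_rel_inverse [OF u(1)]] by (auto simp: V_append V_nil intro: eq_sym eq_trans)
    then show "inv\<^bsub>free_group X\<^esub> a \<in> T" using T [OF u'] inv_class [OF u(1)] u(2) by simp
    show "a \<otimes>\<^bsub>free_group X\<^esub> b \<in> T" if "b \<in> T" for b
    proof -
      obtain w where w: "w \<in> words X" "b = free_rel X `` {w}" "word_eq G A N (V w) []" using \<open>b \<in> T\<close> by (auto simp: T_def)
      show ?thesis
        using word_eq_append2 [OF u(3) w(3)] T [of "u @ w"] u w by (simp add: free_group_mult V_append)
    qed
    fix x assume "x \<in> carrier (free_group X)"
    then obtain w where w: "w \<in> words X" "x = free_rel X `` {w}" by (auto simp: carr)
    note w' = formal_inverse_words [OF w(1)]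
    have "word_eq G A N (V w @ V u @ V (formal_inverse w)) (V w @ [] @ V (formal_inverse w))"
      by (rule word_eq_append [OF u(3)]) (use V w w' in auto)
    then have "word_eq G A N (V (w @ u @ formal_inverse w)) []"
      using V_rel [OF inv_rel [OF w(1)]] by (auto simp: V_append V_nil intro: eq_trans)
    then show "x \<otimes>\<^bsub>free_group X\<^esub> a \<otimes>\<^bsub>free_group X\<^esub> inv\<^bsub>free_group X\<^esub> x \<in> T"
      using T [of "w @ u @ formal_inverse w"] w w' u by (simp add: free_group_mult inv_class)
  qed
  moreover have "R \<subseteq> T"
  proof
    fix r assume r: "r \<in> R"
    have "free_rel X `` {\<rho> r} \<in> normal_closure (free_group X) R"
      using r \<rho> [OF r] by (auto simp: normal_closure_def)
    then have "foldr (\<otimes>) (V (\<rho> r)) \<one> = \<one>" using V \<rho> [OF r] \<phi>_one by auto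
    then have "word_eq G A N ([] @ []) ([] @ V (\<rho> r) @ [])"
      by (intro word_eq.insert) (use V \<rho> r N3 in \<open>auto simp: N_def\<close>)
    then show "r \<in> T" using T [of "\<rho> r"] \<rho> [OF r] by (auto intro: eq_sym)
  qed
  ultimately have "normal_closure (free_group X) R \<subseteq> T" by (auto simp: normal_closure_def)
  then have trivial: "word_eq G A N (V u) []" if "u \<in> words X" "\<phi> u = \<one>" for u
    using \<phi>_one [OF that(1)] that(2) T [OF that(1)] by blast
  have same: "word_eq G A N (V u) (V u')" if u: "u \<in> words X" "u' \<in> words X" "\<phi> u = \<phi> u'" for u u'
  proof -
    note i = formal_inverse_words [OF u(2)]
    have "\<phi> (u @ formal_inverse u') = \<phi> (u' @ formal_inverse u')" using u i \<phi>_append by simp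
    also have "\<dots> = \<one>" using \<phi>_rel [OF inv_rel [OF u(2)]] \<phi>_nil by simp
    finally have "word_eq G A N (V (u @ formal_inverse u')) []" using trivial u i by simp
    from word_eq_append [OF this, of "[]" "V u'"]
    have 1: "word_eq G A N (V u @ V (formal_inverse u') @ V u') (V u')"
      using V u by (simp add: V_append)
    from word_eq_append [OF V_rel [OF free_rel_inverse [OF u(2)]], of "V u" "[]"]
    have "word_eq G A N (V u @ V (formal_inverse u') @ V u') (V u)"
      using V u by (simp add: V_append V_nil)
    with 1 show ?thesis by (blast intro: eq_sym eq_trans)
  qed
  \<comment> \<open>A word over \<open>A\<close> need not be a translated word; it is compared
    letter by letter with the translation of \<open>Z w\<close>.\<close>
  define Z where "Z w = concat (map v w)" for w
  have Z: "Z w \<in> words X \<and> \<phi> (Z w) = foldr (\<otimes>) w \<one> \<and> word_eq G A N w (V (Z w))" if "set w \<subseteq> A" for w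
    using that
  proof (induction w)
    case Nil
    then show ?case using nil by (simp add: Z_def V_nil \<phi>_nil eq_refl)
  next
    case (Cons a w)
    then have a: "a \<in> A" "a \<in> carrier G" "inv a \<in> A" "set w \<subseteq> A" using A inv_A by auto
    have *: "Z (a # w) = v a @ Z w" by (simp add: Z_def)
    have va: "set (V (v a)) \<subseteq> A" "foldr (\<otimes>) (V (v a)) \<one> = a" using V v [OF a(1)] by auto
    have "foldr (\<otimes>) (V (v a) @ [inv a]) \<one> = \<one>"
      using va a A foldr_append_mult [of "V (v a)" "[inv a]"] by auto
    \<comment> \<open>Insert \<open>V (v a)\<close> and \<open>inv a\<close> in front of
      \<open>a\<close>; what then follows \<open>V (v a)\<close> is \<open>inv a\<close> and
      \<open>a\<close>, which can be removed.\<close>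
    then have "word_eq G A N ([] @ [a]) ([] @ (V (v a) @ [inv a]) @ [a])"
      by (intro word_eq.insert) (use va a N2 in \<open>auto simp: N_def\<close>)
    moreover have "word_eq G A N (V (v a) @ []) (V (v a) @ [inv a, a] @ [])"
      by (rule word_eq.insert) (use va a N2 in \<open>auto simp: N_def\<close>)
    ultimately have "word_eq G A N [a] (V (v a))" by (auto intro: eq_sym eq_trans)
    then have "word_eq G A N ([a] @ w) (V (v a) @ V (Z w))"
      using Cons.IH [OF a(4)] by (intro word_eq_append2) auto
    then show ?case
      using Cons.IH [OF a(4)] v [OF a(1)] \<phi>_append by (simp add: * V_append)
  qed
  have "word_eq G A N w w'" if "set w \<subseteq> A" "set w' \<subseteq> A" "foldr (\<otimes>) w \<one> = foldr (\<otimes>) w' \<one>" for w w'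
    using same [of "Z w" "Z w'"] Z [OF that(1)] Z [OF that(2)] that(3) by (metis eq_sym eq_trans)
  moreover have "1 \<le> N" by (simp add: N_def)
  ultimately show ?thesis unfolding A_def by blast
qed

text \<open>Objects over a group: a lift along a letter exists and is unique up to \<open>rel\<close>, and \<open>rel\<close> is transitive as long as the
  end points are at distance at most \<open>N\<close>. So relators of length at most \<open>N\<close> act trivially, as in a covering space.\<close>

locale word_lifting = group G for G :: "('a, 'b) monoid_scheme" (structure) +
  fixes A :: "'a set" and N :: nat and Ob :: "'o \<Rightarrow> bool" and e :: "'o \<Rightarrow> 'a" and rel :: "'o \<Rightarrow> 'o \<Rightarrow> bool"
  assumes A: "A \<subseteq> carrier G" "\<And>a. a \<in> A \<Longrightarrow> inv a \<in> A" and N: "1 \<le> N"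
    and e_closed: "\<And>\<xi>. Ob \<xi> \<Longrightarrow> e \<xi> \<in> carrier G"
    and rel_refl: "\<And>\<xi>. Ob \<xi> \<Longrightarrow> rel \<xi> \<xi>"
    and lift: "\<And>\<xi> a. Ob \<xi> \<Longrightarrow> a \<in> A \<Longrightarrow> \<exists>\<eta>. Ob \<eta> \<and> e \<eta> = e \<xi> \<otimes> a \<and> rel \<xi> \<eta> \<and> rel \<eta> \<xi>"
    and rel_trans: "\<And>\<xi> \<eta> \<zeta> t. Ob \<xi> \<Longrightarrow> Ob \<eta> \<Longrightarrow> Ob \<zeta> \<Longrightarrow> rel \<xi> \<eta> \<Longrightarrow> rel \<eta> \<zeta> \<Longrightarrow>
      set t \<subseteq> A \<Longrightarrow> length t \<le> N \<Longrightarrow> e \<zeta> = e \<xi> \<otimes> foldr (\<otimes>) t \<one> \<Longrightarrow> rel \<xi> \<zeta>"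
begin

text \<open>Each step records both directions because \<open>rel\<close> is not assumed to be
  symmetric.\<close>

inductive lifts :: "'o \<Rightarrow> 'a list \<Rightarrow> 'o \<Rightarrow> bool"
  where
    Nil: "Ob \<xi> \<Longrightarrow> lifts \<xi> [] \<xi>"
  | Cons: "Ob \<xi> \<Longrightarrow> Ob \<eta> \<Longrightarrow> a \<in> A \<Longrightarrow> e \<eta> = e \<xi> \<otimes> a \<Longrightarrow> rel \<xi> \<eta> \<Longrightarrow> rel \<eta> \<xi> \<Longrightarrow>
      lifts \<eta> w \<zeta> \<Longrightarrow> lifts \<xi> (a # w) \<zeta>"

lemma lifts_Ob: "lifts \<xi> w \<eta> \<Longrightarrow> Ob \<xi> \<and> Ob \<eta> \<and> set w \<subseteq> A"
  by (induction rule: lifts.induct) auto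

lemma lifts_end: "lifts \<xi> w \<eta> \<Longrightarrow> e \<eta> = e \<xi> \<otimes> foldr (\<otimes>) w \<one>"
proof (induction rule: lifts.induct)
  case (Nil \<xi>)
  then show ?case using e_closed by simp
next
  case (Cons \<xi> \<eta> a w \<zeta>)
  then have "set w \<subseteq> carrier G" "a \<in> carrier G" "e \<xi> \<in> carrier G"
    using lifts_Ob A(1) e_closed by blast+
  then show ?case using Cons foldr_closed [of w] by (simp add: m_assoc)
qed

lemma lifts_exists: "Ob \<xi> \<Longrightarrow> set w \<subseteq> A \<Longrightarrow> \<exists>\<eta>. lifts \<xi> w \<eta>"
proof (induction w arbitrary: \<xi>)
  case (Cons a w)
  then obtain \<eta> where "Ob \<eta>" "e \<eta> = e \<xi> \<otimes> a" "rel \<xi> \<eta>" "rel \<eta> \<xi>"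
    using lift [of \<xi> a] by auto
  with Cons show ?case by (meson lifts.Cons list.set_intros set_subset_Cons subset_trans subsetD)
qed (auto intro: lifts.Nil)

lemma rel_trans_same_end:
  assumes "Ob \<xi>" "Ob \<eta>" "Ob \<zeta>" "rel \<xi> \<eta>" "rel \<eta> \<zeta>" "e \<zeta> = e \<xi>"
  shows "rel \<xi> \<zeta>"
  using rel_trans [OF assms(1-5), of "[]"] assms(6) e_closed [OF assms(1)] by simp

text \<open>Transitivity may be used only between objects whose ends differ by at most
  \<open>N\<close> letters, so the square formed by two lifts of one letter is crossed in two
  stages: back along \<open>inv a\<close> to the other start, then forward to the same end.\<close>

lemma lifts_unique:
  "lifts \<xi> w \<eta> \<Longrightarrow> lifts \<xi>' w \<eta>' \<Longrightarrow> rel \<xi> \<xi>' \<Longrightarrow> e \<xi>' = e \<xi> \<Longrightarrow> rel \<eta> \<eta>'"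
proof (induction arbitrary: \<xi>' rule: lifts.induct)
  case (Nil \<xi>)
  then show ?case by (auto elim: lifts.cases)
next
  case (Cons \<xi> \<zeta> a w \<eta>)
  from Cons.prems(1) obtain \<zeta>' where z: "Ob \<xi>'" "Ob \<zeta>'" "e \<zeta>' = e \<xi>' \<otimes> a" "rel \<xi>' \<zeta>'" "lifts \<zeta>' w \<eta>'"
    by (auto elim: lifts.cases)
  have a: "a \<in> carrier G" "inv a \<in> A" "e \<xi> \<in> carrier G"
    using Cons.hyps A e_closed by auto
  have "rel \<zeta> \<xi>'"
    by (rule rel_trans [of \<zeta> \<xi> \<xi>' "[inv a]"]) (use Cons z a N in \<open>auto simp: m_assoc\<close>)
  then have "rel \<zeta> \<zeta>'"
    by (rule rel_trans_same_end [of \<zeta> \<xi>' \<zeta>', rotated 3]) (use Cons z in auto)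
  then show ?case using Cons.IH [of \<zeta>'] z Cons by simp
qed

text \<open>Suffixes of a short word are short, so all intermediate objects end within
  \<open>N\<close> letters of the last one, and the relations along the lift compose into
  one.\<close>

lemma lifts_short:
  "lifts \<xi> t \<eta> \<Longrightarrow> length t \<le> N \<Longrightarrow> rel \<xi> \<eta> \<and> rel \<eta> \<xi>"
proof (induction rule: lifts.induct)
  case (Nil \<xi>)
  then show ?case by (simp add: rel_refl)
next
  case (Cons \<xi> \<zeta> a t \<eta>)
  have l: "lifts \<xi> (a # t) \<eta>" using lifts.Cons Cons.hyps by blast
  note o = lifts_Ob [OF l] and en = lifts_end [OF l]
  have IH: "rel \<zeta> \<eta>" "rel \<eta> \<zeta>" using Cons by auto
  have c: "set (a # t) \<subseteq> carrier G" "e \<xi> \<in> carrier G" using o A e_closed by auto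
  have "e \<xi> = e \<eta> \<otimes> foldr (\<otimes>) (map (m_inv G) (rev (a # t))) \<one>"
    using foldr_inverse [OF c(1)] en foldr_closed [OF c(1)] c(2) by (simp add: m_assoc del: foldr.simps)
  moreover have "set (map (m_inv G) (rev (a # t))) \<subseteq> A" using o A(2) by auto
  ultimately have "rel \<eta> \<xi>"
    by (intro rel_trans [of \<eta> \<zeta> \<xi> "map (m_inv G) (rev (a # t))"]) (use Cons IH o in auto)
  moreover have "rel \<xi> \<eta>"
    by (rule rel_trans [of \<xi> \<zeta> \<eta> "a # t"]) (use Cons IH o en in auto)
  ultimately show ?case by simp
qed

lemma lifts_append: "lifts \<xi> (u @ v) \<eta> \<Longrightarrow> \<exists>\<zeta>. lifts \<xi> u \<zeta> \<and> lifts \<zeta> v \<eta>"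
proof (induction u arbitrary: \<xi>)
  case Nil
  then show ?case using lifts_Ob lifts.Nil by (metis append_Nil)
next
  case (Cons a u)
  from Cons.prems obtain \<theta> where "Ob \<xi>" "Ob \<theta>" "a \<in> A" "e \<theta> = e \<xi> \<otimes> a" "rel \<xi> \<theta>" "rel \<theta> \<xi>" "lifts \<theta> (u @ v) \<eta>"
    by (auto elim: lifts.cases)
  with Cons.IH show ?case by (meson lifts.Cons)
qed

lemma lifts_appendI: "lifts \<xi> u \<zeta> \<Longrightarrow> lifts \<zeta> v \<eta> \<Longrightarrow> lifts \<xi> (u @ v) \<eta>"
  by (induction rule: lifts.induct) (auto intro: lifts.Cons)

text \<open>In the insertion case the lift of \<open>t\<close> returns over the point where it began
  and, being short, to an object related to the one where it began; by uniqueness the lift of what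
  follows is unaffected up to \<open>rel\<close>.\<close>

lemma lifts_word_eq:
  "word_eq G A N w w' \<Longrightarrow> lifts \<xi> w \<eta> \<Longrightarrow> lifts \<xi> w' \<eta>' \<Longrightarrow> rel \<eta> \<eta>' \<and> rel \<eta>' \<eta>"
proof (induction arbitrary: \<eta> \<eta>' rule: word_eq.induct)
  case (refl u)
  then show ?case using lifts_unique lifts_Ob rel_refl by blast
next
  case (sym u v)
  then show ?case by blast
next
  case (trans u v w)
  obtain \<zeta> where z: "lifts \<xi> v \<zeta>"
    using lifts_exists [of \<xi> v] lifts_Ob [OF trans.prems(1)] word_eq_sets [OF trans.hyps(1)] by blast
  have r: "rel \<eta> \<zeta>" "rel \<zeta> \<eta>" "rel \<zeta> \<eta>'" "rel \<eta>' \<zeta>"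
    using trans.IH z trans.prems by blast+
  have o: "Ob \<eta>" "Ob \<zeta>" "Ob \<eta>'" using lifts_Ob trans.prems z by blast+
  have "e \<eta>' = e \<eta>"
    using lifts_end trans.prems word_eq_foldr [OF word_eq.trans [OF trans.hyps] A(1)] by simp
  then show ?case using rel_trans_same_end o r by metis
next
  case (insert u v t)
  obtain \<zeta> where z: "lifts \<xi> u \<zeta>" "lifts \<zeta> v \<eta>" using lifts_append insert.prems by blast
  obtain \<zeta>' \<theta> where z': "lifts \<xi> u \<zeta>'" "lifts \<zeta>' t \<theta>" "lifts \<theta> v \<eta>'" using lifts_append insert.prems by meson
  have o: "Ob \<xi>" "Ob \<zeta>" "Ob \<zeta>'" "Ob \<theta>" using lifts_Ob z z' by blast+
  have en: "e \<zeta>' = e \<zeta>" "e \<theta> = e \<zeta>'"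
    using lifts_end z z' insert.hyps e_closed [OF o(3)] by auto
  have "rel \<zeta> \<zeta>'" "rel \<zeta>' \<zeta>" using lifts_unique [OF z(1) z'(1)] lifts_unique [OF z'(1) z(1)] rel_refl o by auto
  moreover have "rel \<zeta>' \<theta>" "rel \<theta> \<zeta>'" using lifts_short [OF z'(2)] insert.hyps by auto
  ultimately have "rel \<zeta> \<theta>" "rel \<theta> \<zeta>"
    using rel_trans_same_end [of \<zeta> \<zeta>' \<theta>] rel_trans_same_end [of \<theta> \<zeta>' \<zeta>] o en by auto
  then show ?case
    using lifts_unique [OF z(2) z'(3)] lifts_unique [OF z'(3) z(2)] en by auto
qed

end

section \<open>Geodesics in locally hyperbolic spaces\<close>

text \<open>Paths are indexed by natural numbers because word metrics have integer values. The
  window \<open>W\<close> bounds the index gaps that are tested: for \<open>c = 0\<close> it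
  separates geodesics, where it is at least the length, from local geodesics.\<close>

definition quasi_geodesic ::
  "'a set \<Rightarrow> ('a \<Rightarrow> 'a \<Rightarrow> real) \<Rightarrow> real \<Rightarrow> real \<Rightarrow> (nat \<Rightarrow> 'a) \<Rightarrow> nat \<Rightarrow> bool"
  where "quasi_geodesic M d c W \<xi> T \<longleftrightarrow> (\<forall>i\<le>T. \<xi> i \<in> M) \<and>
    (\<forall>i j. i \<le> j \<longrightarrow> j \<le> T \<longrightarrow> real j - real i \<le> W \<longrightarrow>
       \<bar>d (\<xi> i) (\<xi> j) - (real j - real i)\<bar> \<le> c)"

text \<open>The index map of a track need not be monotone; with its bounded increments it excludes that a path returning
  to the same region is matched with a wrong passage of the other path.\<close>

definition track ::
  "('a \<Rightarrow> 'a \<Rightarrow> real) \<Rightarrow> real \<Rightarrow> real \<Rightarrow> (nat \<Rightarrow> 'a) \<Rightarrow> nat \<Rightarrow> (nat \<Rightarrow> 'a) \<Rightarrow> nat \<Rightarrow> bool"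
  where "track d c K \<xi> T \<eta> L \<longleftrightarrow> (\<exists>j :: nat \<Rightarrow> nat. j 0 = 0 \<and> j T = L \<and>
    (\<forall>i\<le>T. j i \<le> L \<and> d (\<xi> i) (\<eta> (j i)) \<le> c) \<and>
    (\<forall>i<T. \<bar>real (j (Suc i)) - real (j i)\<bar> \<le> K))"

lemma quasi_geodesic_in: "quasi_geodesic M d c W \<xi> T \<Longrightarrow> i \<le> T \<Longrightarrow> \<xi> i \<in> M"
  by (simp add: quasi_geodesic_def)

lemma quasi_geodesic_dist:
  "quasi_geodesic M d c W \<xi> T \<Longrightarrow> i \<le> j \<Longrightarrow> j \<le> T \<Longrightarrow> real j - real i \<le> W
    \<Longrightarrow> \<bar>d (\<xi> i) (\<xi> j) - (real j - real i)\<bar> \<le> c"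
  by (simp add: quasi_geodesic_def)

lemma quasi_geodesic_mono:
  "quasi_geodesic M d c W \<xi> T \<Longrightarrow> c \<le> c' \<Longrightarrow> W' \<le> W \<Longrightarrow> T' \<le> T \<Longrightarrow> quasi_geodesic M d c' W' \<xi> T'"
  by (fastforce simp: quasi_geodesic_def)

lemma track_mono:
  assumes "track d c K \<xi> T \<eta> L" "c \<le> c'" "K \<le> K'"
  shows "track d c' K' \<xi> T \<eta> L"
proof -
  obtain j where "j 0 = 0" "j T = L" "\<And>i. i \<le> T \<Longrightarrow> j i \<le> L \<and> d (\<xi> i) (\<eta> (j i)) \<le> c"
    "\<And>i. i < T \<Longrightarrow> \<bar>real (j (Suc i)) - real (j i)\<bar> \<le> K"
    using assms(1) unfolding track_def by blast
  with assms(2,3) show ?thesis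
    unfolding track_def by (intro exI [of _ j]) fastforce
qed

lemma track_append:
  assumes 1: "track d c K \<xi> T \<eta> L" and 2: "track d c K (\<lambda>i. \<xi> (T + i)) T' (\<lambda>i. \<eta> (L + i)) L'"
  shows "track d c K \<xi> (T + T') \<eta> (L + L')"
proof -
  obtain j where j: "j 0 = 0" "j T = L" "\<And>i. i \<le> T \<Longrightarrow> j i \<le> L \<and> d (\<xi> i) (\<eta> (j i)) \<le> c"
    "\<And>i. i < T \<Longrightarrow> \<bar>real (j (Suc i)) - real (j i)\<bar> \<le> K"
    using 1 unfolding track_def by blast
  obtain k where k: "k 0 = 0" "k T' = L'"
    "\<And>i. i \<le> T' \<Longrightarrow> k i \<le> L' \<and> d (\<xi> (T + i)) (\<eta> (L + k i)) \<le> c"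
    "\<And>i. i < T' \<Longrightarrow> \<bar>real (k (Suc i)) - real (k i)\<bar> \<le> K"
    using 2 unfolding track_def by blast
  define m where "m i = (if i \<le> T then j i else L + k (i - T))" for i
  have m2: "m i = L + k (i - T)" if "T \<le> i" for i
    using that j(2) k(1) by (auto simp: m_def)
  have "m 0 = 0" by (simp add: m_def j)
  moreover have "m (T + T') = L + L'" by (simp add: m2 k)
  moreover have "m i \<le> L + L' \<and> d (\<xi> i) (\<eta> (m i)) \<le> c" if "i \<le> T + T'" for i
  proof (cases "i \<le> T")
    case True
    then show ?thesis using j(3) [OF True] by (simp add: m_def)
  next
    case False
    then show ?thesis using k(3) [of "i - T"] that by (simp add: m2)
  qed
  moreover have "\<bar>real (m (Suc i)) - real (m i)\<bar> \<le> K" if "i < T + T'" for i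
  proof (cases "i < T")
    case True
    then show ?thesis using j(4) [OF True] by (simp add: m_def)
  next
    case False
    then show ?thesis using k(4) [of "i - T"] that by (simp add: m2 Suc_diff_le)
  qed
  ultimately show ?thesis unfolding track_def by blast
qed

lemma track_cong:
  assumes "track d c K \<xi> T \<eta> L" "\<And>i. i \<le> T \<Longrightarrow> \<xi>' i = \<xi> i" "\<And>i. i \<le> L \<Longrightarrow> \<eta>' i = \<eta> i"
  shows "track d c K \<xi>' T \<eta>' L"
  using assms unfolding track_def by (metis (no_types, lifting))

text \<open>A discrete intermediate value theorem. The order of \<open>p\<close> and
  \<open>q\<close> is left open because index maps of tracks need not be monotone; the slack
  \<open>e\<close> covers a final value that stops just short of \<open>v\<close>.\<close>

lemma intermediate_index:
  fixes f :: "nat \<Rightarrow> real"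
  assumes "\<And>k. min p q \<le> k \<Longrightarrow> k < max p q \<Longrightarrow> \<bar>f (Suc k) - f k\<bar> \<le> 1"
    and "f p \<le> v" "v - e \<le> f q" "0 \<le> e"
  shows "\<exists>k. min p q \<le> k \<and> k \<le> max p q \<and> \<bar>f k - v\<bar> \<le> e + 1"
proof (cases "f q \<le> v")
  case True
  then show ?thesis using assms by (intro exI [of _ q]) auto
next
  case False
  show ?thesis
  proof (cases "p \<le> q")
    case True
    have "\<exists>k. p \<le> k \<and> k \<le> q \<and> \<bar>f k - v\<bar> \<le> 1"
      using True False assms(1)
    proof (induction q rule: dec_induct)
      case base
      then show ?case using assms(2) by auto
    next
      case (step n)
      show ?case
      proof (cases "f n \<le> v")
        case True
        then show ?thesis using step.prems(1) step.prems(2) [of n] step.hyps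
          by (intro exI [of _ "Suc n"]) auto
      next
        case False
        then have "\<exists>k\<ge>p. k \<le> n \<and> \<bar>f k - v\<bar> \<le> 1"
          using step by auto
        then show ?thesis using le_SucI by blast
      qed
    qed
    then show ?thesis using True \<open>0 \<le> e\<close> by fastforce
  next
    case p: False
    then have "q \<le> p" by simp
    then have "\<exists>k. q \<le> k \<and> k \<le> p \<and> \<bar>f k - v\<bar> \<le> 1"
      using assms(1,2)
    proof (induction p rule: dec_induct)
      case base
      then show ?case using False by auto
    next
      case (step n)
      show ?case
      proof (cases "f n \<le> v")
        case False
        then show ?thesis using step.prems step.prems(1) [of n] step.hyps
          by (intro exI [of _ "Suc n"]) auto
      next
        case True
        then have "\<exists>k\<ge>q. k \<le> n \<and> \<bar>f k - v\<bar> \<le> 1"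
          using step by auto
        then show ?thesis using le_SucI by blast
      qed
    qed
    then show ?thesis using p \<open>0 \<le> e\<close> by fastforce
  qed
qed

text \<open>All lengths are multiples of \<open>\<delta>\<close>: the four-point condition is assumed at scale \<open>10\<^sup>7 \<delta>\<close>, local geodesics are
  geodesic on windows of length \<open>2 \<cdot> 10\<^sup>5 \<delta>\<close>, and fellow travelling means distance at most \<open>10\<^sup>4 \<delta>\<close>. Only the orders of
  magnitude matter.\<close>

locale locally_hyperbolic = Metric_space M d
  for M :: "'a set" and d :: "'a \<Rightarrow> 'a \<Rightarrow> real" +
  fixes \<delta> :: nat
  assumes delta_pos: "1 \<le> \<delta>"
    and geodesic_exists: "\<And>x y. x \<in> M \<Longrightarrow> y \<in> M \<Longrightarrow>
      \<exists>g n. g 0 = x \<and> g n = y \<and> quasi_geodesic M d 0 (real n) g n"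
    and four_point: "\<And>x y z u. x \<in> M \<Longrightarrow> y \<in> M \<Longrightarrow> z \<in> M \<Longrightarrow> u \<in> M \<Longrightarrow>
      d x y \<le> 10000000 * real \<delta> \<Longrightarrow> d x z \<le> 10000000 * real \<delta> \<Longrightarrow> d x u \<le> 10000000 * real \<delta> \<Longrightarrow>
      d x y + d z u \<le> max (d x z + d y u) (d x u + d y z) + 2 * real \<delta>"
begin

abbreviation "D \<equiv> real \<delta>"

definition local_geodesic :: "(nat \<Rightarrow> 'a) \<Rightarrow> nat \<Rightarrow> bool"
  where "local_geodesic \<xi> T \<longleftrightarrow> quasi_geodesic M d 0 (200000 * D) \<xi> T"

lemma D_ge: "1 \<le> D"
  using delta_pos by simp

lemma geodesic_dist:
  assumes "quasi_geodesic M d 0 (real n) g n" "i \<le> j" "j \<le> n"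
  shows "d (g i) (g j) = real j - real i"
  using quasi_geodesic_dist [OF assms(1-3)] assms(3) by linarith

lemma local_geodesic_in: "local_geodesic \<xi> T \<Longrightarrow> i \<le> T \<Longrightarrow> \<xi> i \<in> M"
  by (simp add: local_geodesic_def quasi_geodesic_in)

lemma local_geodesic_dist:
  assumes "local_geodesic \<xi> T" "i \<le> j" "j \<le> T" "real j - real i \<le> 200000 * D"
  shows "d (\<xi> i) (\<xi> j) = real j - real i"
  using quasi_geodesic_dist [OF assms(1) [unfolded local_geodesic_def] assms(2-4)] by linarith

lemma geodesic_local:
  "quasi_geodesic M d 0 (real n) g n \<Longrightarrow> local_geodesic g n"
  unfolding local_geodesic_def quasi_geodesic_def by fastforce

text \<open>In terms of Gromov products at \<open>p\<close>: twice (x|y) is at most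
  \<open>e\<close>, while twice (x|x') exceeds \<open>e + 2 * D\<close>. The two smallest of the
  three products differ by at most \<open>D\<close>, so (x'|y) is small as well. Thus an end point
  may be moved far when testing whether \<open>p\<close> is nearly between two points.\<close>

lemma swap_excess:
  assumes "p \<in> M" "x \<in> M" "x' \<in> M" "y \<in> M"
    and "d p x \<le> 10000000 * D" "d p x' \<le> 10000000 * D" "d p y \<le> 10000000 * D"
    and "d p x + d p y - d x y \<le> e" "e + d x x' + 2 * D < d p x + d p x'"
  shows "d p x' + d p y - d x' y \<le> e + 2 * D"
  using four_point [of p x' x y] assms commute [of x x'] by (simp add: max_def split: if_splits)

section \<open>Local geodesics beyond their windows\<close>

lemma unit_steps_dist:
  assumes "\<And>k. k \<le> T \<Longrightarrow> \<xi> k \<in> M" "\<And>k. k < T \<Longrightarrow> d (\<xi> k) (\<xi> (Suc k)) \<le> 1" "i \<le> j" "j \<le> T"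
  shows "d (\<xi> i) (\<xi> j) \<le> real j - real i"
  using assms(3,4)
proof (induction j rule: dec_induct)
  case base
  then show ?case using assms(1) by simp
next
  case (step n)
  then show ?case using triangle [of "\<xi> i" "\<xi> n" "\<xi> (Suc n)"] assms(1,2) [of n] assms(1) by fastforce
qed

lemma local_geodesic_step:
  "local_geodesic \<xi> T \<Longrightarrow> k < T \<Longrightarrow> d (\<xi> k) (\<xi> (Suc k)) = 1"
  using local_geodesic_dist [of \<xi> T k "Suc k"] D_ge by simp

lemma local_geodesic_dist_le:
  "local_geodesic \<xi> T \<Longrightarrow> i \<le> j \<Longrightarrow> j \<le> T \<Longrightarrow> d (\<xi> i) (\<xi> j) \<le> real j - real i"
  by (rule unit_steps_dist) (auto simp: local_geodesic_in local_geodesic_step)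

text \<open>Half a window and a whole window before \<open>j\<close> lie \<open>b\<close> and
  \<open>a\<close>. The overlapping pieces from \<open>i\<close> to \<open>b\<close> and from
  \<open>a\<close> to \<open>j\<close> are so long in sum that the maximum in the four-point
  condition must be the sum containing \<open>d (\<xi> i) (\<xi> j)\<close>, which is thereby
  bounded below with a loss of \<open>2 * D\<close> per step. At most 20 steps keep the loss at
  \<open>40 * D\<close> and the points within reach of the condition.\<close>

lemma local_geodesic_lower:
  assumes lg: "local_geodesic \<xi> T" and "n \<le> 20"
  shows "i \<le> j \<Longrightarrow> j \<le> T \<Longrightarrow> j - i \<le> n * (100000 * \<delta>) \<Longrightarrow> real j - real i - 2 * real n * D \<le> d (\<xi> i) (\<xi> j)"
  using \<open>n \<le> 20\<close>
proof (induction n arbitrary: j)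
  case 0
  then show ?case using local_geodesic_in [OF lg] by simp
next
  case (Suc n)
  let ?h = "100000 * \<delta>"
  show ?case
  proof (cases "j - i \<le> 2 * ?h")
    case True
    then have "real j - real i \<le> 200000 * D"
      using Suc.prems by linarith
    then show ?thesis using local_geodesic_dist [OF lg Suc.prems(1,2)] D_ge by simp
  next
    case False
    define b where "b = j - ?h"
    define a where "a = j - 2 * ?h"
    have ord: "i \<le> a" "a \<le> b" "b \<le> j" "real b = real j - 100000 * D" "real a = real j - 200000 * D"
      using False by (auto simp: a_def b_def of_nat_diff)
    have n: "n * ?h \<le> 20 * ?h" using Suc.prems(4) by (intro mult_le_mono1) auto
    have bi: "b - i \<le> n * ?h" using Suc.prems(3) by (simp add: b_def)
    have lb: "real b - real i - 2 * real n * D \<le> d (\<xi> i) (\<xi> b)"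
      by (rule Suc.IH) (use ord Suc.prems bi in auto)
    have "real b - real i \<le> 2000000 * D"
      using bi n ord by linarith
    then have far: "real j - real i \<le> 2100000 * D" using ord by simp
    have in_M: "\<xi> i \<in> M" "\<xi> a \<in> M" "\<xi> b \<in> M" "\<xi> j \<in> M"
      using local_geodesic_in [OF lg] ord Suc.prems by auto
    have ds: "d (\<xi> a) (\<xi> j) = 200000 * D" "d (\<xi> a) (\<xi> b) = 100000 * D" "d (\<xi> b) (\<xi> j) = 100000 * D"
      using local_geodesic_dist [OF lg, of a j] local_geodesic_dist [OF lg, of a b]
        local_geodesic_dist [OF lg, of b j] ord Suc.prems D_ge by auto
    have ub: "d (\<xi> i) (\<xi> a) \<le> real a - real i" "d (\<xi> i) (\<xi> b) \<le> real b - real i"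
        "d (\<xi> i) (\<xi> j) \<le> real j - real i"
      using local_geodesic_dist_le [OF lg, of i a] local_geodesic_dist_le [OF lg, of i b]
        local_geodesic_dist_le [OF lg, of i j] ord Suc.prems by auto
    have fp: "d (\<xi> i) (\<xi> b) + d (\<xi> a) (\<xi> j)
        \<le> max (d (\<xi> i) (\<xi> a) + d (\<xi> b) (\<xi> j)) (d (\<xi> i) (\<xi> j) + d (\<xi> b) (\<xi> a)) + 2 * D"
      by (rule four_point) (use in_M ub far ord D_ge in auto)
    have nD: "2 * real n * D \<le> 40 * D" using Suc.prems(4) by (intro mult_right_mono) auto
    have "\<not> d (\<xi> i) (\<xi> b) + d (\<xi> a) (\<xi> j) \<le> d (\<xi> i) (\<xi> a) + d (\<xi> b) (\<xi> j) + 2 * D"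
      using nD lb ub ds ord D_ge by linarith
    with fp have "d (\<xi> i) (\<xi> b) + d (\<xi> a) (\<xi> j) \<le> d (\<xi> i) (\<xi> j) + d (\<xi> b) (\<xi> a) + 2 * D"
      by linarith
    then show ?thesis using lb ds ord commute [of "\<xi> a" "\<xi> b"] by (simp add: algebra_simps)
  qed
qed

lemma local_geodesic_quasi:
  assumes "local_geodesic \<xi> T"
  shows "quasi_geodesic M d (40 * D) (2000000 * D) \<xi> T"
  unfolding quasi_geodesic_def
proof (intro conjI allI impI)
  fix i j assume ij: "i \<le> j" "j \<le> T" "real j - real i \<le> 2000000 * D"
  have "real (j - i) \<le> real (20 * (100000 * \<delta>))" using ij by (simp add: of_nat_diff)
  then have "j - i \<le> 20 * (100000 * \<delta>)" by (simp only: of_nat_le_iff)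
  from local_geodesic_lower [OF assms _ ij(1,2) this] local_geodesic_dist_le [OF assms ij(1,2)]
  show "\<bar>d (\<xi> i) (\<xi> j) - (real j - real i)\<bar> \<le> 40 * D" by simp
qed (use local_geodesic_in [OF assms] in auto)

section \<open>Contraction of fellow travelling\<close>

text \<open>A continuity argument: index gaps on \<open>\<eta>\<close> can be read off from
  distances only up to \<open>2000000 * D\<close>. The bound at \<open>n\<close> plus one increment
  of at most \<open>K\<close> stays below that, and the distance estimate then restores the sharp
  bound at \<open>Suc n\<close>.\<close>

lemma track_lipschitz:
  assumes \<xi>: "quasi_geodesic M d c (2000000 * D) \<xi> T" and \<eta>: "local_geodesic \<eta> L"
    and j: "\<And>i. i \<le> T \<Longrightarrow> j i \<le> L \<and> d (\<xi> i) (\<eta> (j i)) \<le> m"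
      "\<And>i. i < T \<Longrightarrow> \<bar>real (j (Suc i)) - real (j i)\<bar> \<le> K"
    and c: "c \<le> 50 * D" "m \<le> 20000 * D" "K \<le> 100000 * D" "0 \<le> c" "0 \<le> m"
    and ab: "a \<le> b" "b \<le> T" "real b - real a \<le> 1000000 * D"
  shows "\<bar>real (j b) - real (j a)\<bar> \<le> real b - real a + 2 * m + c + 40 * D"
  using ab
proof (induction b rule: dec_induct)
  case base
  then show ?case using c D_ge by simp
next
  case (step n)
  note q\<eta> = local_geodesic_quasi [OF \<eta>]
  have prev: "\<bar>real (j n) - real (j a)\<bar> \<le> real n - real a + 2 * m + c + 40 * D"
    using step by auto
  then have near: "\<bar>real (j (Suc n)) - real (j a)\<bar> \<le> 2000000 * D"
    using j(2) [of n] step.prems c by simp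
  have in_M: "\<xi> a \<in> M" "\<xi> (Suc n) \<in> M" "\<eta> (j a) \<in> M" "\<eta> (j (Suc n)) \<in> M"
    using quasi_geodesic_in [OF \<xi>] local_geodesic_in [OF \<eta>] j(1) step by auto
  have "d (\<xi> a) (\<xi> (Suc n)) \<le> real (Suc n) - real a + c"
    using quasi_geodesic_dist [OF \<xi>, of a "Suc n"] step D_ge by auto
  moreover have "d (\<xi> a) (\<eta> (j a)) \<le> m" "d (\<xi> (Suc n)) (\<eta> (j (Suc n))) \<le> m"
    using j(1) step by auto
  moreover have "d (\<eta> (j a)) (\<eta> (j (Suc n)))
      \<le> d (\<eta> (j a)) (\<xi> a) + d (\<xi> a) (\<xi> (Suc n)) + d (\<xi> (Suc n)) (\<eta> (j (Suc n)))"
    using triangle [of "\<eta> (j a)" "\<xi> a" "\<xi> (Suc n)"] triangle [of "\<eta> (j a)" "\<xi> (Suc n)" "\<eta> (j (Suc n))"] in_M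
    by linarith
  ultimately have "d (\<eta> (j a)) (\<eta> (j (Suc n))) \<le> real (Suc n) - real a + c + 2 * m"
    using commute [of "\<xi> a" "\<eta> (j a)"] by simp
  moreover have "\<bar>real (j (Suc n)) - real (j a)\<bar> \<le> d (\<eta> (j a)) (\<eta> (j (Suc n))) + 40 * D"
    using quasi_geodesic_dist [OF q\<eta>, of "j a" "j (Suc n)"] quasi_geodesic_dist [OF q\<eta>, of "j (Suc n)" "j a"]
      j(1) [of a] j(1) [of "Suc n"] step near commute [of "\<eta> (j a)" "\<eta> (j (Suc n))"]
    by (cases "j a \<le> j (Suc n)") auto
  ultimately show ?case by simp
qed

text \<open>In the quadrilateral spanned by \<open>\<xi> lo\<close>, \<open>\<xi> hi\<close> and
  their partners on \<open>\<eta>\<close>, sides of length at most \<open>20000 * D\<close> are not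
  felt at a point about \<open>200000 * D\<close> away, so the long sides are close there by a bound
  independent of the short ones. Where the window is cut off at an end of the path, the partners
  coincide or are within \<open>100 * D\<close>.\<close>

lemma track_improve_point:
  assumes \<xi>: "local_geodesic \<xi> T" and \<eta>: "local_geodesic \<eta> L" and start: "\<xi> 0 = \<eta> 0"
    and end_dist: "d (\<xi> T) (\<eta> L) \<le> 100 * D"
    and j0: "j 0 = 0" and jT: "j T = L"
    and j1: "\<And>i. i \<le> T \<Longrightarrow> j i \<le> L \<and> d (\<xi> i) (\<eta> (j i)) \<le> 20000 * D"
    and j2: "\<And>i. i < T \<Longrightarrow> \<bar>real (j (Suc i)) - real (j i)\<bar> \<le> 100000 * D"
    and ord: "lo \<le> i" "i \<le> hi" "hi \<le> T"
    and lo: "real i - real lo \<le> 200000 * D" "lo = 0 \<or> real i - real lo = 200000 * D"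
    and hi: "real hi - real i \<le> 200000 * D" "hi = T \<or> real hi - real i = 200000 * D"
  shows "\<exists>k. min (j lo) (j hi) \<le> k \<and> k \<le> max (j lo) (j hi) \<and> d (\<xi> i) (\<eta> k) \<le> 3000 * D"
proof -
  note q\<xi> = local_geodesic_quasi [OF \<xi>] and q\<eta> = local_geodesic_quasi [OF \<eta>]
  have L: "j lo \<le> L" "j hi \<le> L" using j1 ord by auto
  have in_M: "\<xi> lo \<in> M" "\<xi> i \<in> M" "\<xi> hi \<in> M" "\<eta> (j lo) \<in> M" "\<eta> (j hi) \<in> M"
    using local_geodesic_in [OF \<xi>] local_geodesic_in [OF \<eta>] L ord by auto
  have near: "\<bar>real (j hi) - real (j lo)\<bar> \<le> 441000 * D"
  proof -
    have "\<bar>real (j hi) - real (j lo)\<bar> \<le> real hi - real lo + 2 * (20000 * D) + 40 * D + 40 * D"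
      by (rule track_lipschitz [OF q\<xi> \<eta> j1 j2]) (use ord lo hi D_ge in auto)
    then show ?thesis using lo hi D_ge by linarith
  qed
  have x: "d (\<xi> lo) (\<xi> i) \<le> real i - real lo" "real i - real lo - 40 * D \<le> d (\<xi> lo) (\<xi> i)"
     "d (\<xi> i) (\<xi> hi) \<le> real hi - real i" "real hi - real i - 40 * D \<le> d (\<xi> i) (\<xi> hi)"
     "d (\<xi> lo) (\<xi> hi) \<le> real hi - real lo" "real hi - real lo - 40 * D \<le> d (\<xi> lo) (\<xi> hi)"
    using local_geodesic_dist_le [OF \<xi>, of lo i] local_geodesic_dist_le [OF \<xi>, of i hi]
      local_geodesic_dist_le [OF \<xi>, of lo hi] quasi_geodesic_dist [OF q\<xi>, of lo i]
      quasi_geodesic_dist [OF q\<xi>, of i hi] quasi_geodesic_dist [OF q\<xi>, of lo hi]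
      ord lo hi D_ge by auto
  have a': "d (\<xi> lo) (\<eta> (j lo)) \<le> 20000 * D" and a0: "lo = 0 \<Longrightarrow> \<xi> lo = \<eta> (j lo)"
    using j1 [of lo] ord start j0 by auto
  have b': "d (\<xi> hi) (\<eta> (j hi)) \<le> 20000 * D" and b0: "hi = T \<Longrightarrow> d (\<xi> hi) (\<eta> (j hi)) \<le> 100 * D"
    using j1 [of hi] ord end_dist jT by auto
  \<comment> \<open>The partner is the point of \<open>\<eta>\<close> at the same distance from
    \<open>\<xi> lo\<close> as \<open>\<xi> i\<close>. Slack is needed if \<open>hi\<close> is
    \<open>T\<close>: there \<open>\<eta>\<close> may stop short of this distance by the
    \<open>100 * D\<close> between the ends and an error of \<open>40 * D\<close>.\<close>
  have "\<exists>k. min (j lo) (j hi) \<le> k \<and> k \<le> max (j lo) (j hi) \<and>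
      \<bar>d (\<xi> lo) (\<eta> k) - d (\<xi> lo) (\<xi> i)\<bar> \<le> 180 * D + 1"
  proof (rule intermediate_index)
    show "\<bar>d (\<xi> lo) (\<eta> (Suc k)) - d (\<xi> lo) (\<eta> k)\<bar> \<le> 1"
      if "min (j lo) (j hi) \<le> k" "k < max (j lo) (j hi)" for k
    proof -
      have "k < L" using that L by auto
      then have "\<eta> k \<in> M" "\<eta> (Suc k) \<in> M" "d (\<eta> k) (\<eta> (Suc k)) = 1"
        using local_geodesic_in [OF \<eta>] local_geodesic_step [OF \<eta>] by auto
      then show ?thesis
        using triangle [of "\<xi> lo" "\<eta> k" "\<eta> (Suc k)"] triangle [of "\<xi> lo" "\<eta> (Suc k)" "\<eta> k"] in_M
          commute [of "\<eta> k" "\<eta> (Suc k)"] by auto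
    qed
    show "d (\<xi> lo) (\<eta> (j lo)) \<le> d (\<xi> lo) (\<xi> i)"
    proof (cases "lo = 0")
      case True
      then show ?thesis using a0 in_M by simp
    next
      case False
      then show ?thesis using lo a' x D_ge by linarith
    qed
    have "d (\<xi> lo) (\<xi> hi) \<le> d (\<xi> lo) (\<eta> (j hi)) + d (\<xi> hi) (\<eta> (j hi))"
      using triangle [of "\<xi> lo" "\<eta> (j hi)" "\<xi> hi"] in_M commute [of "\<xi> hi" "\<eta> (j hi)"] by simp
    then show "d (\<xi> lo) (\<xi> i) - 180 * D \<le> d (\<xi> lo) (\<eta> (j hi))"
      using hi(2) b' b0 x ord D_ge by auto
  qed simp
  then obtain k where k: "min (j lo) (j hi) \<le> k" "k \<le> max (j lo) (j hi)"
    "\<bar>d (\<xi> lo) (\<eta> k) - d (\<xi> lo) (\<xi> i)\<bar> \<le> 181 * D"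
    using D_ge by force
  have kL: "k \<le> L" using k L by auto
  have kM: "\<eta> k \<in> M" using local_geodesic_in [OF \<eta>] kL by auto
  have dk: "d (\<eta> p) (\<eta> q) \<le> \<bar>real q - real p\<bar> + 40 * D \<and> \<bar>real q - real p\<bar> \<le> d (\<eta> p) (\<eta> q) + 40 * D" if "p \<le> L" "q \<le> L" "\<bar>real q - real p\<bar> \<le> 441000 * D" for p q
    using quasi_geodesic_dist [OF q\<eta>, of p q] quasi_geodesic_dist [OF q\<eta>, of q p] that commute [of "\<eta> p" "\<eta> q"]
    by (cases "p \<le> q") auto
  \<comment> \<open>As \<open>k\<close> lies between the two indices, the gaps add up exactly; three
    errors of \<open>40 * D\<close> make the excess \<open>120 * D\<close>.\<close>
  define u v where "u = \<bar>real (j lo) - real k\<bar>" and "v = \<bar>real (j hi) - real k\<bar>"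
  have uv: "u + v = \<bar>real (j hi) - real (j lo)\<bar>" "0 \<le> u" "0 \<le> v"
    using k(1,2) unfolding u_def v_def by (auto simp: min_def max_def split: if_splits)
  have "d (\<eta> k) (\<eta> (j lo)) \<le> u + 40 * D" "d (\<eta> k) (\<eta> (j hi)) \<le> v + 40 * D"
      "u + v \<le> d (\<eta> (j lo)) (\<eta> (j hi)) + 40 * D"
    using dk [of k "j lo"] dk [of k "j hi"] dk [of "j lo" "j hi"] kL L near uv
    unfolding u_def [symmetric] v_def [symmetric] uv(1) [symmetric] by auto
  moreover have "u + v \<le> 441000 * D" using near uv by simp
  ultimately have e1: "d (\<eta> k) (\<eta> (j lo)) + d (\<eta> k) (\<eta> (j hi)) - d (\<eta> (j lo)) (\<eta> (j hi)) \<le> 120 * D"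
    and ub: "d (\<eta> k) (\<eta> (j lo)) \<le> 500000 * D" "d (\<eta> k) (\<eta> (j hi)) \<le> 500000 * D"
    using uv(2,3) D_ge by linarith+
  have ub2: "d (\<eta> k) (\<xi> lo) \<le> 600000 * D" "d (\<eta> k) (\<xi> hi) \<le> 600000 * D"
    using triangle [of "\<eta> k" "\<eta> (j lo)" "\<xi> lo"] triangle [of "\<eta> k" "\<eta> (j hi)" "\<xi> hi"] in_M kM a' b' ub
      commute [of "\<eta> (j lo)" "\<xi> lo"] commute [of "\<eta> (j hi)" "\<xi> hi"] D_ge by auto
  \<comment> \<open>The end points on \<open>\<eta>\<close> are now exchanged for those on
    \<open>\<xi>\<close>, first at \<open>lo\<close>, then at \<open>hi\<close>. Away from the ends
    of the path, \<open>swap_excess\<close> tolerates an exchange over \<open>20000 * D\<close>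
    because the end is about \<open>200000 * D\<close> from \<open>\<eta> k\<close>.\<close>
  have e2: "d (\<eta> k) (\<xi> lo) + d (\<eta> k) (\<eta> (j hi)) - d (\<xi> lo) (\<eta> (j hi)) \<le> 120 * D + 2 * D"
  proof (cases "lo = 0")
    case True
    then show ?thesis using e1 a0 by simp
  next
    case False
    have "d (\<xi> lo) (\<eta> k) \<le> d (\<eta> k) (\<eta> (j lo)) + 20000 * D"
      using triangle [of "\<xi> lo" "\<eta> (j lo)" "\<eta> k"] in_M kM a' commute [of "\<eta> k" "\<eta> (j lo)"] by auto
    then show ?thesis
      by (intro swap_excess [OF kM _ _ _ _ _ _ e1])
       (use in_M False lo x k(3) a' ub ub2 D_ge commute [of "\<xi> lo" "\<eta> (j lo)"] commute [of "\<xi> lo" "\<eta> k"] in auto)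
  qed
  have e3: "d (\<eta> k) (\<xi> lo) + d (\<eta> k) (\<xi> hi) - d (\<xi> lo) (\<xi> hi) \<le> 400 * D"
  proof (cases "hi = T")
    case True
    have "d (\<eta> k) (\<xi> hi) \<le> d (\<eta> k) (\<eta> (j hi)) + 100 * D" "d (\<xi> lo) (\<eta> (j hi)) \<le> d (\<xi> lo) (\<xi> hi) + 100 * D"
      using triangle [of "\<eta> k" "\<eta> (j hi)" "\<xi> hi"] triangle [of "\<xi> lo" "\<xi> hi" "\<eta> (j hi)"] in_M kM b0 [OF True]
        commute [of "\<xi> hi" "\<eta> (j hi)"] by auto
    then show ?thesis using e2 D_ge by linarith
  next
    case False
    then have hi': "real hi - real i = 200000 * D" using hi by simp
    have far: "d (\<xi> lo) (\<xi> hi) \<le> d (\<eta> k) (\<xi> lo) + d (\<eta> k) (\<xi> hi)"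
      "d (\<eta> k) (\<xi> hi) \<le> d (\<eta> k) (\<eta> (j hi)) + 20000 * D"
      using triangle [of "\<xi> lo" "\<eta> k" "\<xi> hi"] triangle [of "\<eta> k" "\<eta> (j hi)" "\<xi> hi"] in_M kM b'
        commute [of "\<xi> lo" "\<eta> k"] commute [of "\<xi> hi" "\<eta> (j hi)"] by auto
    have "d (\<eta> k) (\<xi> hi) + d (\<eta> k) (\<xi> lo) - d (\<xi> hi) (\<xi> lo) \<le> 122 * D + 2 * D"
      by (rule swap_excess [of _ "\<eta> (j hi)"])
       (use far in_M kM e2 hi' x k(3) b' ub ub2 D_ge commute [of "\<xi> lo" "\<eta> (j hi)"] commute [of "\<xi> lo" "\<eta> k"]
          commute [of "\<xi> hi" "\<eta> (j hi)"] in auto)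
    then show ?thesis using D_ge commute [of "\<xi> hi" "\<xi> lo"] by simp
  qed
  \<comment> \<open>Both \<open>\<xi> i\<close> and \<open>\<eta> k\<close> are nearly between
    \<open>\<xi> lo\<close> and \<open>\<xi> hi\<close>, at nearly the same distance from
    \<open>\<xi> lo\<close>, so either sum on the right is close to the distance of these
    ends.\<close>
  have "d (\<xi> lo) (\<xi> hi) + d (\<xi> i) (\<eta> k) \<le> max (d (\<xi> lo) (\<xi> i) + d (\<xi> hi) (\<eta> k)) (d (\<xi> lo) (\<eta> k) + d (\<xi> hi) (\<xi> i)) + 2 * D"
    by (rule four_point) (use in_M kM x lo hi ub2 D_ge commute [of "\<xi> lo" "\<eta> k"] in auto)
  then have "d (\<xi> i) (\<eta> k) \<le> 3000 * D"
    using e3 k(3) x D_ge commute [of "\<xi> lo" "\<eta> k"] commute [of "\<xi> hi" "\<eta> k"] commute [of "\<xi> hi" "\<xi> i"]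
    by linarith
  with k show ?thesis by blast
qed

text \<open>Transitivity of fellow travelling with an unchanged constant rests on this contraction: local geodesics with common
  ends that stay moderately close are in fact very close.\<close>

lemma track_improve:
  assumes \<xi>: "local_geodesic \<xi> T" and \<eta>: "local_geodesic \<eta> L" and start: "\<xi> 0 = \<eta> 0"
    and end_dist: "d (\<xi> T) (\<eta> L) \<le> 100 * D"
    and tr: "track d (20000 * D) (100000 * D) \<xi> T \<eta> L"
  shows "track d (3000 * D) (10000 * D) \<xi> T \<eta> L"
proof -
  obtain j where j0: "j 0 = 0" and jT: "j T = L"
    and j1: "\<And>i. i \<le> T \<Longrightarrow> j i \<le> L \<and> d (\<xi> i) (\<eta> (j i)) \<le> 20000 * D"
    and j2: "\<And>i. i < T \<Longrightarrow> \<bar>real (j (Suc i)) - real (j i)\<bar> \<le> 100000 * D"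
    using tr unfolding track_def by blast
  note q\<xi> = local_geodesic_quasi [OF \<xi>] and q\<eta> = local_geodesic_quasi [OF \<eta>]
  define lo where "lo i = i - 200000 * \<delta>" for i
  define hi where "hi i = min T (i + 200000 * \<delta>)" for i
  have lo: "lo i \<le> i" "real i - real (lo i) \<le> 200000 * D" "lo i = 0 \<or> real i - real (lo i) = 200000 * D" for i
    by (auto simp: lo_def of_nat_diff split: nat_diff_split)
  have hi: "i \<le> hi i" "hi i \<le> T" "real (hi i) - real i \<le> 200000 * D" "hi i = T \<or> real (hi i) - real i = 200000 * D"
    if "i \<le> T" for i
    using that by (auto simp: hi_def min_def)
  have "\<exists>k. min (j (lo i)) (j (hi i)) \<le> k \<and> k \<le> max (j (lo i)) (j (hi i)) \<and> d (\<xi> i) (\<eta> k) \<le> 3000 * D \<and>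
      (i = 0 \<longrightarrow> k = 0) \<and> (i = T \<longrightarrow> k = L)" if i: "i \<le> T" for i
  proof (cases "i = 0 \<or> i = T")
    case True
    then show ?thesis
    proof
      assume "i = 0"
      then show ?thesis using j0 jT start local_geodesic_in [OF \<eta>, of 0]
        by (intro exI [of _ 0]) (auto simp: lo_def)
    next
      assume "i = T"
      moreover have "hi T = T" by (simp add: hi_def)
      ultimately show ?thesis using j0 jT end_dist D_ge
        by (intro exI [of _ L]) auto
    qed
  next
    case False
    then show ?thesis
      using track_improve_point [OF \<xi> \<eta> start end_dist j0 jT j1 j2 lo(1) hi(1) hi(2) lo(2) lo(3) hi(3) hi(4)]
        i by auto
  qed
  then obtain k where k: "\<And>i. i \<le> T \<Longrightarrow> min (j (lo i)) (j (hi i)) \<le> k i \<and> k i \<le> max (j (lo i)) (j (hi i)) \<and>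
      d (\<xi> i) (\<eta> (k i)) \<le> 3000 * D \<and> (i = 0 \<longrightarrow> k i = 0) \<and> (i = T \<longrightarrow> k i = L)"
    by metis
  have kL: "k i \<le> L" if "i \<le> T" for i
  proof -
    have "j (lo i) \<le> L" "j (hi i) \<le> L" using j1 lo(1) [of i] hi(2) [OF that] that by auto
    then show ?thesis using k [OF that] by auto
  qed
  have near: "\<bar>real (j b) - real (j a)\<bar> \<le> 500000 * D" if "a \<le> T" "b \<le> T" "\<bar>real b - real a\<bar> \<le> 400000 * D + 1" for a b
  proof -
    have *: "\<bar>real (j b) - real (j a)\<bar> \<le> real b - real a + 2 * (20000 * D) + 40 * D + 40 * D"
      if "a \<le> b" "b \<le> T" "real b - real a \<le> 400000 * D + 1" for a b
      by (rule track_lipschitz [OF q\<xi> \<eta> j1 j2]) (use that D_ge in auto)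
    show ?thesis using that *[of a b] *[of b a] D_ge by (cases "a \<le> b") auto
  qed
  \<comment> \<open>The new indices are first located coarsely between values of \<open>j\<close>,
    which brings their gap into the range where \<open>\<eta>\<close> is almost geodesic; only then
    does the distance of at most \<open>6000 * D + 1\<close> yield a small increment.\<close>
  have "\<bar>real (k (Suc i)) - real (k i)\<bar> \<le> 10000 * D" if i: "i < T" for i
  proof -
    have *: "lo (Suc i) \<le> T" "lo i \<le> T" "hi (Suc i) \<le> T" "hi i \<le> T"
      using lo(1) [of i] lo(1) [of "Suc i"] hi(2) [of i] hi(2) [of "Suc i"] i by auto
    have step: "real (Suc i) = real i + 1" by simp
    have close: "\<bar>real a - real b\<bar> \<le> 400000 * D + 1" if "a \<in> {lo (Suc i), hi (Suc i)}" "b \<in> {lo i, hi i}" for a b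
    proof -
      have "\<bar>real a - real (Suc i)\<bar> \<le> 200000 * D" "\<bar>real b - real i\<bar> \<le> 200000 * D"
        using that lo(1,2) [of i] lo(1,2) [of "Suc i"] hi(1,3) [of i] hi(1,3) [of "Suc i"] i by auto
      then show ?thesis using step by linarith
    qed
    have c: "\<bar>real (j a) - real (j b)\<bar> \<le> 500000 * D" if "a \<in> {lo (Suc i), hi (Suc i)}" "b \<in> {lo i, hi i}" for a b
      by (rule near) (use that close [OF that] * in auto)
    have "k i \<ge> min (j (lo i)) (j (hi i))" "k i \<le> max (j (lo i)) (j (hi i))"
      "k (Suc i) \<ge> min (j (lo (Suc i))) (j (hi (Suc i)))" "k (Suc i) \<le> max (j (lo (Suc i))) (j (hi (Suc i)))"
      using k [of i] k [of "Suc i"] i by auto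
    then obtain a b a' b' where "a \<in> {lo (Suc i), hi (Suc i)}" "j a \<le> k (Suc i)" "b \<in> {lo i, hi i}" "k i \<le> j b"
      "a' \<in> {lo (Suc i), hi (Suc i)}" "k (Suc i) \<le> j a'" "b' \<in> {lo i, hi i}" "j b' \<le> k i"
      by (auto simp: min_le_iff_disj le_max_iff_disj)
    then have "\<bar>real (k (Suc i)) - real (k i)\<bar> \<le> 500000 * D"
      using c [of a b] c [of a' b'] by linarith
    then have "\<bar>real (k (Suc i)) - real (k i)\<bar> \<le> d (\<eta> (k i)) (\<eta> (k (Suc i))) + 40 * D"
      using quasi_geodesic_dist [OF q\<eta>, of "k i" "k (Suc i)"] quasi_geodesic_dist [OF q\<eta>, of "k (Suc i)" "k i"]
        kL [of i] kL [of "Suc i"] i commute [of "\<eta> (k i)" "\<eta> (k (Suc i))"] D_ge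
      by (cases "k i \<le> k (Suc i)") auto
    moreover have "d (\<eta> (k i)) (\<eta> (k (Suc i))) \<le> 3000 * D + 1 + 3000 * D"
      using triangle [of "\<eta> (k i)" "\<xi> i" "\<eta> (k (Suc i))"] triangle [of "\<xi> i" "\<xi> (Suc i)" "\<eta> (k (Suc i))"]
        local_geodesic_in [OF \<xi>, of i] local_geodesic_in [OF \<xi>, of "Suc i"] kL [of i] kL [of "Suc i"]
        local_geodesic_in [OF \<eta>, of "k i"] local_geodesic_in [OF \<eta>, of "k (Suc i)"] i
        local_geodesic_step [OF \<xi> i] k [of i] k [of "Suc i"] commute [of "\<eta> (k i)" "\<xi> i"] by auto
    ultimately show ?thesis using D_ge by linarith
  qed
  then show ?thesis
    unfolding track_def using k kL by (intro exI [of _ k]) auto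
qed

text \<open>Unlike \<open>track\<close>, this lets the end index be missed by a bounded amount, so that a constant path can fellow travel a short
  nonconstant one.\<close>

definition fellow :: "real \<Rightarrow> (nat \<Rightarrow> 'a) \<Rightarrow> nat \<Rightarrow> (nat \<Rightarrow> 'a) \<Rightarrow> nat \<Rightarrow> bool"
  where "fellow c \<xi> T \<eta> L \<longleftrightarrow> (\<exists>j :: nat \<Rightarrow> nat. j 0 = 0 \<and> real L - real (j T) \<le> c \<and>
    (\<forall>i\<le>T. j i \<le> L \<and> d (\<xi> i) (\<eta> (j i)) \<le> c) \<and>
    (\<forall>i<T. \<bar>real (j (Suc i)) - real (j i)\<bar> \<le> c))"

lemma track_fellow:
  assumes "track d c c \<xi> T \<eta> L" "0 \<le> c"
  shows "fellow c \<xi> T \<eta> L"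
proof -
  obtain j where "j 0 = 0" "j T = L" "\<And>i. i \<le> T \<Longrightarrow> j i \<le> L \<and> d (\<xi> i) (\<eta> (j i)) \<le> c"
    "\<And>i. i < T \<Longrightarrow> \<bar>real (j (Suc i)) - real (j i)\<bar> \<le> c"
    using assms(1) unfolding track_def by blast
  with assms(2) show ?thesis unfolding fellow_def by (intro exI [of _ j]) simp
qed

text \<open>Composing the index maps gives distance \<open>20000 * D\<close>, and
  \<open>track_improve\<close> brings it back below \<open>10000 * D\<close>; only the outer ends
  have to be within \<open>100 * D\<close>.\<close>

lemma fellow_trans:
  assumes \<xi>: "local_geodesic \<xi> T" and \<eta>: "local_geodesic \<eta> L" and \<zeta>: "local_geodesic \<zeta> R"
    and start: "\<xi> 0 = \<zeta> 0" and end_dist: "d (\<xi> T) (\<zeta> R) \<le> 100 * D"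
    and 1: "fellow (10000 * D) \<xi> T \<eta> L" and 2: "fellow (10000 * D) \<eta> L \<zeta> R"
  shows "fellow (10000 * D) \<xi> T \<zeta> R"
proof -
  obtain j where j: "j 0 = 0" "real L - real (j T) \<le> 10000 * D"
    "\<And>i. i \<le> T \<Longrightarrow> j i \<le> L \<and> d (\<xi> i) (\<eta> (j i)) \<le> 10000 * D"
    "\<And>i. i < T \<Longrightarrow> \<bar>real (j (Suc i)) - real (j i)\<bar> \<le> 10000 * D"
    using 1 unfolding fellow_def by blast
  obtain k where k: "k 0 = 0" "real R - real (k L) \<le> 10000 * D"
    "\<And>i. i \<le> L \<Longrightarrow> k i \<le> R \<and> d (\<eta> i) (\<zeta> (k i)) \<le> 10000 * D"
    "\<And>i. i < L \<Longrightarrow> \<bar>real (k (Suc i)) - real (k i)\<bar> \<le> 10000 * D"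
    using 2 unfolding fellow_def by blast
  have lip: "\<bar>real (k b) - real (k a)\<bar> \<le> 31000 * D" if "a \<le> L" "b \<le> L" "\<bar>real b - real a\<bar> \<le> 10000 * D" for a b
  proof -
    have *: "\<bar>real (k b) - real (k a)\<bar> \<le> real b - real a + 2 * (10000 * D) + 40 * D + 40 * D"
      if "a \<le> b" "b \<le> L" "real b - real a \<le> 10000 * D" for a b
      by (rule track_lipschitz [OF local_geodesic_quasi [OF \<eta>] \<zeta> k(3,4)]) (use that D_ge in auto)
    show ?thesis using that *[of a b] *[of b a] D_ge by (cases "a \<le> b") auto
  qed
  have close: "d (\<xi> i) (\<zeta> (k (j i))) \<le> 20000 * D" if "i \<le> T" for i
    using triangle [of "\<xi> i" "\<eta> (j i)" "\<zeta> (k (j i))"] j(3) [OF that] k(3) [of "j i"] that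
      local_geodesic_in [OF \<xi> that] local_geodesic_in [OF \<eta>, of "j i"] local_geodesic_in [OF \<zeta>, of "k (j i)"]
      D_ge by auto
  have step: "\<bar>real (k (j (Suc i))) - real (k (j i))\<bar> \<le> 31000 * D" if "i < T" for i
    using lip [of "j i" "j (Suc i)"] j(3) [of i] j(3) [of "Suc i"] j(4) [OF that] that by auto
  have last: "real R - real (k (j T)) \<le> 41000 * D"
    using lip [of "j T" L] j(2) j(3) [of T] k(2) by auto
  show ?thesis
  \<comment> \<open>A constant \<open>\<xi>\<close> leaves no step in which the end index could be
    corrected, but then \<open>\<zeta>\<close> is short because it nearly returns to its
    start.\<close>
  proof (cases "T = 0")
    case True
    then have "d (\<zeta> 0) (\<zeta> R) \<le> 100 * D" "real R \<le> 41000 * D"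
      using start end_dist last j k by auto
    then have "real R \<le> 10000 * D"
      using quasi_geodesic_dist [OF local_geodesic_quasi [OF \<zeta>], of 0 R] D_ge by auto
    then show ?thesis unfolding fellow_def using True start local_geodesic_in [OF \<zeta>, of 0]
      by (intro exI [of _ "\<lambda>_. 0"]) auto
  next
    case False
    \<comment> \<open>Contraction needs a track ending exactly at \<open>R\<close>; the last index
      is moved there, a jump of at most \<open>31000 * D + 41000 * D\<close>.\<close>
    define m where "m = (\<lambda>i. k (j i))(T := R)"
    have "track d (20000 * D) (100000 * D) \<xi> T \<zeta> R"
      unfolding track_def
    proof (intro exI [of _ m] conjI allI impI)
      show "m 0 = 0" "m T = R" using False j k by (auto simp: m_def)
      show "m i \<le> R" "d (\<xi> i) (\<zeta> (m i)) \<le> 20000 * D" if "i \<le> T" for i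
        using that close j(3) k(3) end_dist D_ge by (auto simp: m_def)
      show "\<bar>real (m (Suc i)) - real (m i)\<bar> \<le> 100000 * D" if "i < T" for i
      proof (cases "Suc i = T")
        case True
        have "k (j T) \<le> R" using j(3) [of T] k(3) by simp
        moreover have "\<bar>real R - real (k (j i))\<bar> \<le> \<bar>real R - real (k (j T))\<bar> + \<bar>real (k (j T)) - real (k (j i))\<bar>"
          by simp
        ultimately show ?thesis
          using step [OF that] last True D_ge by (simp add: m_def)
      next
        case False
        then show ?thesis using step [OF that] that D_ge by (simp add: m_def)
      qed
    qed
    then have "track d (10000 * D) (10000 * D) \<xi> T \<zeta> R"
      by (rule track_mono [OF track_improve [OF \<xi> \<zeta> start end_dist]]) auto
    then show ?thesis by (rule track_fellow) simp
  qed
qed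

section \<open>Polygonal paths without corners\<close>

text \<open>Both paths are nearly geodesic from \<open>a\<close> to \<open>b\<close>, so equal times
  give close points. If \<open>y\<close> is shorter, the rest of \<open>x\<close> is within
  \<open>4 * e\<close> of \<open>b\<close>. The condition \<open>0 < m\<close> allows the index map
  to start at \<open>0\<close> and end at \<open>n\<close>.\<close>

lemma track_geodesic_piece:
  assumes ab: "a \<in> M" "b \<in> M" "d a b \<le> 1000000 * D" and e: "0 \<le> e" "e \<le> 100000 * D"
    and x: "\<And>i. i \<le> m \<Longrightarrow> x i \<in> M \<and> d (x i) a \<le> real i + e \<and> d (x i) b \<le> real m - real i + e"
    and y: "\<And>i. i \<le> n \<Longrightarrow> y i \<in> M \<and> d (y i) a \<le> real i + e \<and> d (y i) b \<le> real n - real i + e"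
    and mn: "real m \<le> d a b + e" "real n \<le> d a b + e" "0 < m"
  shows "track d (5 * e + 2 * D) (3 * e + 1) x m y n"
proof -
  have "d a b \<le> real n + 2 * e"
    using triangle [of a "y 0" b] y [of 0] ab commute [of a "y 0"] by auto
  then have m_le: "real m - real n \<le> 3 * e" using mn by simp
  have "d a b \<le> real m + 2 * e"
    using triangle [of a "x 0" b] x [of 0] ab commute [of a "x 0"] by auto
  then have n_le: "real n - real m \<le> 3 * e" using mn by simp
  define j where "j i = (if i = m then n else min i n)" for i
  show ?thesis
    unfolding track_def
  proof (intro exI [of _ j] conjI allI impI)
    show "d (x i) (y (j i)) \<le> 5 * e + 2 * D" if i: "i \<le> m" for i
    proof (cases "i < m \<and> i \<le> n")
      case True
      then have "j i = i" by (auto simp: j_def)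
      have "d a b + d (x i) (y i) \<le> max (d a (x i) + d b (y i)) (d a (y i) + d b (x i)) + 2 * D"
        by (rule four_point)
          (use True ab x [of i] y [of i] e mn commute [of a "x i"] commute [of a "y i"] in auto)
      then show ?thesis
        using x [of i] y [of i] True mn commute [of a "x i"] commute [of a "y i"] commute [of b "x i"]
          commute [of b "y i"] e by (simp add: \<open>j i = i\<close>) linarith
    next
      case False
      then have "j i = n" using i by (auto simp: j_def)
      have "d (x i) b \<le> 4 * e" using False i x [of i] m_le e by (cases "i = m") auto
      moreover have "d (y n) b \<le> e" using y [of n] by simp
      ultimately show ?thesis
        using triangle [of "x i" b "y n"] x [OF i] y [of n] ab commute [of b "y n"]
        by (simp add: \<open>j i = n\<close>)
    qed
    show "\<bar>real (j (Suc i)) - real (j i)\<bar> \<le> 3 * e + 1" if i: "i < m" for i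
      using that n_le e by (auto simp: j_def min_def)
  qed (use \<open>0 < m\<close> in \<open>auto simp: j_def\<close>)
qed

text \<open>Segments are at least as long as a window, so a window has at most one vertex in its
  interior, where distances add up by the corner condition. The induction keeps track of the last
  segment, of length \<open>m\<close>, since it must be geodesic as a whole.\<close>

lemma concat_chain:
  assumes q: "\<And>l. l \<le> k \<Longrightarrow> q l \<in> M"
    and corner: "\<And>l. Suc l < k \<Longrightarrow> d (q l) (q (Suc l)) + d (q (Suc l)) (q (Suc (Suc l))) = d (q l) (q (Suc (Suc l)))"
    and long: "k \<le> 1 \<or> (\<forall>l<k. 200000 * D \<le> d (q l) (q (Suc l)))"
    and t: "t 0 = 0" "\<And>l. l < k \<Longrightarrow> t l \<le> t (Suc l)"
    and piece: "\<And>l g n. l < k \<Longrightarrow> quasi_geodesic M d 0 (real n) g n \<Longrightarrow> g 0 = q l \<Longrightarrow> g n = q (Suc l) \<Longrightarrow>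
      track d c K (\<lambda>i. \<xi> (t l + i)) (t (Suc l) - t l) g n \<and> track d c K g n (\<lambda>i. \<xi> (t l + i)) (t (Suc l) - t l)"
    and "1 \<le> k"
  shows "\<exists>\<eta> L. local_geodesic \<eta> L \<and> \<eta> 0 = q 0 \<and> \<eta> L = q k \<and> track d c K \<xi> (t k) \<eta> L \<and> track d c K \<eta> L \<xi> (t k)"
proof -
  have "Suc s \<le> k \<Longrightarrow> \<exists>\<eta> L m. local_geodesic \<eta> L \<and> \<eta> 0 = q 0 \<and> \<eta> L = q (Suc s) \<and>
      track d c K \<xi> (t (Suc s)) \<eta> L \<and> track d c K \<eta> L \<xi> (t (Suc s)) \<and>
      m \<le> L \<and> \<eta> (L - m) = q s \<and> quasi_geodesic M d 0 (real m) (\<lambda>i. \<eta> (L - m + i)) m \<and>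
      (L = m \<or> 200000 * D \<le> real m)" for s
  proof (induction s)
    case 0
    obtain g n where g: "g 0 = q 0" "g n = q 1" "quasi_geodesic M d 0 (real n) g n"
      using geodesic_exists [of "q 0" "q 1"] q 0 by auto
    then show ?case
      using geodesic_local [OF g(3)] piece [of 0 n g] 0 t(1)
      by (intro exI [of _ g] exI [of _ n]) auto
  next
    case (Suc s)
    then obtain \<eta> L m where \<eta>: "local_geodesic \<eta> L" "\<eta> 0 = q 0" "\<eta> L = q (Suc s)"
      and tr: "track d c K \<xi> (t (Suc s)) \<eta> L" "track d c K \<eta> L \<xi> (t (Suc s))"
      and m: "m \<le> L" "\<eta> (L - m) = q s" "quasi_geodesic M d 0 (real m) (\<lambda>i. \<eta> (L - m + i)) m"
        "L = m \<or> 200000 * D \<le> real m"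
      using Suc.IH [OF Suc_leD [OF Suc.prems]] by blast
    obtain g n where g: "g 0 = q (Suc s)" "g n = q (Suc (Suc s))" "quasi_geodesic M d 0 (real n) g n"
      using geodesic_exists [of "q (Suc s)" "q (Suc (Suc s))"] q Suc.prems by auto
    define \<theta> where "\<theta> i = (if i \<le> L then \<eta> i else g (i - L))" for i
    have \<theta>1: "\<theta> i = \<eta> i" if "i \<le> L" for i using that by (simp add: \<theta>_def)
    have \<theta>2: "\<theta> i = g (i - L)" if "L \<le> i" for i using that \<eta>(3) g(1) by (auto simp: \<theta>_def)
    have n: "real n = d (q (Suc s)) (q (Suc (Suc s)))"
      using geodesic_dist [OF g(3), of 0 n] g by simp
    have ms: "real m = d (q s) (q (Suc s))"
      using geodesic_dist [OF m(3), of 0 m] m \<eta>(3) by simp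
    have corner': "d (q s) (q (Suc (Suc s))) = real m + real n"
      using corner [of s] Suc.prems n ms by auto
    have "local_geodesic \<theta> (L + n)"
      unfolding local_geodesic_def quasi_geodesic_def
    proof (intro conjI allI impI)
      show "\<theta> i \<in> M" if "i \<le> L + n" for i
        using that local_geodesic_in [OF \<eta>(1)] quasi_geodesic_in [OF g(3)] by (auto simp: \<theta>_def)
      fix i j assume ij: "i \<le> j" "j \<le> L + n" "real j - real i \<le> 200000 * D"
      consider "j \<le> L" | "L \<le> i" | "i < L" "L < j" by linarith
      then have "d (\<theta> i) (\<theta> j) = real j - real i"
      proof cases
        case 1
        then show ?thesis using local_geodesic_dist [OF \<eta>(1)] ij by (simp add: \<theta>1)
      next
        case 2
        then show ?thesis using geodesic_dist [OF g(3), of "i - L" "j - L"] ij by (simp add: \<theta>2 of_nat_diff)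
      next
        case 3
        \<comment> \<open>A window reaching past \<open>L\<close> cannot begin before the last
          segment, which is at least a window long unless it is the whole path.\<close>
        have "L - m \<le> i"
        proof (rule ccontr)
          assume "\<not> L - m \<le> i"
          then show False using m(1,4) ij 3 by linarith
        qed
        define u where "u = i - (L - m)"
        have u: "i = L - m + u" "u \<le> m" using \<open>L - m \<le> i\<close> 3 by (auto simp: u_def)
        define v where "v = j - L"
        have v: "j = L + v" "v \<le> n" using 3 ij by (auto simp: v_def)
        have e: "d (q s) (\<eta> i) = real u" "d (\<eta> i) (q (Suc s)) = real m - real u"
          using geodesic_dist [OF m(3), of 0 u] geodesic_dist [OF m(3), of u m] m u \<eta>(3) by auto
        have f: "d (q (Suc s)) (g v) = real v" "d (g v) (q (Suc (Suc s))) = real n - real v"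
          using geodesic_dist [OF g(3), of 0 v] geodesic_dist [OF g(3), of v n] g v by auto
        have in_M: "\<eta> i \<in> M" "g v \<in> M" "q s \<in> M" "q (Suc s) \<in> M" "q (Suc (Suc s)) \<in> M"
          using local_geodesic_in [OF \<eta>(1), of i] 3 quasi_geodesic_in [OF g(3) v(2)] q Suc.prems by auto
        have "d (\<eta> i) (g v) = real m - real u + real v"
          using triangle [of "\<eta> i" "q (Suc s)" "g v"] triangle [of "q s" "\<eta> i" "q (Suc (Suc s))"]
            triangle [of "\<eta> i" "g v" "q (Suc (Suc s))"] in_M e f corner' by auto
        moreover have "real j - real i = real m - real u + real v"
          using u v m(1) by (simp add: of_nat_diff)
        ultimately show ?thesis using 3 by (simp add: \<theta>1 \<theta>2 v_def)
      qed
      then show "\<bar>d (\<theta> i) (\<theta> j) - (real j - real i)\<bar> \<le> 0" by simp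
    qed
    moreover have "track d c K \<xi> (t (Suc s) + (t (Suc (Suc s)) - t (Suc s))) \<theta> (L + n)"
      by (rule track_append [OF track_cong [OF tr(1)] track_cong [OF conjunct1 [OF piece [OF _ g(3,1,2)]]]])
        (use Suc.prems \<theta>1 \<theta>2 in auto)
    moreover have "track d c K \<theta> (L + n) \<xi> (t (Suc s) + (t (Suc (Suc s)) - t (Suc s)))"
      by (rule track_append [OF track_cong [OF tr(2)] track_cong [OF conjunct2 [OF piece [OF _ g(3,1,2)]]]])
        (use Suc.prems \<theta>1 \<theta>2 in auto)
    moreover have "t (Suc s) + (t (Suc (Suc s)) - t (Suc s)) = t (Suc (Suc s))"
      using t(2) [of "Suc s"] Suc.prems by simp
    moreover have "quasi_geodesic M d 0 (real n) (\<lambda>i. \<theta> (L + n - n + i)) n"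
      using g(3) by (simp add: \<theta>2)
    moreover have "200000 * D \<le> real n"
      using long n Suc.prems by auto
    ultimately show ?case
      using \<eta> g by (intro exI [of _ \<theta>] exI [of _ "L + n"] exI [of _ n]) (simp add: \<theta>1 \<theta>2)
  qed
  from this [of "k - 1"] show ?thesis using \<open>1 \<le> k\<close> by auto
qed

text \<open>The bound \<open>160 * D\<close> for \<open>m\<close> is no larger than the one allowed
  for \<open>a\<close> and \<open>b\<close>: exchanging the two end points raises the excess at
  \<open>p\<close> from \<open>150 * D\<close> only to \<open>154 * D\<close>, and a last four-point
  inequality adds \<open>2 * D\<close>. So vertices can be replaced without drifting away from the
  sample points.\<close>

lemma corner_point:
  assumes in_M: "p' \<in> M" "p \<in> M" "p'' \<in> M" "a \<in> M" "b \<in> M"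
    and p: "390000 * D \<le> d p' p" "d p' p \<le> 900000 * D" "390000 * D \<le> d p p''" "d p p'' \<le> 900000 * D"
    and excess: "d p' p + d p p'' - d p' p'' \<le> 150 * D"
    and ab: "d a p' \<le> 160 * D" "d b p'' \<le> 160 * D"
  shows "\<exists>m\<in>M. d m p \<le> 160 * D \<and> d a m + d m b = d a b"
proof -
  have pa: "\<bar>d p a - d p' p\<bar> \<le> 160 * D" "\<bar>d p b - d p p''\<bar> \<le> 160 * D"
    using triangle [of p a p'] triangle [of p p' a] triangle [of p b p''] triangle [of p p'' b] in_M ab
      commute [of p p'] commute [of p' a] commute [of p'' b] by auto
  have "d p a + d p p'' - d a p'' \<le> 150 * D + 2 * D"
    by (rule swap_excess [of _ p']) (use in_M p excess ab pa commute [of p' a] commute [of p p'] D_ge in auto)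
  then have "d p b + d p a - d b a \<le> 152 * D + 2 * D"
    by (intro swap_excess [of _ p''])
      (use in_M p excess ab pa commute [of p'' b] commute [of p'' a] commute [of p p'] D_ge in auto)
  then have ex: "d p b + d p a - d a b \<le> 154 * D" using commute [of a b] by simp
  obtain g n where g: "g 0 = a" "g n = b" "quasi_geodesic M d 0 (real n) g n"
    using geodesic_exists in_M by blast
  obtain h u where h: "h 0 = a" "h u = p" "quasi_geodesic M d 0 (real u) h u"
    using geodesic_exists in_M by blast
  have n: "d a b = real n" and u: "d a p = real u"
    using geodesic_dist [OF g(3), of 0 n] geodesic_dist [OF h(3), of 0 u] g h by auto
  have un: "u \<le> n"
    using ex n u p pa commute [of p a] D_ge by linarith
  have m: "g u \<in> M" "d a (g u) = real u" "d (g u) b = real n - real u"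
    using quasi_geodesic_in [OF g(3) un] geodesic_dist [OF g(3), of 0 u] geodesic_dist [OF g(3), of u n] un g by auto
  have "d a b + d (g u) p \<le> max (d a (g u) + d b p) (d a p + d b (g u)) + 2 * D"
    by (rule four_point)
      (use in_M m n u pa p commute [of p a] triangle [of a p b] commute [of p b] un D_ge in auto)
  then have "d (g u) p \<le> 160 * D"
    using ex m n u commute [of p a] commute [of p b] commute [of b "g u"] D_ge by linarith
  then show ?thesis using m n by (intro bexI [of _ "g u"]) auto
qed

lemma dist_Nats: "x \<in> M \<Longrightarrow> y \<in> M \<Longrightarrow> d x y \<in> \<nat>"
  using geodesic_exists [of x y] geodesic_dist by (metis le_refl le0 diff_zero of_nat_0 of_nat_in_Nats)

text \<open>Among the chains that stay close to the sample points the shortest one has no corners: a geodesic between the two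
  neighbours of a point passes close to the sample point.\<close>

lemma chain_without_corners:
  assumes p: "\<And>l. l \<le> k \<Longrightarrow> p l \<in> M"
    and len: "\<And>l. l < k \<Longrightarrow> 1 < k \<Longrightarrow> 390000 * D \<le> d (p l) (p (Suc l)) \<and> d (p l) (p (Suc l)) \<le> 900000 * D"
    and excess: "\<And>l. Suc l < k \<Longrightarrow>
      d (p l) (p (Suc l)) + d (p (Suc l)) (p (Suc (Suc l))) - d (p l) (p (Suc (Suc l))) \<le> 150 * D"
  shows "\<exists>q. q 0 = p 0 \<and> q k = p k \<and> (\<forall>l\<le>k. q l \<in> M \<and> d (q l) (p l) \<le> 160 * D) \<and>
    (\<forall>l. Suc l < k \<longrightarrow> d (q l) (q (Suc l)) + d (q (Suc l)) (q (Suc (Suc l))) = d (q l) (q (Suc (Suc l))))"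
proof -
  define Q where "Q = {q. q 0 = p 0 \<and> q k = p k \<and> (\<forall>l\<le>k. q l \<in> M \<and> d (q l) (p l) \<le> 160 * D)}"
  define S where "S q = (\<Sum>l<k. d (q l) (q (Suc l)))" for q
  have S: "S q = real (nat \<lfloor>S q\<rfloor>)" if "q \<in> Q" for q
  proof -
    have "d (q l) (q (Suc l)) \<in> \<nat>" if "l < k" for l
      using \<open>q \<in> Q\<close> dist_Nats that by (auto simp: Q_def)
    then have "S q \<in> \<nat>" unfolding S_def by (induction k) auto
    then show ?thesis by (auto elim: Nats_cases)
  qed
  have "p \<in> Q" using p by (auto simp: Q_def)
  \<comment> \<open>Distances are natural numbers, so a chain of least total length exists.\<close>
  then obtain q where q: "q \<in> Q" and least: "\<And>q'. q' \<in> Q \<Longrightarrow> nat \<lfloor>S q\<rfloor> \<le> nat \<lfloor>S q'\<rfloor>"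
    using ex_has_least_nat [of "\<lambda>q. q \<in> Q" p "\<lambda>q. nat \<lfloor>S q\<rfloor>"] by blast
  have "d (q l) (q (Suc l)) + d (q (Suc l)) (q (Suc (Suc l))) = d (q l) (q (Suc (Suc l)))" if l: "Suc l < k" for l
  proof -
    have in_M: "q l \<in> M" "q (Suc l) \<in> M" "q (Suc (Suc l)) \<in> M" using q l by (auto simp: Q_def)
    have "\<exists>m\<in>M. d m (p (Suc l)) \<le> 160 * D \<and> d (q l) m + d m (q (Suc (Suc l))) = d (q l) (q (Suc (Suc l)))"
      by (rule corner_point [of "p l" _ "p (Suc (Suc l))"])
        (use p in_M q l len [of l] len [of "Suc l"] excess [OF l] in \<open>auto simp: Q_def\<close>)
    then obtain m where m: "m \<in> M" "d m (p (Suc l)) \<le> 160 * D"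
      "d (q l) m + d m (q (Suc (Suc l))) = d (q l) (q (Suc (Suc l)))" by blast
    \<comment> \<open>Moving one vertex onto a geodesic between its neighbours changes two summands
      only; minimality gives the reverse triangle inequality.\<close>
    define q' where "q' = q(Suc l := m)"
    have "q' \<in> Q" using q m l by (auto simp: Q_def q'_def)
    then have le: "S q \<le> S q'" using least S q by (metis of_nat_le_iff)
    have split: "(\<Sum>i<k. f i) = f l + f (Suc l) + (\<Sum>i\<in>{..<k} - {l, Suc l}. f i)" for f :: "nat \<Rightarrow> real"
      using l by (subst sum.subset_diff [of "{l, Suc l}"]) auto
    have "(\<Sum>i\<in>{..<k} - {l, Suc l}. d (q' i) (q' (Suc i))) = (\<Sum>i\<in>{..<k} - {l, Suc l}. d (q i) (q (Suc i)))"
      by (rule sum.cong) (auto simp: q'_def)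
    then have "d (q l) (q (Suc l)) + d (q (Suc l)) (q (Suc (Suc l))) \<le> d (q l) m + d m (q (Suc (Suc l)))"
      using le unfolding S_def split [of "\<lambda>l. d (q l) (q (Suc l))"] split [of "\<lambda>l. d (q' l) (q' (Suc l))"]
      by (simp add: q'_def)
    then show ?thesis using m(3) triangle [OF in_M] by simp
  qed
  then show ?thesis using q by (intro exI [of _ q]) (auto simp: Q_def)
qed

subsection \<open>Straightening\<close>

text \<open>Sample the path about every \<open>400000 * D\<close>; the geodesic segments of a
  cornerless chain near the samples form a local geodesic. The constant exceeds the
  \<open>40 * D\<close> of local geodesics to leave room for an appended edge or a slight
  bend.\<close>

lemma straighten:
  assumes \<xi>: "quasi_geodesic M d (50 * D) (2000000 * D) \<xi> T"
  shows "\<exists>\<eta> L. local_geodesic \<eta> L \<and> \<eta> 0 = \<xi> 0 \<and> \<eta> L = \<xi> T \<and> fellow (2100 * D) \<xi> T \<eta> L \<and> fellow (2100 * D) \<eta> L \<xi> T"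
\<comment> \<open>A short path may have equal end points, and a constant path has no track onto a
  nonconstant one; constant index maps suffice for \<open>fellow\<close>.\<close>
proof (cases "real T \<le> 1000 * D")
  case True
  have in_M: "\<xi> i \<in> M" if "i \<le> T" for i using quasi_geodesic_in [OF \<xi> that] .
  obtain \<eta> L where \<eta>: "\<eta> 0 = \<xi> 0" "\<eta> L = \<xi> T" "quasi_geodesic M d 0 (real L) \<eta> L"
    using geodesic_exists [of "\<xi> 0" "\<xi> T"] in_M by auto
  have \<xi>0: "d (\<xi> i) (\<xi> 0) \<le> 1050 * D" if "i \<le> T" for i
    using quasi_geodesic_dist [OF \<xi>, of 0 i] that True D_ge commute [of "\<xi> 0" "\<xi> i"] by auto
  have \<eta>0: "d (\<eta> 0) (\<eta> i) = real i" if "i \<le> L" for i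
    using geodesic_dist [OF \<eta>(3), of 0 i] that by simp
  have "real L \<le> 1050 * D"
    using \<eta>0 [of L] \<eta> \<xi>0 [of T] commute [of "\<xi> 0" "\<xi> T"] by simp
  then have "fellow (2100 * D) \<xi> T \<eta> L" "fellow (2100 * D) \<eta> L \<xi> T"
    unfolding fellow_def using \<xi>0 \<eta>0 \<eta>(1) True D_ge
    by (intro exI [of _ "\<lambda>_. 0"]; fastforce simp: commute [of _ "\<xi> 0"])+
  then show ?thesis using geodesic_local [OF \<eta>(3)] \<eta> by blast
next
  case False
  define g where "g = 400000 * \<delta>"
  have g: "real g = 400000 * D" "0 < g" using delta_pos by (auto simp: g_def)
  \<comment> \<open>The last segment takes the remainder of the division, so it is shorter than
    \<open>2 * g\<close>; \<open>max\<close> provides one segment when \<open>T < g\<close>.\<close>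
  define k where "k = max 1 (T div g)"
  define t where "t l = (if l < k then l * g else T)" for l
  have gap: "t l \<le> t (Suc l)" "t (Suc l) \<le> T" "real (t (Suc l)) - real (t l) \<le> 800000 * D"
    "1 < k \<Longrightarrow> 400000 * D \<le> real (t (Suc l)) - real (t l)"
    "1000 * D < real (t (Suc l)) - real (t l)" if l: "l < k" for l
  proof -
    have "T < T div g * g + g" using g by (metis div_mult_mod_eq mod_less_divisor add_less_cancel_left)
    have "T div g * g \<le> T" by simp
    consider "T div g = 0" "k = 1" | "T div g = k"
      unfolding k_def by linarith
    then have "T < k * g + g \<and> (1 < k \<longrightarrow> k * g \<le> T) \<and> (k = 1 \<longrightarrow> T < 2 * g)"
    proof cases
      case 1
      then show ?thesis using \<open>T < T div g * g + g\<close> by simp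
    next
      case 2
      then show ?thesis using \<open>T < T div g * g + g\<close> \<open>T div g * g \<le> T\<close> by auto
    qed
    then have T: "T < k * g + g" "1 < k \<Longrightarrow> k * g \<le> T" "k = 1 \<Longrightarrow> T < 2 * g" by auto
    have "t l \<le> t (Suc l) \<and> t (Suc l) \<le> T \<and> real (t (Suc l)) - real (t l) \<le> 800000 * D \<and>
      (1 < k \<longrightarrow> 400000 * D \<le> real (t (Suc l)) - real (t l)) \<and> 1000 * D < real (t (Suc l)) - real (t l)"
    proof (cases "Suc l < k")
      case True
      then have "t (Suc l) = t l + g" by (simp add: t_def)
      moreover have "t (Suc l) \<le> T"
      proof -
        have "Suc l * g \<le> k * g" using True by (intro mult_le_mono1) simp
        then show ?thesis using True T(2) by (simp add: t_def)
      qed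
      ultimately show ?thesis using g D_ge by simp
    next
      case False
      then have k: "k = Suc l" using l by simp
      then have *: "t (Suc l) = T" "t l = l * g" by (auto simp: t_def)
      have "real T - real (l * g) \<le> 2 * real g"
      proof -
        have "T \<le> l * g + 2 * g" using T(1) k by simp
        then have "real T \<le> real (l * g + 2 * g)" by (simp only: of_nat_le_iff)
        then show ?thesis by simp
      qed
      moreover have "1 < k \<Longrightarrow> l * g + g \<le> T" using T(2) k by simp
      then have "1 < k \<Longrightarrow> real (l * g + g) \<le> real T" by (simp only: of_nat_le_iff)
      then have "1 < k \<Longrightarrow> real g \<le> real T - real (l * g)" by simp
      moreover have "l = 0" if "\<not> 1 < k" using that k by simp
      ultimately show ?thesis
        using * g \<open>\<not> real T \<le> 1000 * D\<close> D_ge T(2) k by (cases "1 < k") (auto simp del: of_nat_mult)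
    qed
    then show "t l \<le> t (Suc l)" "t (Suc l) \<le> T" "real (t (Suc l)) - real (t l) \<le> 800000 * D"
      "1 < k \<Longrightarrow> 400000 * D \<le> real (t (Suc l)) - real (t l)"
      "1000 * D < real (t (Suc l)) - real (t l)" by auto
  qed
  have tT: "t l \<le> T" if "l \<le> k" for l
    using gap(1,2) [of l] that by (cases "l < k") (auto simp: t_def)
  have t0: "t 0 = 0" by (simp add: t_def k_def)
  define p where "p l = \<xi> (t l)" for l
  have p: "p l \<in> M" if "l \<le> k" for l using quasi_geodesic_in [OF \<xi> tT [OF that]] by (simp add: p_def)
  have pd: "\<bar>d (p l) (p (Suc l)) - (real (t (Suc l)) - real (t l))\<bar> \<le> 50 * D" if "l < k" for l
    unfolding p_def using gap [OF that] D_ge by (intro quasi_geodesic_dist [OF \<xi>]) auto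
  have pd2: "\<bar>d (p l) (p (Suc (Suc l))) - (real (t (Suc (Suc l))) - real (t l))\<bar> \<le> 50 * D" if "Suc l < k" for l
    unfolding p_def using gap [of l] gap [OF that] that D_ge by (intro quasi_geodesic_dist [OF \<xi>]) auto
  have "\<exists>q. q 0 = p 0 \<and> q k = p k \<and> (\<forall>l\<le>k. q l \<in> M \<and> d (q l) (p l) \<le> 160 * D) \<and>
    (\<forall>l. Suc l < k \<longrightarrow> d (q l) (q (Suc l)) + d (q (Suc l)) (q (Suc (Suc l))) = d (q l) (q (Suc (Suc l))))"
  proof (rule chain_without_corners [OF p])
    show "390000 * D \<le> d (p l) (p (Suc l)) \<and> d (p l) (p (Suc l)) \<le> 900000 * D" if "l < k" "1 < k" for l
      using pd [OF that(1)] gap [OF that(1)] that(2) D_ge by (auto simp: abs_le_iff)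
    show "d (p l) (p (Suc l)) + d (p (Suc l)) (p (Suc (Suc l))) - d (p l) (p (Suc (Suc l))) \<le> 150 * D"
      if "Suc l < k" for l
      using pd [of l] pd [OF that] pd2 [OF that] that by (auto simp: abs_le_iff)
  qed
  then obtain q where q: "q 0 = p 0" "q k = p k" and qM: "\<And>l. l \<le> k \<Longrightarrow> q l \<in> M"
    and qp: "\<And>l. l \<le> k \<Longrightarrow> d (q l) (p l) \<le> 160 * D"
    and corner: "\<And>l. Suc l < k \<Longrightarrow> d (q l) (q (Suc l)) + d (q (Suc l)) (q (Suc (Suc l))) = d (q l) (q (Suc (Suc l)))"
    by blast
  have qd: "\<bar>d (q l) (q (Suc l)) - d (p l) (p (Suc l))\<bar> \<le> 320 * D" if "l < k" for l
    using triangle [of "q l" "p l" "q (Suc l)"] triangle [of "p l" "p (Suc l)" "q (Suc l)"]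
      triangle [of "p l" "q l" "p (Suc l)"] triangle [of "q l" "q (Suc l)" "p (Suc l)"]
      p [of l] p [of "Suc l"] qM [of l] qM [of "Suc l"] qp [of l] qp [of "Suc l"] that
      commute [of "q l" "p l"] commute [of "q (Suc l)" "p (Suc l)"] by (auto simp: abs_le_iff)
  \<comment> \<open>The error \<open>400 * D\<close> covers the \<open>50 * D\<close> of the path
    and twice the \<open>160 * D\<close> by which vertices are displaced; the resulting
    \<open>2002 * D\<close> is below \<open>2100 * D\<close>.\<close>
  have "\<exists>\<eta> L. local_geodesic \<eta> L \<and> \<eta> 0 = q 0 \<and> \<eta> L = q k \<and>
      track d (5 * (400 * D) + 2 * D) (3 * (400 * D) + 1) \<xi> (t k) \<eta> L \<and>
      track d (5 * (400 * D) + 2 * D) (3 * (400 * D) + 1) \<eta> L \<xi> (t k)"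
  proof (rule concat_chain)
    show "q l \<in> M" if "l \<le> k" for l using qM [OF that] .
    show "d (q l) (q (Suc l)) + d (q (Suc l)) (q (Suc (Suc l))) = d (q l) (q (Suc (Suc l)))" if "Suc l < k" for l
      using corner [OF that] .
    show "k \<le> 1 \<or> (\<forall>l<k. 200000 * D \<le> d (q l) (q (Suc l)))"
    proof (cases "k \<le> 1")
      case False
      have "200000 * D \<le> d (q l) (q (Suc l))" if "l < k" for l
        using pd [OF that] qd [OF that] gap(4) [OF that] False D_ge by (auto simp: abs_le_iff)
      then show ?thesis by blast
    qed simp
    show "t 0 = 0" by fact
    show "t l \<le> t (Suc l)" if "l < k" for l using gap(1) [OF that] .
    show "1 \<le> k" by (simp add: k_def)
    fix l h n assume l: "l < k" and h: "quasi_geodesic M d 0 (real n) h n" "h 0 = q l" "h n = q (Suc l)"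
    let ?m = "t (Suc l) - t l"
    have m: "real ?m = real (t (Suc l)) - real (t l)" using gap(1) [OF l] by (simp add: of_nat_diff)
    have n: "real n = d (q l) (q (Suc l))" using geodesic_dist [OF h(1), of 0 n] h by simp
    have in_M: "q l \<in> M" "q (Suc l) \<in> M" "p l \<in> M" "p (Suc l) \<in> M" using qM p l by auto
    have ab: "d (q l) (q (Suc l)) \<le> 1000000 * D"
      using pd [OF l] qd [OF l] gap [OF l] D_ge by (auto simp: abs_le_iff)
    have x: "\<xi> (t l + i) \<in> M \<and> d (\<xi> (t l + i)) (q l) \<le> real i + 400 * D \<and>
        d (\<xi> (t l + i)) (q (Suc l)) \<le> real ?m - real i + 400 * D" if "i \<le> ?m" for i
    proof -
      have i: "t l \<le> t l + i" "t l + i \<le> t (Suc l)" "t l + i \<le> T" "t l \<le> T"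
        using that gap [OF l] by auto
      have M: "\<xi> (t l + i) \<in> M" using quasi_geodesic_in [OF \<xi> i(3)] .
      have "real i \<le> real ?m" using that by simp
      then have "\<bar>d (p l) (\<xi> (t l + i)) - real i\<bar> \<le> 50 * D"
          "\<bar>d (\<xi> (t l + i)) (p (Suc l)) - (real (t (Suc l)) - real (t l) - real i)\<bar> \<le> 50 * D"
        using quasi_geodesic_dist [OF \<xi> i(1) i(3)] quasi_geodesic_dist [OF \<xi> i(2) gap(2) [OF l]] gap(3) [OF l] m D_ge
        by (auto simp: p_def algebra_simps)
      then show ?thesis
        using M m triangle [of "\<xi> (t l + i)" "p l" "q l"] triangle [of "\<xi> (t l + i)" "p (Suc l)" "q (Suc l)"] in_M
          qp [of l] qp [of "Suc l"] l commute [of "q l" "p l"] commute [of "q (Suc l)" "p (Suc l)"]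
          commute [of "p l" "\<xi> (t l + i)"] D_ge by (auto simp: abs_le_iff)
    qed
    have y: "h i \<in> M \<and> d (h i) (q l) \<le> real i + 400 * D \<and> d (h i) (q (Suc l)) \<le> real n - real i + 400 * D"
      if "i \<le> n" for i
      using quasi_geodesic_in [OF h(1) that] geodesic_dist [OF h(1), of 0 i] geodesic_dist [OF h(1), of i n] h that
        commute [of "q l" "h i"] by auto
    have mn: "real ?m \<le> d (q l) (q (Suc l)) + 400 * D" "real n \<le> d (q l) (q (Suc l)) + 400 * D" "0 < ?m" "0 < n"
      using pd [OF l] qd [OF l] gap(5) [OF l] n m D_ge by (auto simp: abs_le_iff)
    have e: "0 \<le> 400 * D" "400 * D \<le> 100000 * D" by auto
    show "track d (5 * (400 * D) + 2 * D) (3 * (400 * D) + 1) (\<lambda>i. \<xi> (t l + i)) ?m h n \<and>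
        track d (5 * (400 * D) + 2 * D) (3 * (400 * D) + 1) h n (\<lambda>i. \<xi> (t l + i)) ?m"
      using track_geodesic_piece [OF in_M(1,2) ab e x y mn(1,2,3)]
        track_geodesic_piece [OF in_M(1,2) ab e y x mn(2,1,4)] by blast
  qed
  then obtain \<eta> L where \<eta>: "local_geodesic \<eta> L" "\<eta> 0 = q 0" "\<eta> L = q k"
      "track d (5 * (400 * D) + 2 * D) (3 * (400 * D) + 1) \<xi> (t k) \<eta> L"
      "track d (5 * (400 * D) + 2 * D) (3 * (400 * D) + 1) \<eta> L \<xi> (t k)" by blast
  have "t k = T" by (simp add: t_def)
  moreover have "fellow (2100 * D) \<xi> (t k) \<eta> L" "fellow (2100 * D) \<eta> L \<xi> (t k)"
    using track_fellow [OF track_mono [OF \<eta>(4)], of "2100 * D"] track_fellow [OF track_mono [OF \<eta>(5)], of "2100 * D"] D_ge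
    by auto
  ultimately show ?thesis using \<eta>(1-3) q t0 by (auto simp: p_def)
qed

lemma fellow_prefix:
  assumes "\<And>i. i \<le> Suc T \<Longrightarrow> \<xi> i \<in> M" "d (\<xi> T) (\<xi> (Suc T)) \<le> 1"
  shows "fellow (10000 * D) \<xi> T \<xi> (Suc T)" "fellow (10000 * D) \<xi> (Suc T) \<xi> T"
proof -
  show "fellow (10000 * D) \<xi> T \<xi> (Suc T)"
    unfolding fellow_def using assms(1) D_ge by (intro exI [of _ "\<lambda>i. i"]) auto
  show "fellow (10000 * D) \<xi> (Suc T) \<xi> T"
    unfolding fellow_def
  proof (intro exI [of _ "\<lambda>i. min i T"] conjI allI impI)
    show "d (\<xi> i) (\<xi> (min i T)) \<le> 10000 * D" if "i \<le> Suc T" for i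
      using that assms D_ge commute [of "\<xi> T" "\<xi> (Suc T)"] by (cases "i \<le> T") (auto simp: le_Suc_eq)
  qed (use D_ge in \<open>auto simp: min_def\<close>)
qed

text \<open>Appending the edge changes distances by at most 1, so \<open>straighten\<close> still
  applies; indices beyond \<open>T\<close> are afterwards replaced by \<open>T\<close>.\<close>

lemma lift_step:
  assumes \<xi>: "local_geodesic \<xi> T" and y: "y \<in> M" "d (\<xi> T) y \<le> 1"
  shows "\<exists>\<eta> L. local_geodesic \<eta> L \<and> \<eta> 0 = \<xi> 0 \<and> \<eta> L = y \<and> fellow (10000 * D) \<xi> T \<eta> L \<and> fellow (10000 * D) \<eta> L \<xi> T"
proof -
  define \<theta> where "\<theta> = \<xi>(Suc T := y)"
  have \<theta>: "\<theta> i = \<xi> i" if "i \<le> T" for i using that by (simp add: \<theta>_def)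
  have \<theta>T: "\<theta> (Suc T) = y" by (simp add: \<theta>_def)
  note q = local_geodesic_quasi [OF \<xi>]
  have q\<theta>: "quasi_geodesic M d (50 * D) (2000000 * D) \<theta> (Suc T)"
    unfolding quasi_geodesic_def
  proof (intro conjI allI impI)
    show \<theta>M: "\<theta> i \<in> M" if "i \<le> Suc T" for i
      using that y quasi_geodesic_in [OF q] by (auto simp: \<theta>_def le_Suc_eq)
    fix i j assume ij: "i \<le> j" "j \<le> Suc T" "real j - real i \<le> 2000000 * D"
    consider "j \<le> T" | "i \<le> T" "j = Suc T" | "i = Suc T" "j = Suc T" using ij by linarith
    then show "\<bar>d (\<theta> i) (\<theta> j) - (real j - real i)\<bar> \<le> 50 * D"
    proof cases
      case 1
      then show ?thesis using quasi_geodesic_dist [OF q ij(1) 1 ij(3)] ij D_ge by (simp add: \<theta>)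
    next
      case 2
      have "\<bar>d (\<xi> i) (\<xi> T) - (real T - real i)\<bar> \<le> 40 * D"
        using quasi_geodesic_dist [OF q 2(1)] 2 ij by simp
      moreover have "\<bar>d (\<xi> i) y - d (\<xi> i) (\<xi> T)\<bar> \<le> 1"
        using triangle [of "\<xi> i" "\<xi> T" y] triangle [of "\<xi> i" y "\<xi> T"] y quasi_geodesic_in [OF q] 2
          commute [of y "\<xi> T"] by auto
      ultimately show ?thesis using 2 D_ge by (auto simp: \<theta> \<theta>T abs_le_iff)
    next
      case 3
      then show ?thesis using y D_ge by (simp add: \<theta>T)
    qed
  qed
  obtain \<eta> L where \<eta>: "local_geodesic \<eta> L" "\<eta> 0 = \<theta> 0" "\<eta> L = \<theta> (Suc T)"
    "fellow (2100 * D) \<theta> (Suc T) \<eta> L" "fellow (2100 * D) \<eta> L \<theta> (Suc T)"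
    using straighten [OF q\<theta>] by blast
  obtain j where j: "j 0 = 0" "real L - real (j (Suc T)) \<le> 2100 * D"
    "\<And>i. i \<le> Suc T \<Longrightarrow> j i \<le> L \<and> d (\<theta> i) (\<eta> (j i)) \<le> 2100 * D"
    "\<And>i. i < Suc T \<Longrightarrow> \<bar>real (j (Suc i)) - real (j i)\<bar> \<le> 2100 * D"
    using \<eta>(4) unfolding fellow_def by blast
  have "real L - real (j T) \<le> 10000 * D"
    using j(2) j(4) [of T] D_ge by (auto simp: abs_le_iff)
  moreover have "j i \<le> L \<and> d (\<xi> i) (\<eta> (j i)) \<le> 10000 * D" if "i \<le> T" for i
    using j(3) [of i] that D_ge by (simp add: \<theta>)
  moreover have "\<bar>real (j (Suc i)) - real (j i)\<bar> \<le> 10000 * D" if "i < T" for i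
    using j(4) [of i] that D_ge by simp
  ultimately have 1: "fellow (10000 * D) \<xi> T \<eta> L"
    unfolding fellow_def using j(1) by (intro exI [of _ j]) simp
  obtain k where k: "k 0 = 0" "real (Suc T) - real (k L) \<le> 2100 * D"
    "\<And>i. i \<le> L \<Longrightarrow> k i \<le> Suc T \<and> d (\<eta> i) (\<theta> (k i)) \<le> 2100 * D"
    "\<And>i. i < L \<Longrightarrow> \<bar>real (k (Suc i)) - real (k i)\<bar> \<le> 2100 * D"
    using \<eta>(5) unfolding fellow_def by blast
  have 2: "fellow (10000 * D) \<eta> L \<xi> T"
    unfolding fellow_def
  proof (intro exI [of _ "\<lambda>i. min (k i) T"] conjI allI impI)
    show "real T - real (min (k L) T) \<le> 10000 * D"
      using k(2) D_ge by (auto simp: min_def)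
    show "min (k i) T \<le> T" for i by simp
    show "d (\<eta> i) (\<xi> (min (k i) T)) \<le> 10000 * D" if "i \<le> L" for i
    proof (cases "k i \<le> T")
      case True
      then show ?thesis using k(3) [OF that] D_ge by (simp add: \<theta>)
    next
      case False
      then have "k i = Suc T" using k(3) [OF that] by simp
      then show ?thesis
        using k(3) [OF that] triangle [of "\<eta> i" y "\<xi> T"] y commute [of y "\<xi> T"] D_ge
          local_geodesic_in [OF \<eta>(1) that] local_geodesic_in [OF \<xi>, of T] by (simp add: \<theta>T)
    qed
    show "\<bar>real (min (k (Suc i)) T) - real (min (k i) T)\<bar> \<le> 10000 * D" if "i < L" for i
      using k(4) [OF that] D_ge by (auto simp: min_def)
  qed (simp add: k(1))
  show ?thesis using 1 2 \<eta>(1-3) by (auto simp: \<theta> \<theta>T)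
qed

subsection \<open>Global hyperbolicity\<close>

lemma fellow_same_time:
  assumes g: "quasi_geodesic M d 0 (real n) g n" and h: "quasi_geodesic M d 0 (real m) h m"
    and start: "g 0 = h 0" and near: "k \<le> m" "d (g s) (h k) \<le> c" and s: "s \<le> n" "s \<le> m"
  shows "d (g s) (h s) \<le> 2 * c"
proof -
  have M: "g 0 \<in> M" "g s \<in> M" "h k \<in> M" "h s \<in> M"
    using quasi_geodesic_in [OF g] quasi_geodesic_in [OF h] near s by auto
  have "d (g 0) (g s) = real s" "d (g 0) (h k) = real k"
    using geodesic_dist [OF g, of 0 s] geodesic_dist [OF h, of 0 k] near s start by auto
  then have "\<bar>real s - real k\<bar> \<le> c"
    using triangle [of "g 0" "g s" "h k"] triangle [of "g 0" "h k" "g s"] M near commute [of "g s" "h k"] by auto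
  moreover have "d (h k) (h s) = \<bar>real s - real k\<bar>"
    using geodesic_dist [OF h, of k s] geodesic_dist [OF h, of s k] near s commute [of "h k" "h s"]
    by (cases "k \<le> s") auto
  ultimately show ?thesis using triangle [of "g s" "h k" "h s"] M near by auto
qed

lemma gromov_hyperbolic_of_unique_local_geodesics:
  assumes unique: "\<And>\<xi> T \<eta> L. local_geodesic \<xi> T \<Longrightarrow> local_geodesic \<eta> L \<Longrightarrow> \<xi> 0 = \<eta> 0 \<Longrightarrow>
    d (\<xi> T) (\<eta> L) \<le> 1 \<Longrightarrow> fellow (10000 * D) \<xi> T \<eta> L"
  shows "gromov_hyperbolic M d"
proof -
  have straight: "d (\<alpha> s) (\<gamma> s) \<le> 30000 * D"
    if \<alpha>: "quasi_geodesic M d 0 (real A) \<alpha> A" and \<beta>: "quasi_geodesic M d 0 (real B) \<beta> B"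
      and \<gamma>: "quasi_geodesic M d 0 (real C) \<gamma> C" and ends: "\<alpha> A = \<beta> 0" "\<gamma> 0 = \<alpha> 0" "\<gamma> C = \<beta> B"
      and corner: "\<And>u v. u \<le> A \<Longrightarrow> v \<le> B \<Longrightarrow> real u \<le> 2000000 * D \<Longrightarrow> real v \<le> 2000000 * D \<Longrightarrow>
        real u + real v - 2 * D \<le> d (\<alpha> (A - u)) (\<beta> v)"
      and s: "s \<le> A" "s \<le> C"
    for \<alpha> A \<beta> B \<gamma> C s
  proof -
    define \<theta> where "\<theta> i = (if i \<le> A then \<alpha> i else \<beta> (i - A))" for i
    have \<theta>1: "\<theta> i = \<alpha> i" if "i \<le> A" for i using that by (simp add: \<theta>_def)
    have \<theta>2: "\<theta> i = \<beta> (i - A)" if "A \<le> i" for i using that ends by (auto simp: \<theta>_def)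
    have "quasi_geodesic M d (50 * D) (2000000 * D) \<theta> (A + B)"
      unfolding quasi_geodesic_def
    proof (intro conjI allI impI)
      show "\<theta> i \<in> M" if "i \<le> A + B" for i
        using that quasi_geodesic_in [OF \<alpha>] quasi_geodesic_in [OF \<beta>] by (auto simp: \<theta>_def)
      fix i j assume ij: "i \<le> j" "j \<le> A + B" "real j - real i \<le> 2000000 * D"
      consider "j \<le> A" | "A \<le> i" | "i < A" "A < j" by linarith
      then show "\<bar>d (\<theta> i) (\<theta> j) - (real j - real i)\<bar> \<le> 50 * D"
      proof cases
        case 1
        then show ?thesis using geodesic_dist [OF \<alpha> ij(1) 1] ij by (simp add: \<theta>1)
      next
        case 2
        then show ?thesis using geodesic_dist [OF \<beta>, of "i - A" "j - A"] ij by (simp add: \<theta>2 of_nat_diff)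
      next
        case 3
        define u v where "u = A - i" and "v = j - A"
        have u: "i = A - u" "u \<le> A" and v: "j = A + v" "v \<le> B" using 3 ij by (auto simp: u_def v_def)
        have uv: "real j - real i = real u + real v" using u v by (simp add: of_nat_diff)
        have "real u + real v - 2 * D \<le> d (\<alpha> i) (\<beta> v)"
          unfolding u(1) using corner [OF u(2) v(2)] ij uv by simp
        moreover have "d (\<alpha> i) (\<alpha> A) = real u" "d (\<beta> 0) (\<beta> v) = real v"
          using geodesic_dist [OF \<alpha>, of i A] geodesic_dist [OF \<beta>, of 0 v] u v by (auto simp: of_nat_diff)
        moreover have "\<alpha> i \<in> M" "\<alpha> A \<in> M" "\<beta> v \<in> M"
          using quasi_geodesic_in [OF \<alpha>] quasi_geodesic_in [OF \<beta>] u v 3 by auto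
        ultimately show ?thesis
          using triangle [of "\<alpha> i" "\<alpha> A" "\<beta> v"] uv 3 ends by (auto simp: \<theta>1 \<theta>2 v_def [symmetric])
      qed
    qed
    from straighten [OF this] obtain \<eta> L where \<eta>: "local_geodesic \<eta> L" "\<eta> 0 = \<theta> 0" "\<eta> L = \<theta> (A + B)"
        "fellow (2100 * D) \<theta> (A + B) \<eta> L" by blast
    have ends': "\<eta> 0 = \<gamma> 0" "\<eta> L = \<gamma> C" using \<eta>(2,3) ends \<theta>1 [of 0] \<theta>2 [of "A + B"] by auto
    have "fellow (10000 * D) \<eta> L \<gamma> C"
      by (rule unique [OF \<eta>(1) geodesic_local [OF \<gamma>]]) (use ends' quasi_geodesic_in [OF \<gamma>, of C] in auto)
    then obtain k where k: "\<And>i. i \<le> L \<Longrightarrow> k i \<le> C \<and> d (\<eta> i) (\<gamma> (k i)) \<le> 10000 * D"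
      unfolding fellow_def by blast
    obtain j where j: "\<And>i. i \<le> A + B \<Longrightarrow> j i \<le> L \<and> d (\<theta> i) (\<eta> (j i)) \<le> 2100 * D"
      using \<eta>(4) unfolding fellow_def by blast
    have "j s \<le> L" "d (\<alpha> s) (\<eta> (j s)) \<le> 2100 * D" using j [of s] s by (auto simp: \<theta>1)
    moreover have "k (j s) \<le> C" "d (\<eta> (j s)) (\<gamma> (k (j s))) \<le> 10000 * D" using k [of "j s"] j [of s] s by auto
    ultimately have "d (\<alpha> s) (\<gamma> (k (j s))) \<le> 15000 * D"
      using triangle [of "\<alpha> s" "\<eta> (j s)" "\<gamma> (k (j s))"] quasi_geodesic_in [OF \<alpha> s(1)]
        local_geodesic_in [OF \<eta>(1), of "j s"] quasi_geodesic_in [OF \<gamma>, of "k (j s)"] D_ge by auto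
    from fellow_same_time [OF \<alpha> \<gamma> ends(2) [symmetric] \<open>k (j s) \<le> C\<close> this s] show ?thesis by simp
  qed
  have thin: "d (g s) (h s) \<le> 80000 * D"
    if g: "quasi_geodesic M d 0 (real n) g n" and h: "quasi_geodesic M d 0 (real m) h m"
      and start: "g 0 = h 0" and s: "s \<le> n" "s \<le> m" "2 * real s \<le> real n + real m - d (g n) (h m)"
    for g n h m s
  proof -
    have o_M: "g 0 \<in> M" and "g n \<in> M" "h m \<in> M"
      using quasi_geodesic_in [OF g] quasi_geodesic_in [OF h] by auto
    then obtain \<beta> T where \<beta>: "\<beta> 0 = g n" "\<beta> T = h m" "quasi_geodesic M d 0 (real T) \<beta> T"
      using geodesic_exists by blast
    note \<beta>M = quasi_geodesic_in [OF \<beta>(3)]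
    have "\<forall>t. \<exists>c N. t \<le> T \<longrightarrow> c 0 = g 0 \<and> c N = \<beta> t \<and> quasi_geodesic M d 0 (real N) c N"
      using geodesic_exists [OF o_M \<beta>M] by blast
    then obtain c N where c: "\<And>t. t \<le> T \<Longrightarrow> c t 0 = g 0" "\<And>t. t \<le> T \<Longrightarrow> c t (N t) = \<beta> t"
      "\<And>t. t \<le> T \<Longrightarrow> quasi_geodesic M d 0 (real (N t)) (c t) (N t)" by metis
    \<comment> \<open>Absence of a corner at \<open>\<beta> t\<close>, forward or backward, is
      tested only up to \<open>2000000 * D\<close>, as far as \<open>straighten\<close>
      looks.\<close>
    define FW where "FW t \<longleftrightarrow> (\<forall>u v. u \<le> N t \<longrightarrow> v \<le> T - t \<longrightarrow> real u \<le> 2000000 * D \<longrightarrow> real v \<le> 2000000 * D \<longrightarrow>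
        real u + real v - 2 * D \<le> d (c t (N t - u)) (\<beta> (t + v)))" for t
    define BW where "BW t \<longleftrightarrow> (\<forall>u v. u \<le> N t \<longrightarrow> v \<le> t \<longrightarrow> real u \<le> 2000000 * D \<longrightarrow> real v \<le> 2000000 * D \<longrightarrow>
        real u + real v - 2 * D \<le> d (c t (N t - u)) (\<beta> (t - v)))" for t
    have cd: "d (c t (N t - u)) (\<beta> t) = real u" if "t \<le> T" "u \<le> N t" for t u
      using geodesic_dist [OF c(3) [OF that(1)], of "N t - u" "N t"] c(2) [OF that(1)] that by (simp add: of_nat_diff)
    \<comment> \<open>Corners on both sides contradict the four-point condition because
      \<open>\<beta>\<close> passes straight through \<open>\<beta> t\<close>. The two deficits may
      occur at different points of \<open>c t\<close>; going back to the farther one, at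
      \<open>w\<close>, preserves both.\<close>
    have either: "FW t \<or> BW t" if t: "t \<le> T" for t
    proof (rule ccontr)
      assume "\<not> (FW t \<or> BW t)"
      then obtain u v u' v' where
        u: "u \<le> N t" "v \<le> T - t" "real u \<le> 2000000 * D" "real v \<le> 2000000 * D"
          "d (c t (N t - u)) (\<beta> (t + v)) < real u + real v - 2 * D"
        and u': "u' \<le> N t" "v' \<le> t" "real u' \<le> 2000000 * D" "real v' \<le> 2000000 * D"
          "d (c t (N t - u')) (\<beta> (t - v')) < real u' + real v' - 2 * D"
        unfolding FW_def BW_def by (auto simp: not_le)
      define w where "w = max u u'"
      have w: "w \<le> N t" "real w \<le> 2000000 * D" "u \<le> w" "u' \<le> w" using u u' by (auto simp: w_def)
      let ?P = "c t (N t - w)"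
      have M: "?P \<in> M" "c t (N t - u) \<in> M" "c t (N t - u') \<in> M" "\<beta> t \<in> M" "\<beta> (t + v) \<in> M" "\<beta> (t - v') \<in> M"
        using quasi_geodesic_in [OF c(3) [OF t]] \<beta>M t u u' by auto
      have "d ?P (c t (N t - u)) = real w - real u" "d ?P (c t (N t - u')) = real w - real u'"
        using geodesic_dist [OF c(3) [OF t], of "N t - w" "N t - u"]
          geodesic_dist [OF c(3) [OF t], of "N t - w" "N t - u'"] w u u' by (auto simp: of_nat_diff)
      then have P: "d ?P (\<beta> (t + v)) < real w + real v - 2 * D" "d ?P (\<beta> (t - v')) < real w + real v' - 2 * D"
        using triangle [of ?P "c t (N t - u)" "\<beta> (t + v)"] triangle [of ?P "c t (N t - u')" "\<beta> (t - v')"] M u u'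
        by auto
      have b: "d (\<beta> t) (\<beta> (t + v)) = real v" "d (\<beta> t) (\<beta> (t - v')) = real v'"
          "d (\<beta> (t + v)) (\<beta> (t - v')) = real v + real v'"
        using geodesic_dist [OF \<beta>(3), of t "t + v"] geodesic_dist [OF \<beta>(3), of "t - v'" t]
          geodesic_dist [OF \<beta>(3), of "t - v'" "t + v"] t u u' commute [of "\<beta> t" "\<beta> (t - v')"]
          commute [of "\<beta> (t + v)" "\<beta> (t - v')"] by (auto simp: of_nat_diff)
      have w': "d (\<beta> t) ?P = real w" using cd [OF t w(1)] commute [of "\<beta> t" ?P] by simp
      have "d (\<beta> t) ?P + d (\<beta> (t + v)) (\<beta> (t - v'))
          \<le> max (d (\<beta> t) (\<beta> (t + v)) + d ?P (\<beta> (t - v'))) (d (\<beta> t) (\<beta> (t - v')) + d ?P (\<beta> (t + v))) + 2 * D"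
        by (rule four_point) (use M b w w' u u' in auto)
      then show False using P b w' by auto
    qed
    have "FW T"
      unfolding FW_def using cd [of T] D_ge by auto
    have "BW 0"
      unfolding BW_def using cd [of 0] D_ge by auto
    \<comment> \<open>If \<open>BW\<close> never fails, \<open>T\<close> serves for both; otherwise
      its first failure is the switch.\<close>
    have "\<exists>t t'. t \<le> T \<and> t' \<le> T \<and> (t' = t \<or> t' = Suc t) \<and> BW t \<and> FW t'"
    proof (cases "\<forall>t\<le>T. BW t")
      case True
      then show ?thesis using \<open>FW T\<close> by blast
    next
      case False
      then have ex: "\<exists>t. t \<le> T \<and> \<not> BW t" by blast
      define t where "t = (LEAST t. t \<le> T \<and> \<not> BW t)"
      have t: "t \<le> T" "\<not> BW t" using LeastI_ex [OF ex] by (auto simp: t_def)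
      then have "t \<noteq> 0" using \<open>BW 0\<close> by metis
      then obtain r where r: "t = Suc r" using not0_implies_Suc by blast
      have "BW r" using not_less_Least [of r "\<lambda>t. t \<le> T \<and> \<not> BW t"] r t(1) unfolding t_def [symmetric] by auto
      then show ?thesis using either [OF t(1)] t r by (intro exI [of _ r] exI [of _ t]) auto
    qed
    then obtain t t' where t: "t \<le> T" "t' \<le> T" "t' = t \<or> t' = Suc t" "BW t" "FW t'" by blast
    \<comment> \<open>\<open>s\<close> is at most the Gromov product of the ends of the side, which
      is at most the distance from the vertex to any of its points; so time \<open>s\<close> exists
      on every \<open>c r\<close>.\<close>
    have long: "s \<le> N r" if "r \<le> T" for r
    proof -
      have "real n = d (g 0) (g n)" "real m = d (g 0) (h m)"
        using geodesic_dist [OF g, of 0 n] geodesic_dist [OF h, of 0 m] start by auto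
      moreover have "d (g 0) (\<beta> r) = real (N r)"
        using geodesic_dist [OF c(3) [OF that], of 0 "N r"] c(1,2) [OF that] by simp
      moreover have "d (g n) (\<beta> r) = real r" "d (\<beta> r) (h m) = real T - real r" "d (g n) (h m) = real T"
        using geodesic_dist [OF \<beta>(3), of 0 r] geodesic_dist [OF \<beta>(3), of r T] geodesic_dist [OF \<beta>(3), of 0 T]
          that \<beta> by auto
      ultimately have "real s \<le> real (N r)"
        using triangle [of "g 0" "\<beta> r" "g n"] triangle [of "g 0" "\<beta> r" "h m"] o_M \<open>g n \<in> M\<close> \<open>h m \<in> M\<close> \<beta>M [OF that] s
          commute [of "g n" "\<beta> r"] by auto
      then show ?thesis by simp
    qed
    have 1: "d (c t s) (g s) \<le> 30000 * D"
    proof (rule straight [OF c(3) [OF t(1)] _ g])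
      show "quasi_geodesic M d 0 (real t) (\<lambda>v. \<beta> (t - v)) t"
        unfolding quasi_geodesic_def
      proof (intro conjI allI impI)
        show "\<beta> (t - i) \<in> M" if "i \<le> t" for i using \<beta>M [of "t - i"] t by simp
        fix i j assume "i \<le> j" "j \<le> t"
        then show "\<bar>d (\<beta> (t - i)) (\<beta> (t - j)) - (real j - real i)\<bar> \<le> 0"
          using geodesic_dist [OF \<beta>(3), of "t - j" "t - i"] t commute [of "\<beta> (t - i)" "\<beta> (t - j)"]
          by (simp add: of_nat_diff)
      qed
    qed (use c t \<beta> s long \<open>BW t\<close> in \<open>auto simp: BW_def\<close>)
    have 2: "d (c t' s) (h s) \<le> 30000 * D"
    proof (rule straight [OF c(3) [OF t(2)] _ h])
      show "quasi_geodesic M d 0 (real (T - t')) (\<lambda>v. \<beta> (t' + v)) (T - t')"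
        using \<beta>M geodesic_dist [OF \<beta>(3)] t(2) unfolding quasi_geodesic_def by auto
    qed (use c t \<beta> s long start \<open>FW t'\<close> in \<open>auto simp: FW_def\<close>)
    have "d (\<beta> t) (\<beta> t') \<le> 1"
      using t(3) geodesic_dist [OF \<beta>(3), of t t'] t \<beta>M [of t] by auto
    then have "fellow (10000 * D) (c t) (N t) (c t') (N t')"
      by (intro unique geodesic_local c) (use t c in auto)
    then obtain k where "k \<le> N t'" "d (c t s) (c t' k) \<le> 10000 * D"
      using long [OF t(1)] unfolding fellow_def by blast
    from fellow_same_time [OF c(3) [OF t(1)] c(3) [OF t(2)] _ this long [OF t(1)] long [OF t(2)]]
    have 3: "d (c t s) (c t' s) \<le> 20000 * D" using c(1) t by simp
    show ?thesis
      using 1 2 3 triangle [of "g s" "c t s" "h s"] triangle [of "c t s" "c t' s" "h s"] commute [of "c t s" "g s"]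
        quasi_geodesic_in [OF g s(1)] quasi_geodesic_in [OF h s(2)]
        quasi_geodesic_in [OF c(3) [OF t(1)] long [OF t(1)]] quasi_geodesic_in [OF c(3) [OF t(2)] long [OF t(2)]]
      by auto
  qed
  have "gromov_product d w x z \<ge> min (gromov_product d w x y) (gromov_product d w y z) - 90000 * D"
    if wxyz: "w \<in> M" "x \<in> M" "y \<in> M" "z \<in> M" for w x y z
  proof -
    obtain g n where g: "g 0 = w" "g n = x" "quasi_geodesic M d 0 (real n) g n"
      using geodesic_exists [OF wxyz(1,2)] by blast
    obtain h m where h: "h 0 = w" "h m = y" "quasi_geodesic M d 0 (real m) h m"
      using geodesic_exists [OF wxyz(1,3)] by blast
    obtain f p where f: "f 0 = w" "f p = z" "quasi_geodesic M d 0 (real p) f p"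
      using geodesic_exists [OF wxyz(1,4)] by blast
    have ds: "d w x = real n" "d w y = real m" "d w z = real p"
      using geodesic_dist [OF g(3), of 0 n] geodesic_dist [OF h(3), of 0 m] geodesic_dist [OF f(3), of 0 p] g h f
      by auto
    define v where "v = min (gromov_product d w x y) (gromov_product d w y z)"
    have gp: "0 \<le> gromov_product d w a b \<and> gromov_product d w a b \<le> d w a \<and> gromov_product d w a b \<le> d w b"
      if "a \<in> M" "b \<in> M" for a b
    proof -
      have "d a b \<le> d w a + d w b" "d w a \<le> d w b + d a b" "d w b \<le> d w a + d a b"
        using triangle [of a w b] triangle [of w b a] triangle [of w a b] wxyz(1) that
        by (simp_all add: commute [of a w] commute [of b a])
      then show ?thesis by (simp add: gromov_product_def)
    qed
    have "0 \<le> v" "v \<le> real n" "v \<le> real m" "v \<le> real p"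
      using gp [OF wxyz(2,3)] gp [OF wxyz(3,4)] unfolding v_def ds by linarith+
    define s where "s = nat \<lfloor>v\<rfloor>"
    have s: "real s \<le> v" "v < real s + 1" using \<open>0 \<le> v\<close> by (auto simp: s_def)
    then have sn: "s \<le> n" "s \<le> m" "s \<le> p"
      using \<open>v \<le> real n\<close> \<open>v \<le> real m\<close> \<open>v \<le> real p\<close> by linarith+
    have "2 * real s \<le> real n + real m - d x y" "2 * real s \<le> real m + real p - d y z"
      using s(1) ds by (auto simp: v_def gromov_product_def)
    then have "d (g s) (h s) \<le> 80000 * D" "d (h s) (f s) \<le> 80000 * D"
      using thin [OF g(3) h(3), of s] thin [OF h(3) f(3), of s] sn g h f by auto
    moreover have "d (g s) x = real n - real s" "d (f s) z = real p - real s"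
      using geodesic_dist [OF g(3), of s n] geodesic_dist [OF f(3), of s p] g f sn by auto
    moreover have "g s \<in> M" "h s \<in> M" "f s \<in> M"
      using quasi_geodesic_in [OF g(3)] quasi_geodesic_in [OF h(3)] quasi_geodesic_in [OF f(3)] sn by auto
    ultimately have "d x z \<le> real n + real p - 2 * real s + 160000 * D"
      using triangle [of x "g s" z] triangle [of "g s" "h s" z] triangle [of "h s" "f s" z] wxyz commute [of x "g s"]
      by auto
    \<comment> \<open>Halving \<open>160000 * D\<close> gives \<open>80000 * D\<close>; the rest
      absorbs rounding \<open>v\<close> down to \<open>s\<close>.\<close>
    then have "v - 90000 * D \<le> gromov_product d w x z"
      using s ds D_ge by (auto simp: gromov_product_def field_simps)
    then show ?thesis by (simp add: v_def)
  qed
  then show ?thesis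
    unfolding gromov_hyperbolic_def using Metric_space_axioms by (intro conjI exI [of _ "90000 * D"]) auto
qed

end

section \<open>Cayley graphs\<close>

context group begin

lemma word_dist_left_mult:
  assumes "g \<in> carrier G" "x \<in> carrier G" "y \<in> carrier G"
  shows "word_dist G S (g \<otimes> x) (g \<otimes> y) = word_dist G S x y"
proof -
  have "inv (g \<otimes> x) \<otimes> (g \<otimes> y) = inv x \<otimes> (inv g \<otimes> (g \<otimes> y))"
    using assms by (simp add: inv_mult_group m_assoc)
  also have "inv g \<otimes> (g \<otimes> y) = y"
    using assms by (simp add: m_assoc [symmetric])
  finally show ?thesis using assms by (simp add: word_dist_def)
qed

lemma word_dist_mult_le:
  assumes "S \<subseteq> carrier G" "x \<in> carrier G" "set t \<subseteq> S \<union> m_inv G ` S"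
  shows "word_dist G S x (x \<otimes> foldr (\<otimes>) t \<one>) \<le> real (length t)"
proof -
  have "set t \<subseteq> carrier G" using assms by auto
  then have "foldr (\<otimes>) t \<one> \<in> carrier G" by (rule foldr_closed)
  then show ?thesis using word_length_le [OF assms(3)] assms(2) by (simp add: word_dist_def m_assoc [symmetric])
qed

lemma word_dist_word:
  assumes S: "finite_generating_set G S" and "x \<in> carrier G" "y \<in> carrier G"
  obtains t where "set t \<subseteq> S \<union> m_inv G ` S" "real (length t) = word_dist G S x y" "y = x \<otimes> foldr (\<otimes>) t \<one>"
proof -
  have "inv x \<otimes> y \<in> carrier G" using assms by simp
  then obtain t where t: "length t = word_length G S (inv x \<otimes> y)" "set t \<subseteq> S \<union> m_inv G ` S"
      "set t \<subseteq> carrier G" "foldr (\<otimes>) t \<one> = inv x \<otimes> y"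
    using word_length_attained [OF S] by metis
  have xy: "x \<otimes> (inv x \<otimes> y) = y" using assms by (simp add: m_assoc [symmetric])
  show thesis
  proof (rule that [OF t(2)])
    show "real (length t) = word_dist G S x y" using t(1) assms(2,3) by (simp add: word_dist_def)
    show "y = x \<otimes> foldr (\<otimes>) t \<one>" by (simp only: t(4) xy)
  qed
qed

text \<open>The prefixes of a shortest word: upper bounds that add up to the distance of the ends
  must all be equalities.\<close>

lemma word_dist_geodesic:
  assumes S: "finite_generating_set G S" and xy: "x \<in> carrier G" "y \<in> carrier G"
  shows "\<exists>g n. g 0 = x \<and> g n = y \<and> quasi_geodesic (carrier G) (word_dist G S) 0 (real n) g n"
proof -
  interpret Metric_space "carrier G" "word_dist G S" by (rule word_dist_Metric_space [OF S])
  have SC: "S \<subseteq> carrier G" using S by (simp add: finite_generating_set_def)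
  obtain t where t: "set t \<subseteq> S \<union> m_inv G ` S" "real (length t) = word_dist G S x y" "y = x \<otimes> foldr (\<otimes>) t \<one>"
    using word_dist_word [OF S xy] .
  have tC: "set t \<subseteq> carrier G" using t(1) SC by auto
  define g where "g i = x \<otimes> foldr (\<otimes>) (take i t) \<one>" for i
  have gC: "g i \<in> carrier G" for i
    unfolding g_def using xy tC foldr_closed [of "take i t"] set_take_subset [of i t] by auto
  have le: "word_dist G S (g i) (g j) \<le> real j - real i" if "i \<le> j" "j \<le> length t" for i j
  proof -
    let ?m = "take (j - i) (drop i t)"
    have m: "set ?m \<subseteq> S \<union> m_inv G ` S" using t(1) by (meson set_drop_subset set_take_subset subset_trans)
    have C: "set (take i t) \<subseteq> carrier G" "set ?m \<subseteq> carrier G"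
      using tC by (meson set_drop_subset set_take_subset subset_trans)+
    have "take j t = take i t @ ?m" using that by (metis le_add_diff_inverse take_add)
    then have "g j = g i \<otimes> foldr (\<otimes>) ?m \<one>"
      unfolding g_def using C foldr_closed [OF C(1)] foldr_closed [OF C(2)] foldr_append_mult [OF C] xy
      by (simp add: m_assoc del: foldr_append)
    then show ?thesis using word_dist_mult_le [OF SC gC m, of i] that by (simp add: of_nat_diff)
  qed
  have ends: "g 0 = x" "g (length t) = y" using xy t by (auto simp: g_def)
  have "word_dist G S (g i) (g j) = real j - real i" if "i \<le> j" "j \<le> length t" for i j
    using le [of 0 i] le [OF that] le [of j "length t"] triangle [of x "g i" y] triangle [of "g i" "g j" y] gC xy ends t(2) that
    by auto
  then show ?thesis using ends gC unfolding quasi_geodesic_def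
    by (intro exI [of _ g] exI [of _ "length t"]) auto
qed

text \<open>Left translation by \<open>inv x\<close> moves the condition from \<open>\<one>\<close>
  to \<open>x\<close>. The defect \<open>d n / 10000000\<close> is less than
  \<open>\<delta> + 1\<close>, where \<open>\<delta>\<close> is its integer part, hence at most
  \<open>2 * \<delta>\<close>. As \<open>d\<close> is unbounded, \<open>\<delta>\<close> can be made
  at least \<open>N\<close>.\<close>

lemma locally_hyperbolic_of_real_tree_cone:
  assumes S: "finite_generating_set G S" and \<omega>: "nonprincipal_ultrafilter \<omega>" and d: "scaling_sequence d"
    and tree: "real_tree (group_cone_space G S \<omega> d) (group_cone_dist G S \<omega> d)"
  shows "\<exists>\<delta>\<ge>N. locally_hyperbolic (carrier G) (word_dist G S) \<delta>"
proof -
  let ?\<rho> = "word_dist G S"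
  interpret C: asymptotic_cone "carrier G" ?\<rho> \<one> \<omega> d
    using assms word_dist_Metric_space by (simp add: asymptotic_cone_def asymptotic_cone_axioms_def)
  let ?R = "10000000 :: real"
  let ?four_point = "\<lambda>n x y z u. ?\<rho> x y + ?\<rho> z u \<le> max (?\<rho> x z + ?\<rho> y u) (?\<rho> x u + ?\<rho> y z) + 1 / ?R * d n"
  have "eventually (\<lambda>n. \<forall>x\<in>carrier G. \<forall>y\<in>carrier G. \<forall>z\<in>carrier G. \<forall>u\<in>carrier G. ?\<rho> \<one> x \<le> d n \<longrightarrow> ?\<rho> \<one> y \<le> d n \<longrightarrow>
      ?\<rho> \<one> z \<le> d n \<longrightarrow> ?\<rho> \<one> u \<le> d n \<longrightarrow> ?four_point n x y z u) \<omega>"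
    by (rule C.eventually_four_point) (use tree in \<open>simp_all add: group_cone_space_def group_cone_dist_def\<close>)
  then have "eventually (\<lambda>n. (\<forall>x\<in>carrier G. \<forall>y\<in>carrier G. \<forall>z\<in>carrier G. \<forall>u\<in>carrier G. ?\<rho> \<one> x \<le> d n \<longrightarrow> ?\<rho> \<one> y \<le> d n \<longrightarrow>
      ?\<rho> \<one> z \<le> d n \<longrightarrow> ?\<rho> \<one> u \<le> d n \<longrightarrow> ?four_point n x y z u) \<and> ?R * (real N + 1) \<le> d n) \<omega>"
    using C.eventually_scale_ge by (rule eventually_conj)
  then obtain n where four: "\<And>x y z u. x \<in> carrier G \<Longrightarrow> y \<in> carrier G \<Longrightarrow> z \<in> carrier G \<Longrightarrow> u \<in> carrier G \<Longrightarrow>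
      ?\<rho> \<one> x \<le> d n \<Longrightarrow> ?\<rho> \<one> y \<le> d n \<Longrightarrow> ?\<rho> \<one> z \<le> d n \<Longrightarrow> ?\<rho> \<one> u \<le> d n \<Longrightarrow> ?four_point n x y z u"
    and large: "?R * (real N + 1) \<le> d n"
    using eventually_happens' [OF C.omega_nontrivial] by (metis (no_types, lifting))
  define \<delta> where "\<delta> = nat \<lfloor>d n / ?R\<rfloor>"
  have q: "real N + 1 \<le> d n / ?R" using large by simp
  then have \<delta>: "real \<delta> \<le> d n / ?R" "d n / ?R < real \<delta> + 1" unfolding \<delta>_def by linarith+
  have \<delta>N: "N \<le> \<delta>" "1 \<le> \<delta>" using q \<delta> by linarith+
  have "locally_hyperbolic (carrier G) ?\<rho> \<delta>"
  proof (rule locally_hyperbolic.intro [OF word_dist_Metric_space [OF S]], unfold_locales)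
    show "1 \<le> \<delta>" by fact
    show "\<exists>g n. g 0 = x \<and> g n = y \<and> quasi_geodesic (carrier G) ?\<rho> 0 (real n) g n"
      if "x \<in> carrier G" "y \<in> carrier G" for x y
      using word_dist_geodesic [OF S that] .
    show "?\<rho> x y + ?\<rho> z u \<le> max (?\<rho> x z + ?\<rho> y u) (?\<rho> x u + ?\<rho> y z) + 2 * real \<delta>"
      if M: "x \<in> carrier G" "y \<in> carrier G" "z \<in> carrier G" "u \<in> carrier G"
        and b: "?\<rho> x y \<le> ?R * real \<delta>" "?\<rho> x z \<le> ?R * real \<delta>" "?\<rho> x u \<le> ?R * real \<delta>" for x y z u
    proof -
      have tr: "?\<rho> (inv x \<otimes> p) (inv x \<otimes> r) = ?\<rho> p r" if "p \<in> carrier G" "r \<in> carrier G" for p r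
        using word_dist_left_mult that M(1) by simp
      have e: "?\<rho> \<one> (inv x \<otimes> p) = ?\<rho> x p" if "p \<in> carrier G" for p
        using tr [OF M(1) that] M(1) by simp
      have R: "?R * real \<delta> \<le> d n" using \<delta>(1) by simp
      have xx: "?\<rho> x x \<le> d n" using M(1) C.d_pos [of n] by simp
      have i: "inv x \<otimes> p \<in> carrier G" if "p \<in> carrier G" for p using that M(1) by simp
      have "?four_point n (inv x \<otimes> x) (inv x \<otimes> y) (inv x \<otimes> z) (inv x \<otimes> u)"
        by (rule four [OF i i i i]; (simp only: M e)?) (use b R xx in linarith)+
      then have "?four_point n x y z u" by (simp only: tr M)
      moreover have "1 / ?R * d n \<le> 2 * real \<delta>" using \<delta>(2) \<delta>N(2) by simp
      ultimately show ?thesis by linarith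
    qed
  qed
  then show ?thesis using \<delta>N by blast
qed

text \<open>The Cayley graph is coarsely simply connected, so transporting local geodesics along words depends only on the
  values of the words.\<close>

lemma local_geodesics_fellow:
  assumes S: "finite_generating_set G S" and hyp: "locally_hyperbolic (carrier G) (word_dist G S) \<delta>"
    and N: "1 \<le> N" "N \<le> \<delta>"
    and word_eq: "\<And>w w'. set w \<subseteq> S \<union> m_inv G ` S \<Longrightarrow> set w' \<subseteq> S \<union> m_inv G ` S \<Longrightarrow>
      foldr (\<otimes>) w \<one> = foldr (\<otimes>) w' \<one> \<Longrightarrow> word_eq G (S \<union> m_inv G ` S) N w w'"
    and \<xi>: "locally_hyperbolic.local_geodesic (carrier G) (word_dist G S) \<delta> \<xi> T"
    and \<eta>: "locally_hyperbolic.local_geodesic (carrier G) (word_dist G S) \<delta> \<eta> L"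
    and start: "\<xi> 0 = \<eta> 0" and near: "word_dist G S (\<xi> T) (\<eta> L) \<le> 1"
  shows "locally_hyperbolic.fellow (word_dist G S) (10000 * real \<delta>) \<xi> T \<eta> L"
proof -
  let ?\<rho> = "word_dist G S" and ?A = "S \<union> m_inv G ` S"
  interpret H: locally_hyperbolic "carrier G" ?\<rho> \<delta> by (rule hyp)
  have SC: "S \<subseteq> carrier G" using S by (simp add: finite_generating_set_def)
  \<comment> \<open>Objects are the local geodesics with the start of \<open>\<eta>\<close>, lying
    over their end points; the pair records the length, since a path is a function on all natural
    numbers.\<close>
  define Ob where "Ob = (\<lambda>(\<xi>, T). H.local_geodesic \<xi> T \<and> \<xi> 0 = \<eta> 0)"
  define rel where "rel = (\<lambda>(\<xi>, T) (\<eta>, L). H.fellow (10000 * real \<delta>) \<xi> T \<eta> L)"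
  interpret W: word_lifting G ?A N Ob "\<lambda>(\<xi>, T). \<xi> T" rel
  proof
    show "?A \<subseteq> carrier G" using SC by auto
    show "inv a \<in> ?A" if "a \<in> ?A" for a using that SC by (auto simp: subset_iff)
    show "1 \<le> N" by fact
    show "(\<lambda>(\<xi>, T). \<xi> T) p \<in> carrier G" if "Ob p" for p
      using that H.local_geodesic_in by (auto simp: Ob_def)
    show "rel p p" if "Ob p" for p
      using that H.local_geodesic_in H.D_ge unfolding Ob_def rel_def H.fellow_def
      by (auto intro!: exI [of _ "\<lambda>i. i"])
    show "\<exists>q. Ob q \<and> (\<lambda>(\<xi>, T). \<xi> T) q = (\<lambda>(\<xi>, T). \<xi> T) p \<otimes> a \<and> rel p q \<and> rel q p"
      if p: "Ob p" and a: "a \<in> ?A" for p a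
    proof -
      obtain \<alpha> n where \<alpha>: "p = (\<alpha>, n)" "H.local_geodesic \<alpha> n" "\<alpha> 0 = \<eta> 0" using p by (auto simp: Ob_def)
      have aC: "a \<in> carrier G" "\<alpha> n \<in> carrier G" using a SC H.local_geodesic_in [OF \<alpha>(2)] by auto
      then have "?\<rho> (\<alpha> n) (\<alpha> n \<otimes> a) \<le> 1"
        using word_dist_mult_le [OF SC, of "\<alpha> n" "[a]"] a by simp
      then show ?thesis
        using H.lift_step [OF \<alpha>(2), of "\<alpha> n \<otimes> a"] aC \<alpha>(1,3) unfolding Ob_def rel_def by fastforce
    qed
    show "rel p r"
      if "Ob p" "Ob q" "Ob r" "rel p q" "rel q r" "set t \<subseteq> ?A" "length t \<le> N"
        "(\<lambda>(\<xi>, T). \<xi> T) r = (\<lambda>(\<xi>, T). \<xi> T) p \<otimes> foldr (\<otimes>) t \<one>" for p q r t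
    proof -
      obtain p1 p2 q1 q2 r1 r2 where pqr: "p = (p1, p2)" "q = (q1, q2)" "r = (r1, r2)" by (metis surj_pair)
      have "p1 p2 \<in> carrier G" using that(1) H.local_geodesic_in by (auto simp: Ob_def pqr)
      then have "?\<rho> (p1 p2) (r1 r2) \<le> real N"
        using word_dist_mult_le [OF SC _ that(6), of "p1 p2"] that(7,8) by (simp add: pqr)
      \<comment> \<open>Here the scale beats the relators: \<open>N \<le> \<delta>\<close> puts the
        ends within the range of \<open>fellow_trans\<close>.\<close>
      then have "?\<rho> (p1 p2) (r1 r2) \<le> 100 * real \<delta>" using N by linarith
      then show ?thesis
        using that(1-5) H.fellow_trans [of p1 p2 q1 q2 r1 r2] by (simp add: pqr Ob_def rel_def)
    qed
  qed
  \<comment> \<open>A local geodesic is itself a lift of its label: its initial segments, beginning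
    with a constant path, form the chain of objects.\<close>
  have lifts_prefix: "n \<le> m \<Longrightarrow> \<exists>w. W.lifts (\<alpha>, 0) w (\<alpha>, n)"
    if \<alpha>: "H.local_geodesic \<alpha> m" "\<alpha> 0 = \<eta> 0" for \<alpha> m n
  proof (induction n)
    case 0
    have "Ob (\<alpha>, 0)" using \<alpha> unfolding Ob_def H.local_geodesic_def by (auto intro: quasi_geodesic_mono)
    then show ?case by (intro exI [of _ "[]"] W.lifts.Nil)
  next
    case (Suc n)
    then obtain w where w: "W.lifts (\<alpha>, 0) w (\<alpha>, n)" by auto
    have Ob: "Ob (\<alpha>, n)" "Ob (\<alpha>, Suc n)"
      using \<alpha> Suc.prems unfolding Ob_def H.local_geodesic_def by (auto intro: quasi_geodesic_mono)
    have M: "\<alpha> i \<in> carrier G" if "i \<le> Suc n" for i using H.local_geodesic_in [OF \<alpha>(1)] that Suc.prems by simp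
    have one: "?\<rho> (\<alpha> n) (\<alpha> (Suc n)) = 1" using H.local_geodesic_step [OF \<alpha>(1)] Suc.prems by simp
    obtain t where t: "set t \<subseteq> ?A" "real (length t) = ?\<rho> (\<alpha> n) (\<alpha> (Suc n))" "\<alpha> (Suc n) = \<alpha> n \<otimes> foldr (\<otimes>) t \<one>"
      using word_dist_word [OF S M M, of n "Suc n"] by auto
    then have "length t = 1" using one by simp
    then obtain a where a: "t = [a]" by (auto simp: length_Suc_conv)
    have "rel (\<alpha>, n) (\<alpha>, Suc n)" "rel (\<alpha>, Suc n) (\<alpha>, n)"
      using H.fellow_prefix [OF M] one by (auto simp: rel_def)
    then have "W.lifts (\<alpha>, n) [a] (\<alpha>, Suc n)"
      using Ob t a SC M by (intro W.lifts.Cons [OF _ _ _ _ _ _ W.lifts.Nil]) auto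
    then show ?case using W.lifts_appendI [OF w] by blast
  qed
  obtain w where w: "W.lifts (\<xi>, 0) w (\<xi>, T)" using lifts_prefix [OF \<xi> start] by blast
  obtain w' where w': "W.lifts (\<eta>, 0) w' (\<eta>, L)" using lifts_prefix [OF \<eta>] by blast
  have M: "\<xi> T \<in> carrier G" "\<eta> L \<in> carrier G" "\<eta> 0 \<in> carrier G"
    using H.local_geodesic_in [OF \<xi>] H.local_geodesic_in [OF \<eta>] by auto
  \<comment> \<open>The word \<open>t\<close>, of length at most 1, closes the gap between the ends,
    so that \<open>w\<close> and \<open>w' @ t\<close> have the same value.\<close>
  obtain t where t: "set t \<subseteq> ?A" "real (length t) = ?\<rho> (\<eta> L) (\<xi> T)" "\<xi> T = \<eta> L \<otimes> foldr (\<otimes>) t \<one>"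
    using word_dist_word [OF S M(2,1)] .
  have short: "length t \<le> N" using t(2) near N(1) H.commute [of "\<xi> T" "\<eta> L"] by simp
  have sets: "set w \<subseteq> ?A" "set w' \<subseteq> ?A" using W.lifts_Ob w w' by blast+
  have Ob: "Ob (\<xi>, 0)" "Ob (\<xi>, T)" "Ob (\<eta>, 0)" "Ob (\<eta>, L)" using W.lifts_Ob w w' by blast+
  obtain \<theta> where \<theta>: "W.lifts (\<eta>, L) t \<theta>" using W.lifts_exists [OF Ob(4) t(1)] by blast
  obtain \<zeta> where \<zeta>: "W.lifts (\<xi>, 0) (w' @ t) \<zeta>" using W.lifts_exists [OF Ob(1), of "w' @ t"] sets t by auto
  note lift_w' = W.lifts_appendI [OF w' \<theta>]
  have C: "set w \<subseteq> carrier G" "set w' \<subseteq> carrier G" "set t \<subseteq> carrier G" using sets t(1) W.A(1) by blast+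
  have e: "\<xi> T = \<eta> 0 \<otimes> foldr (\<otimes>) w \<one>" "\<eta> L = \<eta> 0 \<otimes> foldr (\<otimes>) w' \<one>"
    using W.lifts_end [OF w] W.lifts_end [OF w'] start by auto
  have "\<eta> 0 \<otimes> foldr (\<otimes>) w \<one> = \<eta> 0 \<otimes> foldr (\<otimes>) (w' @ t) \<one>"
    using e t(3) foldr_append_mult [OF C(2,3)] foldr_closed [OF C(2)] foldr_closed [OF C(3)] M by (simp add: m_assoc)
  then have "foldr (\<otimes>) w \<one> = foldr (\<otimes>) (w' @ t) \<one>"
    using M(3) foldr_closed [OF C(1)] foldr_closed [of "w' @ t"] C by (simp del: foldr_append)
  then have "word_eq G ?A N w (w' @ t)" using sets t by (intro word_eq) auto
  then have 1: "rel (\<xi>, T) \<zeta>" using W.lifts_word_eq w \<zeta> by blast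
  \<comment> \<open>Both are constant paths at the common start but may differ as pairs, so the two
    lifts of \<open>w' @ t\<close> are compared by uniqueness up to \<open>rel\<close>.\<close>
  have "rel (\<xi>, 0) (\<eta>, 0)"
    using start M H.D_ge unfolding rel_def H.fellow_def by (auto intro!: exI [of _ "\<lambda>_. 0"])
  then have 2: "rel \<zeta> \<theta>" using W.lifts_unique [OF \<zeta> lift_w'] start by simp
  have 3: "rel \<theta> (\<eta>, L)" using W.lifts_short [OF \<theta> short] by blast
  have Ob': "Ob \<zeta>" "Ob \<theta>" using W.lifts_Ob \<zeta> \<theta> by blast+
  have ends: "(\<lambda>(\<xi>, T). \<xi> T) \<theta> = \<xi> T" using W.lifts_end [OF \<theta>] t(3) by simp
  have 4: "rel (\<xi>, T) \<theta>" by (rule W.rel_trans_same_end [OF Ob(2) Ob' 1 2]) (use ends in simp)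
  obtain t' where t': "set t' \<subseteq> ?A" "real (length t') = ?\<rho> (\<xi> T) (\<eta> L)" "\<eta> L = \<xi> T \<otimes> foldr (\<otimes>) t' \<one>"
    using word_dist_word [OF S M(1,2)] .
  have "length t' \<le> N" using t'(2) near N(1) by simp
  then have "rel (\<xi>, T) (\<eta>, L)"
    using W.rel_trans [OF Ob(2) Ob'(2) Ob(4) 4 3 t'(1)] t'(3) by simp
  then show ?thesis by (simp add: rel_def)
qed

end

theorem theorem8p1:
  fixes G :: "('a, 'b) monoid_scheme" and S :: "'a set"
  assumes "group G"
    and "finitely_presented G"
    and "finite_generating_set G S"
    and "\<exists>\<omega> d. nonprincipal_ultrafilter \<omega> \<and> scaling_sequence d \<and>
           real_tree (group_cone_space G S \<omega> d) (group_cone_dist G S \<omega> d)"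
  shows "hyperbolic_group G"
proof -
  interpret group G by fact
  obtain N where N: "1 \<le> N" and word_eq: "\<And>w w'. set w \<subseteq> S \<union> m_inv G ` S \<Longrightarrow> set w' \<subseteq> S \<union> m_inv G ` S \<Longrightarrow>
      foldr (\<otimes>\<^bsub>G\<^esub>) w \<one>\<^bsub>G\<^esub> = foldr (\<otimes>\<^bsub>G\<^esub>) w' \<one>\<^bsub>G\<^esub> \<Longrightarrow> word_eq G (S \<union> m_inv G ` S) N w w'"
    using finitely_presented_word_eq [OF assms(2,3)] by blast
  obtain \<delta> where \<delta>: "N \<le> \<delta>" "locally_hyperbolic (carrier G) (word_dist G S) \<delta>"
    using locally_hyperbolic_of_real_tree_cone [OF assms(3)] assms(4) by blast
  have "gromov_hyperbolic (carrier G) (word_dist G S)"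
    by (rule locally_hyperbolic.gromov_hyperbolic_of_unique_local_geodesics [OF \<delta>(2)])
      (rule local_geodesics_fellow [OF assms(3) \<delta>(2) N \<delta>(1) word_eq])
  then show ?thesis
    unfolding hyperbolic_group_def using assms(3) by blast
qed

end
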